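(* Let $q\in\mathbb{C}^\times$ be a root of unity with $l\ge2$ minimal such that $q^{2l}=1$ and $\delta=q+q^{-1}\ge0$. Let $\chi_{\infty,l}$ be an extremal trace on $TL_\infty(\delta)$ with parameter $\gamma$, and write its restriction to $TL_n$ in terms of the traces of irreducible representations as $\chi^{(n)}_{\infty,l}=\sum_i\lambda_{n,i}l_{n,i}$. Then the coefficients satisfy $$\lambda_{0,0}=\begin{cases}0&l=2\\1&\text{otherwise}\end{cases},\qquad\lambda_{1,0}=1,\qquad\lambda_{n,i}=\gamma^i\lambda_{n-2i,0}\quad(0\le i\le\lfloor n/2\rfloor),$$ and, for all $n\ge1$, $$\lambda_{n,0}=\begin{cases}c_{n,0}&\text{if }(n,0)\text{ is critical, i.e. } l\mid n+1\\ c_{n,0}+\gamma^{j}c_{n-2j,0}&\text{otherwise}\end{cases}$$ where $j\in\{0,\dots,l-1\}$ is the residue of $n+1$ modulo $l$, and $c_{m,0}:=0$ for $m<0$.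
   Context: $TL_n(\delta)$ is the unital complex algebra with generators $e_1,\dots,e_{n-1}$ and relations $e_i^2=\delta e_i$, $e_ie_{i\pm1}e_i=e_i$, $e_ie_j=e_je_i$ for $|i-j|>1$; $TL_\infty=\bigcup_nTL_n$. A trace is a linear functional $t$ with $t(ab)=t(ba)$. The standard representation $\mathcal{V}_{n,p}$, $0\le p\le\lfloor n/2\rfloor$, has basis the $(n,p)$-link states (top halves of planar Temperley-Lieb diagrams on $n$ points with $p$ cups and $n-2p$ through strands), with action by concatenation, closed loops replaced by $\delta$ and results with more than $p$ cups set to zero. $\mathcal{L}_{n,p}$ is the irreducible quotient of $\mathcal{V}_{n,p}$; these form a complete set of irreducibles, with $0\le p\le\lfloor n/2\rfloor$, except that for $l=2$ and $n$ even only $0\le p\le\frac n2-1$ occurs (in that case the coefficient $\lambda_{n,n/2}$ is taken to be $0$). $t_{n,p}$ and $l_{n,p}$ are the un-normalized matrix traces on $\mathcal{V}_{n,p}$ and $\mathcal{L}_{n,p}$. Extremal traces at roots of unity: these satisfy the same conditions as in the generic case, i.e. the restriction of $\chi_{\infty,l}$ to $TL_n$ is $\sum_ic_{n,i}t_{n,i}$ with, for some parameter $\gamma$, $c_{0,0}=c_{1,0}=1$, $c_{n,0}=c_{n-1,0}-\gamma c_{n-2,0}$ for $n\ge2$, $c_{n,i}=\gamma^ic_{n-2i,0}$ (equivalently $c_{n,0}=[n+1]_r/([2]_r)^n$ with $\gamma=([2]_r)^{-2}$, $[n]_r=\frac{r^n-r^{-n}}{r-r^{-1}}$). *)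

theory Defs
  imports Complex_Main "HOL-Library.Poly_Mapping" "HOL-Combinatorics.Permutations"
    "HOL-Algebra.QuotRing"
begin

section \<open>Free complex vector spaces\<close>

text \<open>\<^typ>\<open>'a \<Rightarrow>\<^sub>0 complex\<close> is the complex vector space with basis \<^typ>\<open>'a\<close>.\<close>

definition cscale :: "complex \<Rightarrow> ('a \<Rightarrow>\<^sub>0 complex) \<Rightarrow> ('a \<Rightarrow>\<^sub>0 complex)" where
  "cscale c v = Poly_Mapping.map ((*) c) v"

lemma lookup_cscale: "Poly_Mapping.lookup (cscale c v) x = c * Poly_Mapping.lookup v x"
  unfolding cscale_def by (simp add: Poly_Mapping.map.rep_eq when_def)

global_interpretation free_vs: vector_space "cscale :: complex \<Rightarrow> ('a \<Rightarrow>\<^sub>0 complex) \<Rightarrow> _"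
  by unfold_locales
    (auto intro!: poly_mapping_eqI simp: lookup_cscale Poly_Mapping.lookup_add algebra_simps)

text \<open>
  The trace of the endomorphism of \<open>U / W\<close> induced by \<open>T\<close>: extend a basis \<open>C\<close> of \<open>W\<close> to a basis
  \<open>B\<close> of \<open>U\<close>; the classes of the elements of \<open>B - C\<close> form a basis of \<open>U / W\<close>.
  It is meant for finite-dimensional \<open>U\<close> and for \<open>T\<close> preserving \<open>W \<subseteq> U\<close>.
\<close>

definition quotient_trace ::
  "('a \<Rightarrow>\<^sub>0 complex) set \<Rightarrow> ('a \<Rightarrow>\<^sub>0 complex) set \<Rightarrow> (('a \<Rightarrow>\<^sub>0 complex) \<Rightarrow> ('a \<Rightarrow>\<^sub>0 complex)) \<Rightarrow> complex"
where
  "quotient_trace U W T =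
     (THE t. \<exists>B C. free_vs.independent B \<and> free_vs.span B = U \<and> C \<subseteq> B \<and> free_vs.span C = W \<and>
        t = (\<Sum>b\<in>B - C. free_vs.representation B (T b) b))"


section \<open>Temperley-Lieb algebras\<close>

text \<open>Words in the generators, written additively to match \<^theory>\<open>HOL-Library.Poly_Mapping\<close>:
  the convolution product makes \<open>word \<Rightarrow>\<^sub>0 complex\<close> the free algebra on \<open>e\<^sub>0, e\<^sub>1, \<dots>\<close>.\<close>

datatype word = Word (letters: "nat list")

instantiation word :: monoid_add
begin

definition zero_word :: word where "0 = Word []"

definition plus_word :: "word \<Rightarrow> word \<Rightarrow> word" where
  "u + v = Word (letters u @ letters v)"

instance
  by intro_classes (simp_all add: zero_word_def plus_word_def)

end

definition gen :: "nat \<Rightarrow> (word \<Rightarrow>\<^sub>0 complex)" where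
  "gen i = Poly_Mapping.single (Word [i]) 1"

definition free_algebra :: "nat set \<Rightarrow> (word \<Rightarrow>\<^sub>0 complex) ring" where
  "free_algebra G =
     \<lparr>carrier = {a. \<forall>u\<in>Poly_Mapping.keys a. set (letters u) \<subseteq> G},
      mult = (*), one = 1, zero = 0, add = (+)\<rparr>"

definition tl_relators :: "complex \<Rightarrow> nat set \<Rightarrow> (word \<Rightarrow>\<^sub>0 complex) set" where
  "tl_relators \<delta> G =
     {gen i * gen i - cscale \<delta> (gen i) | i. i \<in> G} \<union>
     {gen i * gen j * gen i - gen i | i j. i \<in> G \<and> j \<in> G \<and> (j = i + 1 \<or> i = j + 1)} \<union>
     {gen i * gen j - gen j * gen i | i j. i \<in> G \<and> j \<in> G \<and> (i + 1 < j \<or> j + 1 < i)}"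

definition tl_ideal :: "complex \<Rightarrow> nat set \<Rightarrow> (word \<Rightarrow>\<^sub>0 complex) set" where
  "tl_ideal \<delta> G = genideal (free_algebra G) (tl_relators \<delta> G)"

definition tl_algebra :: "complex \<Rightarrow> nat set \<Rightarrow> (word \<Rightarrow>\<^sub>0 complex) set ring" where
  "tl_algebra \<delta> G = free_algebra G Quot tl_ideal \<delta> G"

definition TL :: "complex \<Rightarrow> nat \<Rightarrow> (word \<Rightarrow>\<^sub>0 complex) set ring" where
  "TL \<delta> n = tl_algebra \<delta> {1..<n}"

text \<open>The union of the \<open>TL \<delta> n\<close> along \<open>e\<^sub>i \<mapsto> e\<^sub>i\<close> is presented by all generators and relations.\<close>

definition TL_inf :: "complex \<Rightarrow> (word \<Rightarrow>\<^sub>0 complex) set ring" where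
  "TL_inf \<delta> = tl_algebra \<delta> {1..}"

text \<open>The inclusion of \<open>TL \<delta> n\<close> into \<^term>\<open>TL_inf \<delta>\<close>; it sends the coset of \<open>a\<close> to the coset of \<open>a\<close>.\<close>

definition tl_incl :: "complex \<Rightarrow> (word \<Rightarrow>\<^sub>0 complex) set \<Rightarrow> (word \<Rightarrow>\<^sub>0 complex) set" where
  "tl_incl \<delta> X = tl_ideal \<delta> {1..} <+>\<^bsub>free_algebra {1..}\<^esub> X"

text \<open>The multiple \<open>c \<cdot> 1\<close> of the unit of \<^term>\<open>TL_inf \<delta>\<close>.\<close>

definition tl_scalar :: "complex \<Rightarrow> complex \<Rightarrow> (word \<Rightarrow>\<^sub>0 complex) set" where
  "tl_scalar \<delta> c = tl_ideal \<delta> {1..} +>\<^bsub>free_algebra {1..}\<^esub> Poly_Mapping.single 0 c"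

definition is_trace_inf :: "complex \<Rightarrow> ((word \<Rightarrow>\<^sub>0 complex) set \<Rightarrow> complex) \<Rightarrow> bool" where
  "is_trace_inf \<delta> t \<longleftrightarrow>
     (\<forall>a\<in>carrier (TL_inf \<delta>). \<forall>b\<in>carrier (TL_inf \<delta>).
        t (a \<oplus>\<^bsub>TL_inf \<delta>\<^esub> b) = t a + t b \<and> t (a \<otimes>\<^bsub>TL_inf \<delta>\<^esub> b) = t (b \<otimes>\<^bsub>TL_inf \<delta>\<^esub> a)) \<and>
     (\<forall>c. \<forall>a\<in>carrier (TL_inf \<delta>). t (tl_scalar \<delta> c \<otimes>\<^bsub>TL_inf \<delta>\<^esub> a) = c * t a)"


section \<open>Standard representations\<close>

text \<open>
  A link state on the points \<open>1, \<dots>, n\<close> is encoded as the involution exchanging the two ends of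
  each cup; its fixed points are the through strands. A point strictly inside a cup must
  be joined to another point inside that cup: cups do not cross, and no through strand is
  enclosed by a cup.
\<close>

type_synonym link = "nat \<Rightarrow> nat"

definition link_states :: "nat \<Rightarrow> nat \<Rightarrow> link set" where
  "link_states n p =
     {w. w permutes {1..n} \<and> (\<forall>k. w (w k) = k) \<and>
         (\<forall>a b. a < b \<and> b < w a \<longrightarrow> a < w b \<and> w b < w a \<and> w b \<noteq> b) \<and>
         card {k \<in> {1..n}. w k \<noteq> k} = 2 * p}"

text \<open>
  Concatenation of \<open>e\<^sub>i\<close> with a link state \<open>w\<close> that does not join \<open>i\<close> to \<open>i + 1\<close> and where these are
  not both through strands: \<open>i\<close> and \<open>i + 1\<close> become joined, and so do their former partners; if one
  of \<open>i\<close>, \<open>i + 1\<close> was a through strand, the partner of the other becomes a through strand.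
\<close>

definition link_join :: "nat \<Rightarrow> link \<Rightarrow> link" where
  "link_join i w = (\<lambda>k.
     if k = i then i + 1
     else if k = i + 1 then i
     else if k = w i then (if w (i + 1) = i + 1 then k else w (i + 1))
     else if k = w (i + 1) then (if w i = i then k else w i)
     else w k)"

text \<open>If \<open>i\<close> and \<open>i + 1\<close> are both through strands, concatenation with \<open>e\<^sub>i\<close> creates an additional cup.\<close>

definition link_act :: "complex \<Rightarrow> nat \<Rightarrow> link \<Rightarrow> (link \<Rightarrow>\<^sub>0 complex)" where
  "link_act \<delta> i w =
     (if w i = i + 1 then Poly_Mapping.single w \<delta>
      else if w i = i \<and> w (i + 1) = i + 1 then 0
      else Poly_Mapping.single (link_join i w) 1)"

definition std_module :: "nat \<Rightarrow> nat \<Rightarrow> (link \<Rightarrow>\<^sub>0 complex) set" where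
  "std_module n p = {v. Poly_Mapping.keys v \<subseteq> link_states n p}"

definition gen_op :: "complex \<Rightarrow> nat \<Rightarrow> nat \<Rightarrow> nat \<Rightarrow> (link \<Rightarrow>\<^sub>0 complex) \<Rightarrow> (link \<Rightarrow>\<^sub>0 complex)" where
  "gen_op \<delta> n p i v =
     (\<Sum>w\<in>link_states n p. cscale (Poly_Mapping.lookup v w) (link_act \<delta> i w))"

definition free_op ::
  "complex \<Rightarrow> nat \<Rightarrow> nat \<Rightarrow> (word \<Rightarrow>\<^sub>0 complex) \<Rightarrow> (link \<Rightarrow>\<^sub>0 complex) \<Rightarrow> (link \<Rightarrow>\<^sub>0 complex)" where
  "free_op \<delta> n p a v =
     (\<Sum>u\<in>Poly_Mapping.keys a.
        cscale (Poly_Mapping.lookup a u) (foldr (gen_op \<delta> n p) (letters u) v))"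

text \<open>All representatives of an element of \<open>TL \<delta> n\<close> act by the same operator, because the \<open>gen_op\<close>
  satisfy the defining relations.\<close>

definition tl_op ::
  "complex \<Rightarrow> nat \<Rightarrow> nat \<Rightarrow> (word \<Rightarrow>\<^sub>0 complex) set \<Rightarrow> (link \<Rightarrow>\<^sub>0 complex) \<Rightarrow> (link \<Rightarrow>\<^sub>0 complex)" where
  "tl_op \<delta> n p X = the_elem (free_op \<delta> n p ` X)"

definition std_trace :: "complex \<Rightarrow> nat \<Rightarrow> nat \<Rightarrow> (word \<Rightarrow>\<^sub>0 complex) set \<Rightarrow> complex" where
  "std_trace \<delta> n p X =
     (\<Sum>w\<in>link_states n p. Poly_Mapping.lookup (tl_op \<delta> n p X (Poly_Mapping.single w 1)) w)"


section \<open>Irreducible quotients\<close>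

definition std_submodule :: "complex \<Rightarrow> nat \<Rightarrow> nat \<Rightarrow> (link \<Rightarrow>\<^sub>0 complex) set \<Rightarrow> bool" where
  "std_submodule \<delta> n p W \<longleftrightarrow>
     free_vs.subspace W \<and> W \<subseteq> std_module n p \<and>
     (\<forall>X\<in>carrier (TL \<delta> n). tl_op \<delta> n p X ` W \<subseteq> W)"

text \<open>The kernel of the projection of the standard representation onto its irreducible quotient,
  that is, the maximal proper submodule, which is unique for the pairs \<open>(n, p)\<close> that label an
  irreducible representation (\<open>irr_labels\<close> below).\<close>

definition max_submodule :: "complex \<Rightarrow> nat \<Rightarrow> nat \<Rightarrow> (link \<Rightarrow>\<^sub>0 complex) set" where
  "max_submodule \<delta> n p =
     (THE W. std_submodule \<delta> n p W \<and> W \<noteq> std_module n p \<and>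
        (\<forall>W'. std_submodule \<delta> n p W' \<and> W \<subseteq> W' \<longrightarrow> W' = W \<or> W' = std_module n p))"

definition irr_trace :: "complex \<Rightarrow> nat \<Rightarrow> nat \<Rightarrow> (word \<Rightarrow>\<^sub>0 complex) set \<Rightarrow> complex" where
  "irr_trace \<delta> n p X = quotient_trace (std_module n p) (max_submodule \<delta> n p) (tl_op \<delta> n p X)"

definition irr_labels :: "nat \<Rightarrow> nat \<Rightarrow> nat set" where
  "irr_labels l n = {p. p \<le> n div 2 \<and> \<not> (l = 2 \<and> even n \<and> p = n div 2)}"


section \<open>Extremal traces\<close>

fun ext_rec :: "complex \<Rightarrow> nat \<Rightarrow> complex" where
  "ext_rec \<gamma> 0 = 1"
| "ext_rec \<gamma> (Suc 0) = 1"
| "ext_rec \<gamma> (Suc (Suc n)) = ext_rec \<gamma> (Suc n) - \<gamma> * ext_rec \<gamma> n"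

text \<open>\<open>c\<^sub>m\<^sub>,\<^sub>0\<close>, extended by \<open>0\<close> to negative \<open>m\<close>.\<close>

definition ext_coeff0 :: "complex \<Rightarrow> int \<Rightarrow> complex" where
  "ext_coeff0 \<gamma> m = (if m < 0 then 0 else ext_rec \<gamma> (nat m))"

definition ext_coeff :: "complex \<Rightarrow> nat \<Rightarrow> nat \<Rightarrow> complex" where
  "ext_coeff \<gamma> n i = \<gamma> ^ i * ext_coeff0 \<gamma> (int n - 2 * int i)"

definition extremal_trace ::
  "complex \<Rightarrow> complex \<Rightarrow> ((word \<Rightarrow>\<^sub>0 complex) set \<Rightarrow> complex) \<Rightarrow> bool" where
  "extremal_trace \<delta> \<gamma> \<chi> \<longleftrightarrow>
     is_trace_inf \<delta> \<chi> \<and>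
     (\<forall>n. \<forall>X\<in>carrier (TL \<delta> n).
        \<chi> (tl_incl \<delta> X) = (\<Sum>i\<le>n div 2. ext_coeff \<gamma> n i * std_trace \<delta> n i X))"

text \<open>
  \<open>lam n i\<close> are the coefficients of \<open>\<chi>\<close> restricted to \<open>TL \<delta> n\<close> with respect to the traces of the
  irreducible representations. For \<open>l = 2\<close> and even \<open>n\<close> there is no irreducible representation
  labelled \<open>n / 2\<close> and its coefficient is \<open>0\<close> by convention. For \<open>l = 2\<close> and \<open>n = 0\<close> this leaves no
  label at all, so there is no expansion in this case, only the convention.
\<close>

definition irr_coeffs ::
  "nat \<Rightarrow> complex \<Rightarrow> ((word \<Rightarrow>\<^sub>0 complex) set \<Rightarrow> complex) \<Rightarrow> (nat \<Rightarrow> nat \<Rightarrow> complex) \<Rightarrow> bool" where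
  "irr_coeffs l \<delta> \<chi> lam \<longleftrightarrow>
     (\<forall>n. \<not> (l = 2 \<and> n = 0) \<longrightarrow>
        (\<forall>X\<in>carrier (TL \<delta> n).
           \<chi> (tl_incl \<delta> X) = (\<Sum>i\<in>irr_labels l n. lam n i * irr_trace \<delta> n i X))) \<and>
     (\<forall>n. l = 2 \<and> even n \<longrightarrow> lam n (n div 2) = 0)"

end

theory Submission
  imports Defs "HOL-Library.Function_Algebras" "HOL-Computational_Algebra.Polynomial"
begin

text \<open>
  The standard representation \<open>V\<^sub>n\<^sub>,\<^sub>p\<close> is realised in the \<open>n\<close>-th tensor power of the spin
  representation of quantum \<open>sl\<^sub>2\<close>: \<open>True\<close> is a down spin, a through strand is an up spin, and a cup
  is the vector \<open>(up, down) + q (down, up)\<close>. There the raising operator annihilates \<open>V\<^sub>n\<^sub>,\<^sub>p\<close> and the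
  lowering operator commutes with the action.

  Capping off cups in a nonzero proper submodule of \<open>V\<^sub>n\<^sub>,\<^sub>p\<close> exhibits the trivial representation (all
  \<open>e\<^sub>j\<close> act as \<open>0\<close>) as a subquotient of some \<open>V\<^sub>m\<^sub>,\<^sub>k\<close> with \<open>m = n - 2i\<close>, \<open>k = p - i > 0\<close>. A vector
  annihilated by all \<open>e\<^sub>j\<close> is a multiple of the \<open>q\<close>-symmetric one, and Gaussian binomials at the root of
  unity show that this requires \<open>k < l\<close> and \<open>l dvd m + 1 - k\<close>, which determines \<open>i\<close>.
  The only nonzero proper submodule is then the image of \<open>V\<^sub>n\<^sub>,\<^sub>i\<close> under the \<open>k\<close>-th power of the lowering
  operator, and this image is \<open>L\<^sub>n\<^sub>,\<^sub>i\<close>. Hence \<open>t\<^sub>n\<^sub>,\<^sub>p = l\<^sub>n\<^sub>,\<^sub>p + l\<^sub>n\<^sub>,\<^sub>i\<close>, to be substituted into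
  \<open>\<Sum>\<^sub>p c\<^sub>n\<^sub>,\<^sub>p t\<^sub>n\<^sub>,\<^sub>p\<close>. The \<open>l\<^sub>n\<^sub>,\<^sub>p\<close> are linearly independent because a product with \<open>p\<close> consecutive caps and
  cups has nonzero trace on \<open>L\<^sub>n\<^sub>,\<^sub>p\<close> and acts as \<open>0\<close> on \<open>L\<^sub>n\<^sub>,\<^sub>i\<close> for \<open>i < p\<close>.
\<close>

section \<open>The tensor space model\<close>

text \<open>In tensor space a submodule is a set of functions on which capping, inserting a cup and
  deleting the last point are explicit linear maps; the argument needs neither an invariant form nor
  semisimplicity. The obstacle is that a trivial subquotient B/A need not come from a singular
  vector: a representative is annihilated only modulo A. The classification therefore runs by
  induction on the number of points. Restriction to one point fewer yields a second congruence
  modulo l; compared with the one obtained by capping, it leaves a single hard case. There a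
  representative is corrected to a true singular vector by solving a tridiagonal system with
  determinant the quantum integer [m+2]. The classification in turn bounds chains of submodules,
  which makes the maximal submodule unique. For l = 2 and n = 2p the image of the lowering operator
  is all of V_{n,p}: this is the missing label. As \<open>loop\<close> vanishes there, cups are
  removed by zigzags wherever a further point exists, not by division.\<close>

definition fscale :: "complex \<Rightarrow> ('a \<Rightarrow> complex) \<Rightarrow> ('a \<Rightarrow> complex)" where
  "fscale c f = (\<lambda>x. c * f x)"

global_interpretation fun_vs: vector_space "fscale :: complex \<Rightarrow> ('a \<Rightarrow> complex) \<Rightarrow> _"
  by unfold_locales (auto simp: fscale_def fun_eq_iff algebra_simps)

lemma fscale_apply [simp]: "fscale c f x = c * f x"
  by (simp add: fscale_def)

lemma sum_fun_apply: "(\<Sum>i\<in>A. f i) x = (\<Sum>i\<in>A. f i x)"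
  for f :: "'i \<Rightarrow> 'a \<Rightarrow> complex"
  by (induction A rule: infinite_finite_induct) auto

type_synonym spins = "nat \<Rightarrow> bool"
type_synonym tensor = "spins \<Rightarrow> complex"

definition downs :: "spins \<Rightarrow> nat set" where
  "downs S = {i. S i}"

lemma downs_iff [simp]: "i \<in> downs S \<longleftrightarrow> S i"
  by (simp add: downs_def)

text \<open>All tensor powers share one function type; the number of points and the weight are
  imposed by the support alone. An up spin is \<open>False\<close>, so appending a point with spin
  up leaves the function unchanged, and V_{n,p} is literally contained in V_{n+1,p}.\<close>

definition graded :: "nat \<Rightarrow> nat \<Rightarrow> tensor set" where
  "graded n k = {f. \<forall>S. f S \<noteq> 0 \<longrightarrow> downs S \<subseteq> {1..n} \<and> card (downs S) = k}"

text \<open>The component with last spin down, read on n points. It is the second map of the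
  restriction sequence V_{n,p+1} -> V_{n+1,p+1} -> V_{n,p}, the first one being the
  inclusion.\<close>

definition tail :: "nat \<Rightarrow> tensor \<Rightarrow> tensor" where
  "tail n f S = (if S (Suc n) then 0 else f (S(Suc n := True)))"

lemma gradedI:
  assumes "\<And>S. f S \<noteq> 0 \<Longrightarrow> downs S \<subseteq> {1..n} \<and> card (downs S) = k"
  shows "f \<in> graded n k"
  using assms unfolding graded_def by blast

lemma graded_supp: "f \<in> graded n k \<Longrightarrow> f S \<noteq> 0 \<Longrightarrow> downs S \<subseteq> {1..n} \<and> card (downs S) = k"
  unfolding graded_def by blast

lemma subspace_graded: "fun_vs.subspace (graded n k)"
proof (rule fun_vs.subspaceI)
  show "0 \<in> graded n k" by (rule gradedI) simp
  show "f + g \<in> graded n k" if f: "f \<in> graded n k" and g: "g \<in> graded n k" for f g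
  proof (rule gradedI)
    fix S assume "(f + g) S \<noteq> 0"
    then have "f S \<noteq> 0 \<or> g S \<noteq> 0" by auto
    then show "downs S \<subseteq> {1..n} \<and> card (downs S) = k"
      using graded_supp[OF f, of S] graded_supp[OF g, of S] by blast
  qed
  show "fscale c f \<in> graded n k" if f: "f \<in> graded n k" for c f
  proof (rule gradedI)
    fix S assume "fscale c f S \<noteq> 0"
    then have "f S \<noteq> 0" by auto
    then show "downs S \<subseteq> {1..n} \<and> card (downs S) = k"
      using graded_supp[OF f, of S] by blast
  qed
qed

lemma tail_add: "tail n (f + g) = tail n f + tail n g"
  by (auto simp: tail_def fun_eq_iff)

lemma tail_scale: "tail n (fscale c f) = fscale c (tail n f)"
  by (auto simp: tail_def fun_eq_iff)

lemma tail_diff: "tail n (f - g) = tail n f - tail n g"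
  by (auto simp: tail_def fun_eq_iff)

lemma tail_zero [simp]: "tail n 0 = 0"
  by (auto simp: tail_def fun_eq_iff)

lemma finite_spins: "downs S \<subseteq> {1..n::nat} \<Longrightarrow> finite (downs S)"
  by (rule finite_subset) auto

lemma downs_upd:
  "downs (S(a := True)) = insert a (downs S)"
  "downs (S(a := False)) = downs S - {a}"
  by (auto split: if_splits)

lemma graded_tail: assumes "f \<in> graded (Suc n) (Suc k)" shows "tail n f \<in> graded n k"
proof -
  have "downs S \<subseteq> {1..n} \<and> card (downs S) = k" if "tail n f S \<noteq> 0" for S
  proof -
    from that have S: "\<not> S (Suc n)" and "f (S(Suc n := True)) \<noteq> 0"
      by (auto simp: tail_def split: if_splits)
    with assms have "downs (S(Suc n := True)) \<subseteq> {1..Suc n}" "card (downs (S(Suc n := True))) = Suc k"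
      unfolding graded_def by blast+
    then have sub: "insert (Suc n) (downs S) \<subseteq> {1..Suc n}" and c: "card (insert (Suc n) (downs S)) = Suc k"
      by (simp_all only: downs_upd)
    have "finite (downs S)" using sub by (auto intro: finite_subset)
    then show ?thesis using S sub c by (auto simp: le_Suc_eq)
  qed
  then show ?thesis by (auto simp: graded_def)
qed

lemma gradedD: 
  assumes "f \<in> graded n k" "S i" "i = 0 \<or> n < i" shows "f S = 0"
proof (rule ccontr)
  assume "f S \<noteq> 0"
  with assms(1) have "downs S \<subseteq> {1..n}" by (auto simp: graded_def)
  then have "i \<in> {1..n}" using assms(2) by auto
  with assms(3) show False by auto
qed

lemma graded_card: "f \<in> graded n k \<Longrightarrow> card (downs S) \<noteq> k \<Longrightarrow> f S = 0"
  unfolding graded_def by blast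

lemma graded_tail_zero:
  assumes "f \<in> graded (Suc n) k" "tail n f = 0" shows "f \<in> graded n k"
proof -
  have "downs S \<subseteq> {1..n} \<and> card (downs S) = k" if "f S \<noteq> 0" for S
  proof -
    have "\<not> S (Suc n)"
    proof
      assume S: "S (Suc n)"
      then have "S(Suc n := False, Suc n := True) = S" by (auto simp: fun_eq_iff)
      then have "tail n f (S(Suc n := False)) = f S" by (simp add: tail_def)
      with assms(2) that show False by simp
    qed
    moreover have "downs S \<subseteq> {1..Suc n} \<and> card (downs S) = k"
      using assms(1) that by (auto simp: graded_def)
    ultimately show ?thesis by (auto simp: le_Suc_eq)
  qed
  then show ?thesis by (auto simp: graded_def)
qed

locale nonzero_parameter =
  fixes q :: complex
  assumes q_nonzero [simp]: "q \<noteq> 0"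
begin

abbreviation loop :: complex where "loop \<equiv> q + inverse q"

text \<open>The rank one operator on the sites j and j + 1 whose image is spanned by the cup vector
  and whose trace is \<open>loop\<close>.\<close>

definition tl_e :: "nat \<Rightarrow> tensor \<Rightarrow> tensor" where
  "tl_e j f S =
     (if S j = S (Suc j) then 0
      else if S j then q * f S + f (S(j := False, Suc j := True))
      else inverse q * f S + f (S(j := True, Suc j := False)))"

definition cup :: "nat \<Rightarrow> tensor \<Rightarrow> tensor" where
  "cup n g S =
     (if S (Suc n) = S (Suc (Suc n)) then 0
      else (if S (Suc n) then q else 1) * g (S(Suc n := False, Suc (Suc n) := False)))"

definition cap :: "nat \<Rightarrow> tensor \<Rightarrow> tensor" where
  "cap n f S =
     (if S (Suc n) \<or> S (Suc (Suc n)) then 0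
      else inverse q * f (S(Suc (Suc n) := True)) + f (S(Suc n := True)))"

lemma tl_e_add: "tl_e j (f + g) = tl_e j f + tl_e j g"
  by (auto simp: tl_e_def fun_eq_iff algebra_simps)
lemma tl_e_diff: "tl_e j (f - g) = tl_e j f - tl_e j g"
  by (auto simp: tl_e_def fun_eq_iff algebra_simps)
lemma tl_e_scale: "tl_e j (fscale c f) = fscale c (tl_e j f)"
  by (auto simp: tl_e_def fun_eq_iff algebra_simps)
lemma tl_e_zero [simp]: "tl_e j 0 = 0"
  by (auto simp: tl_e_def fun_eq_iff)
lemma tl_e_sum: "finite A \<Longrightarrow> tl_e j (\<Sum>i\<in>A. f i) = (\<Sum>i\<in>A. tl_e j (f i))"
proof (induction A rule: finite_induct)
  case (insert x F)
  have "sum f (insert x F) = f x + sum f F" by (rule sum.insert) fact+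
  moreover have "(\<Sum>i\<in>insert x F. tl_e j (f i)) = tl_e j (f x) + (\<Sum>i\<in>F. tl_e j (f i))"
    by (rule sum.insert) fact+
  ultimately show ?case using insert by (metis tl_e_add)
next
  case empty
  have "sum f {} = 0" "(\<Sum>i\<in>{}. tl_e j (f i)) = 0" by (rule sum.empty)+
  then show ?case by (metis tl_e_zero)
qed

lemma cup_add: "cup n (f + g) = cup n f + cup n g"
  by (auto simp: cup_def fun_eq_iff algebra_simps)
lemma cup_scale: "cup n (fscale c f) = fscale c (cup n f)"
  by (auto simp: cup_def fun_eq_iff)
lemma cup_zero [simp]: "cup n 0 = 0"
  by (auto simp: cup_def fun_eq_iff)
lemma cap_add: "cap n (f + g) = cap n f + cap n g"
  by (auto simp: cap_def fun_eq_iff algebra_simps)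
lemma cap_scale: "cap n (fscale c f) = fscale c (cap n f)"
  by (auto simp: cap_def fun_eq_iff algebra_simps)
lemma cap_zero [simp]: "cap n 0 = 0"
  by (auto simp: cap_def fun_eq_iff)

text \<open>Writing S itself as an update turns the spins near j into explicit Boolean values, so
  that identities between local operators reduce to evaluation in finitely many cases.\<close>

lemma spins_cases2:
  obtains S0 :: spins and a b where "S = S0(j := a, Suc j := b)"
  by (rule that[of S "S j" "S (Suc j)"]) simp

lemma spins_cases3:
  obtains S0 :: spins and a b c where "S = S0(j := a, Suc j := b, Suc (Suc j) := c)"
  by (rule that[of S "S j" "S (Suc j)" "S (Suc (Suc j))"]) simp

lemma upd_sort:
  "S(Suc j := b, j := a) = S(j := a, Suc j := b)"
  "S(Suc (Suc j) := b, j := a) = S(j := a, Suc (Suc j) := b)"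
  for S :: spins
  by (auto simp: fun_eq_iff)

lemma tl_e_square: "tl_e j (tl_e j f) = fscale loop (tl_e j f)"
proof (rule ext)
  fix S :: spins
  obtain S0 a b where S: "S = S0(j := a, Suc j := b)" by (rule spins_cases2)
  show "tl_e j (tl_e j f) S = fscale loop (tl_e j f) S"
    unfolding S by (cases a; cases b) (simp_all add: tl_e_def upd_sort field_simps)
qed

lemma tl_e_braid1: "tl_e j (tl_e (Suc j) (tl_e j f)) = tl_e j f"
proof (rule ext)
  fix S :: spins
  obtain S0 a b c where S: "S = S0(j := a, Suc j := b, Suc (Suc j) := c)" by (rule spins_cases3)
  show "tl_e j (tl_e (Suc j) (tl_e j f)) S = tl_e j f S"
    unfolding S by (cases a; cases b; cases c) (simp_all add: tl_e_def upd_sort field_simps)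
qed

lemma tl_e_braid2: "tl_e (Suc j) (tl_e j (tl_e (Suc j) f)) = tl_e (Suc j) f"
proof (rule ext)
  fix S :: spins
  obtain S0 a b c where S: "S = S0(j := a, Suc j := b, Suc (Suc j) := c)" by (rule spins_cases3)
  show "tl_e (Suc j) (tl_e j (tl_e (Suc j) f)) S = tl_e (Suc j) f S"
    unfolding S by (cases a; cases b; cases c) (simp_all add: tl_e_def upd_sort field_simps)
qed

lemma tl_e_commute: 
  assumes "Suc i < j" shows "tl_e i (tl_e j f) = tl_e j (tl_e i f)"
proof (rule ext)
  fix S :: spins
  have tw: "T(j := x, i := y) = T(i := y, j := x)" "T(j := x, Suc i := y) = T(Suc i := y, j := x)"
    "T(Suc j := x, i := y) = T(i := y, Suc j := x)"
    "T(Suc j := x, Suc i := y) = T(Suc i := y, Suc j := x)" for T :: spins and x y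
    using assms by (auto simp: fun_eq_iff)
  show "tl_e i (tl_e j f) S = tl_e j (tl_e i f) S"
    using assms by (cases "S i"; cases "S (Suc i)"; cases "S j"; cases "S (Suc j)") 
     (simp_all add: tl_e_def tw algebra_simps)
qed

lemma tl_e_eq_cup_cap: "tl_e (Suc n) f = cup n (cap n f)"
proof (rule ext)
  fix S :: spins
  obtain S0 a b where S: "S = S0(Suc n := a, Suc (Suc n) := b)" by (rule spins_cases2)
  show "tl_e (Suc n) f S = cup n (cap n f) S"
    unfolding S by (cases a; cases b) (simp_all add: tl_e_def cup_def cap_def upd_sort field_simps)
qed

text \<open>The grading says that g lives on n points: the left side vanishes at configurations with
  a down spin at one of the two new sites, and g must do the same.\<close>

lemma cap_cup: assumes "g \<in> graded n k" shows "cap n (cup n g) = fscale loop g"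
proof (rule ext)
  fix S :: spins
  obtain S0 a b where S: "S = S0(Suc n := a, Suc (Suc n) := b)" by (rule spins_cases2)
  show "cap n (cup n g) S = fscale loop g S"
  proof (cases "a \<or> b")
    case True
    then have "g S = 0" using assms unfolding S 
      by (intro gradedD[of g n k _ "if a then Suc n else Suc (Suc n)"]) auto
    then show ?thesis using True unfolding S by (simp add: cap_def)
  next
    case False
    then show ?thesis unfolding S by (simp add: cup_def cap_def upd_sort field_simps)
  qed
qed

lemma cup_inject:
  assumes "cup n g = 0" "g \<in> graded n k" shows "g = 0"
proof (rule ext)
  fix S :: spins
  show "g S = 0 S"
  proof (cases "S (Suc n) \<or> S (Suc (Suc n))")
    case True
    then show ?thesis using gradedD[OF assms(2), of S "Suc n"] gradedD[OF assms(2), of S "Suc (Suc n)"] by auto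
  next
    case False
    then have "S(Suc n := False, Suc (Suc n) := False) = S" by (auto simp: fun_eq_iff)
    then have "cup n g (S(Suc (Suc n) := True)) = g S"
      using False by (simp add: cup_def)
    then show ?thesis using assms(1) by simp
  qed
qed

lemma upd_sort_far:
  fixes S :: spins
  assumes "Suc j \<le> n"
  shows "S(Suc n := b, j := a) = S(j := a, Suc n := b)"
    "S(Suc n := b, Suc j := a) = S(Suc j := a, Suc n := b)"
    "S(Suc (Suc n) := b, j := a) = S(j := a, Suc (Suc n) := b)"
    "S(Suc (Suc n) := b, Suc j := a) = S(Suc j := a, Suc (Suc n) := b)"
  using assms by (auto simp: fun_eq_iff)

lemma tl_e_cup: assumes "Suc j \<le> n" shows "tl_e j (cup n g) = cup n (tl_e j g)"
  using assms by (auto simp: fun_eq_iff tl_e_def cup_def upd_sort_far algebra_simps)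

lemma tl_e_cap: assumes "Suc j \<le> n" shows "tl_e j (cap n g) = cap n (tl_e j g)"
  using assms by (auto simp: fun_eq_iff tl_e_def cap_def upd_sort_far algebra_simps)

lemma tl_e_tail: assumes "Suc j \<le> n" shows "tl_e j (tail n g) = tail n (tl_e j g)"
  using assms by (auto simp: fun_eq_iff tl_e_def tail_def upd_sort_far algebra_simps)

text \<open>Straightening a zigzag. It undoes \<open>cup\<close> without dividing by
  \<open>loop\<close>, which is zero for l = 2; the price is one further point to the left of the
  cup.\<close>

lemma cap_zigzag:
  assumes "g \<in> graded (Suc n) k" shows "cap (Suc n) (tl_e (Suc n) (cup (Suc n) g)) = g"
proof (rule ext)
  fix S :: spins
  obtain S0 a b c where S: "S = S0(Suc n := a, Suc (Suc n) := b, Suc (Suc (Suc n)) := c)" by (rule spins_cases3)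
  show "cap (Suc n) (tl_e (Suc n) (cup (Suc n) g)) S = g S"
  proof (cases "b \<or> c")
    case True
    then have "g S = 0" using assms unfolding S 
      by (intro gradedD[of g "Suc n" k _ "if b then Suc (Suc n) else Suc (Suc (Suc n))"]) auto
    then show ?thesis using True unfolding S by (simp add: cap_def)
  next
    case False
    then show ?thesis unfolding S by (cases a) (simp_all add: cup_def cap_def tl_e_def upd_sort field_simps)
  qed
qed

text \<open>Lifts cups through \<open>tail\<close>: if \<open>tail n g\<close> is h, then
  \<open>cup n h\<close> is the tail of the zigzag built from g.\<close>

lemma tail_zigzag:
  assumes "g \<in> graded (Suc n) k" 
  shows "tail (Suc (Suc n)) (tl_e (Suc n) (cup (Suc n) g)) = cup n (tail n g)"
proof (rule ext)
  fix S :: spins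
  obtain S0 a b c where S: "S = S0(Suc n := a, Suc (Suc n) := b, Suc (Suc (Suc n)) := c)" by (rule spins_cases3)
  show "tail (Suc (Suc n)) (tl_e (Suc n) (cup (Suc n) g)) S = cup n (tail n g) S"
  proof (cases c)
    case True
    then have "g (T(Suc (Suc (Suc n)) := c)) = 0" for T
      using assms by (intro gradedD[of g "Suc n" k _ "Suc (Suc (Suc n))"]) auto
    then show ?thesis unfolding S using True
      by (auto simp: cup_def tail_def upd_sort)
  next
    case False
    then show ?thesis unfolding S by (cases a; cases b) (simp_all add: cup_def tail_def tl_e_def upd_sort field_simps)
  qed
qed

end

section \<open>Link states as tensors\<close>

lemma link_statesD:
  assumes "w \<in> link_states n p"
  shows "w permutes {1..n}" "w (w k) = k" "a < b \<Longrightarrow> b < w a \<Longrightarrow> a < w b \<and> w b < w a \<and> w b \<noteq> b"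
    "card {k \<in> {1..n}. w k \<noteq> k} = 2 * p"
  using assms by (auto simp: link_states_def)

lemma link_states_range:
  assumes "w \<in> link_states n p" "w k \<noteq> k"
  shows "1 \<le> k" "k \<le> n" "1 \<le> w k" "w k \<le> n"
  using link_statesD(1)[OF assms(1)] assms(2) permutes_in_image[of w "{1..n}" k]
  by (auto simp: permutes_def) 

lemma link_statesI:
  assumes inv: "\<And>k. w (w k) = k" and rng: "\<And>k. w k \<noteq> k \<Longrightarrow> 1 \<le> k \<and> k \<le> n"
    and "\<And>a b. a < b \<Longrightarrow> b < w a \<Longrightarrow> a < w b \<and> w b < w a \<and> w b \<noteq> b"
    and "card {k. w k \<noteq> k} = 2 * p"
  shows "w \<in> link_states n p"
proof -
  have "w permutes {1..n}"
    unfolding permutes_def using inv rng by (metis atLeastAtMost_iff)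
  moreover have "\<forall>k. w (w k) = k" using inv by blast
  moreover have "\<forall>a b. a < b \<and> b < w a \<longrightarrow> a < w b \<and> w b < w a \<and> w b \<noteq> b"
    using assms(3) by blast
  moreover have "card {k \<in> {1..n}. w k \<noteq> k} = 2 * p"
  proof -
    have "{k \<in> {1..n}. w k \<noteq> k} = {k. w k \<noteq> k}" using rng by auto
    then show ?thesis using assms(4) by simp
  qed
  ultimately show ?thesis unfolding link_states_def by blast
qed

lemma link_states_card:
  assumes "w \<in> link_states n p" shows "card {k. w k \<noteq> k} = 2 * p"
proof -
  have "{k \<in> {1..n}. w k \<noteq> k} = {k. w k \<noteq> k}" using link_states_range[OF assms] by auto
  then show ?thesis using link_statesD(4)[OF assms] by simp
qed

lemma finite_link_support:
  assumes "w \<in> link_states n p" shows "finite {k. w k \<noteq> k}"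
proof (rule finite_subset)
  show "{k. w k \<noteq> k} \<subseteq> {1..n}"
  proof
    fix k assume "k \<in> {k. w k \<noteq> k}"
    then have "w k \<noteq> k" by simp
    then show "k \<in> {1..n}" using link_states_range(1,2)[OF assms] by simp
  qed
qed simp

lemma card_exchange:
  assumes "finite A" "y \<in> A" "x \<notin> A" shows "card (insert x (A - {y})) = card A"
proof -
  have "card (insert x (A - {y})) = Suc (card (A - {y}))"
    using assms by (intro card_insert_disjoint) auto
  then show ?thesis using assms card_Suc_Diff1 by metis
qed

text \<open>Since i and i + 1 are neighbours, a third cup has both of them on the same side; hence
  it has their partners on that side too, and joining the partners creates no crossing. The cases
  are a through strand at i, one at i + 1, and two distinct cups.\<close>

lemma link_join_in_link_states:
  assumes w: "w \<in> link_states n p" and i: "1 \<le> i" "Suc i \<le> n"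
    and ne: "w i \<noteq> Suc i" "w i \<noteq> i \<or> w (Suc i) \<noteq> Suc i"
  shows "link_join i w \<in> link_states n p"
proof -
  note inv = link_statesD(2)[OF w] and nc = link_statesD(3)[OF w]
  define x y where "x = w i" and "y = w (Suc i)"
  have wx: "w x = i" and wy: "w y = Suc i" by (simp_all add: x_def y_def inv)
  have wi: "w i = x" "w (Suc i) = y" by (simp_all add: x_def y_def)
  have out: "w k \<noteq> i" "w k \<noteq> Suc i" if "k \<noteq> x" "k \<noteq> y" for k
    using that inv[of k] by (auto simp: x_def y_def)
  have out': "w k \<noteq> x" "w k \<noteq> y" if "k \<noteq> i" "k \<noteq> Suc i" for k
    using that inv[of k] wx wy by metis+
  define u where "u = link_join i w"
  have rng: "1 \<le> k \<and> k \<le> n" if "w k \<noteq> k" for k using link_states_range[OF w that] by simp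
  consider (left) "x = i" "y \<noteq> Suc i"
    | (right) "x \<noteq> i" "y = Suc i" | (both) "x \<noteq> Suc i" "x \<noteq> i" "y \<noteq> Suc i"
    using ne unfolding x_def[symmetric] y_def[symmetric] by blast
  then have "u \<in> link_states n p"
  proof cases
    case left
    \<comment> \<open>A partner of i + 1 to the left of i would enclose the through strand at
      i.\<close>
    have y1: "Suc i < y"
    proof (rule ccontr)
      assume "\<not> Suc i < y"
      then have "y < i" using left wx wy by (metis Suc_lessI linorder_neqE_nat n_not_Suc_n not_less_eq)
      then show False using nc[of y i] wy left x_def by auto
    qed
    have u: "u i = Suc i" "u (Suc i) = i" "u y = y" "\<And>k. k \<noteq> i \<Longrightarrow> k \<noteq> Suc i \<Longrightarrow> k \<noteq> y \<Longrightarrow> u k = w k"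
      using left y1 by (auto simp: u_def link_join_def x_def y_def)
    show ?thesis
    proof (rule link_statesI)
      show "u (u k) = k" for k
        using u inv[of k] out[of k] out'[of k] left by metis
      show "1 \<le> k \<and> k \<le> n" if "u k \<noteq> k" for k
        using that u(3) u(4)[of k] rng[of k] i by (cases "k = i"; cases "k = Suc i"; cases "k = y") auto
      have fin: "finite {k. w k \<noteq> k}" by (rule finite_link_support[OF w])
      have "w k \<noteq> k \<and> k \<noteq> y \<or> k = i \<longleftrightarrow> u k \<noteq> k" for k
        using u(1-3) u(4)[of k] wi wx wy left y1 by (cases "k = i"; cases "k = Suc i"; cases "k = y") auto
      then have "{k. u k \<noteq> k} = insert i ({k. w k \<noteq> k} - {y})" by blast
      moreover have "y \<in> {k. w k \<noteq> k}" "i \<notin> {k. w k \<noteq> k}" using wi wx wy left y1 by auto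
      ultimately have "card {k. u k \<noteq> k} = card {k. w k \<noteq> k}"
        using card_exchange[OF fin] by (simp only:)
      then show "card {k. u k \<noteq> k} = 2 * p" using link_states_card[OF w] by simp
      fix a b assume ab: "a < b" "b < u a"
      have ub: "u b = (if b = i then Suc i else if b = Suc i then i else if b = y then y else w b)"
        using u by auto
      have a: "a \<noteq> i" "a \<noteq> Suc i" "a \<noteq> y" using ab u by auto
      then have "u a = w a" using u by auto
      with ab have lt: "a < b" "b < w a" by auto
      have no: "\<not> (a < i \<and> i < w a)" using nc[of a i] wi left by auto
      consider "b = i" | "b = Suc i" | "b = y" | "b \<noteq> i" "b \<noteq> Suc i" "b \<noteq> y" by blast
      then show "a < u b \<and> u b < u a \<and> u b \<noteq> b"
      proof cases
        case 1
        then show ?thesis using lt no by simp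
      next
        case 2
        then have "a < i \<and> i < w a" using lt a by linarith
        then show ?thesis using no by simp
      next
        case 3
        then have "a < Suc i \<and> Suc i < w a" using nc[OF lt] wy by simp
        then have "a < i \<and> i < w a" using a by linarith
        then show ?thesis using no by simp
      next
        case 4
        then show ?thesis using nc[OF lt] ub \<open>u a = w a\<close> by simp
      qed
    qed
  next
    case right
    have x1: "x < i"
    proof (rule ccontr)
      assume "\<not> x < i"
      then have "Suc i < x" using right wx y_def by (metis Suc_lessI linorder_neqE_nat)
      then show False using nc[of i "Suc i"] right x_def y_def by auto
    qed
    have u: "u i = Suc i" "u (Suc i) = i" "u x = x" "\<And>k. k \<noteq> i \<Longrightarrow> k \<noteq> Suc i \<Longrightarrow> k \<noteq> x \<Longrightarrow> u k = w k"
      using right x1 by (auto simp: u_def link_join_def x_def y_def)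
    show ?thesis
    proof (rule link_statesI)
      show "u (u k) = k" for k
        using u inv[of k] out[of k] out'[of k] right by metis
      show "1 \<le> k \<and> k \<le> n" if "u k \<noteq> k" for k
        using that u(3) u(4)[of k] rng[of k] i by (cases "k = i"; cases "k = Suc i"; cases "k = x") auto
      have fin: "finite {k. w k \<noteq> k}" by (rule finite_link_support[OF w])
      have "w k \<noteq> k \<and> k \<noteq> x \<or> k = (Suc i) \<longleftrightarrow> u k \<noteq> k" for k
        using u(1-3) u(4)[of k] wi wx wy right x1 by (cases "k = i"; cases "k = Suc i"; cases "k = x") auto
      then have "{k. u k \<noteq> k} = insert (Suc i) ({k. w k \<noteq> k} - {x})" by blast
      moreover have "x \<in> {k. w k \<noteq> k}" "(Suc i) \<notin> {k. w k \<noteq> k}" using wi wx wy right x1 by auto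
      ultimately have "card {k. u k \<noteq> k} = card {k. w k \<noteq> k}"
        using card_exchange[OF fin] by (simp only:)
      then show "card {k. u k \<noteq> k} = 2 * p" using link_states_card[OF w] by simp
      fix a b assume ab: "a < b" "b < u a"
      have ub: "u b = (if b = i then Suc i else if b = Suc i then i else if b = x then x else w b)"
        using u by auto
      have a: "a \<noteq> i" "a \<noteq> Suc i" "a \<noteq> x" using ab u by auto
      then have "u a = w a" using u by auto
      with ab have lt: "a < b" "b < w a" by auto
      have no: "\<not> (a < Suc i \<and> Suc i < w a)" using nc[of a "Suc i"] wi right by auto
      have wa: "w a \<noteq> Suc i" using out(2)[of a] a right by simp
      consider "b = i" | "b = Suc i" | "b = x" | "b \<noteq> i" "b \<noteq> Suc i" "b \<noteq> x" by blast
      then show "a < u b \<and> u b < u a \<and> u b \<noteq> b"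
      proof cases
        case 1
        then have "a < Suc i \<and> Suc i < w a" using lt wa by linarith
        then show ?thesis using no by simp
      next
        case 2
        then show ?thesis using lt no by simp
      next
        case 3
        then have "a < i \<and> i < w a" using nc[OF lt] wx by simp
        then have "a < Suc i \<and> Suc i < w a" using wa by linarith
        then show ?thesis using no by simp
      next
        case 4
        then show ?thesis using nc[OF lt] ub \<open>u a = w a\<close> by simp
      qed
    qed
  next
    case both
    have yi: "y \<noteq> i" using wy both x_def by auto
    have xy: "x \<noteq> y" using wx wy by auto
    \<comment> \<open>The two cups lie side by side, or they are nested on one side of the pair i, i
      + 1.\<close>
    have pos: "x < i \<and> Suc i < y \<or> y < x \<and> x < i \<or> Suc i < y \<and> y < x"
    proof (cases "x < i")
      case True
      show ?thesis
      proof (cases "Suc i < y")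
        case False
        then have "y < i" using both yi by auto
        moreover have "y < x"
          using nc[of y i] \<open>y < i\<close> wy x_def True by auto
        ultimately show ?thesis using True by auto
      qed (use True in auto)
    next
      case False
      then have "Suc i < x" using both by auto
      then show ?thesis using nc[of i "Suc i"] both x_def y_def by auto
    qed
    have u: "u i = Suc i" "u (Suc i) = i" "u x = y" "u y = x"
        "\<And>k. k \<noteq> i \<Longrightarrow> k \<noteq> Suc i \<Longrightarrow> k \<noteq> x \<Longrightarrow> k \<noteq> y \<Longrightarrow> u k = w k"
      using both yi xy by (auto simp: u_def link_join_def x_def y_def)
    show ?thesis
    proof (rule link_statesI)
      show "u (u k) = k" for k
        using u inv[of k] out[of k] out'[of k] both yi xy by metis
      have eqv: "w k \<noteq> k \<longleftrightarrow> u k \<noteq> k" for k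
      proof -
        consider "k = i" | "k = Suc i" | "k = x" | "k = y" | "k \<noteq> i" "k \<noteq> Suc i" "k \<noteq> x" "k \<noteq> y" by blast
        then show ?thesis using u wi wx wy both xy yi by cases simp_all
      qed
      show "1 \<le> k \<and> k \<le> n" if "u k \<noteq> k" for k
        using rng[of k] eqv[of k] that by blast
      have "{k. u k \<noteq> k} = {k. w k \<noteq> k}" using eqv by blast
      then show "card {k. u k \<noteq> k} = 2 * p"
        using link_states_card[OF w] by simp
      fix a b assume ab: "a < b" "b < u a"
      have ub: "u b = (if b = i then Suc i else if b = Suc i then i else if b = x then y else if b = y then x else w b)"
        using u by auto
      have ua: "u a = (if a = i then Suc i else if a = Suc i then i else if a = x then y else if a = y then x else w a)"
        using u by auto
      have ne: "x \<noteq> Suc i" "x \<noteq> i" "y \<noteq> Suc i" "y \<noteq> i" "x \<noteq> y" using both yi xy by auto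
      have I: "a = i \<Longrightarrow> False" "a = Suc i \<Longrightarrow> False" using ab ua by auto
      consider "a = x" | "a = y" | "a \<noteq> x" "a \<noteq> y" by blast
      then show "a < u b \<and> u b < u a \<and> u b \<noteq> b"
      proof cases
        case 1
        then have "u a = y" using u by simp
        with ab 1 pos have p: "x < i" "Suc i < y" "x < b" "b < y" by auto
        consider "b = i" | "b = Suc i" | "b < i" | "Suc i < b" by linarith
        then show ?thesis
        proof cases
          case 3
          then have "x < w b \<and> w b < i \<and> w b \<noteq> b" using nc[of x b] p wx by simp
          then show ?thesis using p 1 3 ub \<open>u a = y\<close> by simp
        next
          case 4
          then have "Suc i < w b \<and> w b < y \<and> w b \<noteq> b" using nc[of "Suc i" b] p wi by simp
          then show ?thesis using p 1 4 ub \<open>u a = y\<close> by simp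
        qed (use p 1 ub \<open>u a = y\<close> in auto)
      next
        case 2
        then have ua: "u a = x" using u by simp
        with ab 2 pos have p: "y < b" "b < x" "y < x" "x < i \<or> Suc i < y" by auto
        then have b: "b \<noteq> i" "b \<noteq> Suc i" "b \<noteq> x" "b \<noteq> y" by auto
        then have ub': "u b = w b" using u by simp
        \<comment> \<open>The point b lies inside the outer and outside the inner of two nested
          cups. Noncrossing with the outer cup bounds \<open>w b\<close> from one direction;
          noncrossing with the inner cup, applied to \<open>w b\<close> in place of b, bounds it
          from the other.\<close>
        from p(4) have "y < w b \<and> w b < x \<and> w b \<noteq> b"
        proof
          assume "x < i"
          then have "y < w b \<and> w b < Suc i \<and> w b \<noteq> b" using nc[of y b] p wy by simp
          moreover have "\<not> x < w b"
          proof
            assume "x < w b"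
            moreover have "w b < i" using out(1)[of b] b calculation \<open>y < w b \<and> w b < Suc i \<and> w b \<noteq> b\<close> by linarith
            ultimately show False using nc[of x "w b"] wx inv[of b] p by simp
          qed
          moreover have "w b \<noteq> x" using out'(1)[of b] b by simp
          ultimately show ?thesis by linarith
        next
          assume "Suc i < y"
          then have "i < w b \<and> w b < x \<and> w b \<noteq> b" using nc[of i b] p wi by simp
          moreover have "\<not> w b < y"
          proof
            assume "w b < y"
            moreover have "Suc i < w b" using out(2)[of b] b \<open>i < w b \<and> w b < x \<and> w b \<noteq> b\<close> by linarith
            ultimately show False using nc[of "Suc i" "w b"] wi inv[of b] p by simp
          qed
          moreover have "w b \<noteq> y" using out'(2)[of b] b by simp
          ultimately show ?thesis by linarith
        qed
        then show ?thesis using ua 2 ub' by simp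
      next
        case 3
        then have ua: "u a = w a" and a: "a \<noteq> i" "a \<noteq> Suc i" using u I by auto
        then have lt: "a < b" "b < w a" using ab by auto
        have wa: "w a \<noteq> i" "w a \<noteq> Suc i" "w a \<noteq> x" "w a \<noteq> y"
          using out[of a] out'[of a] a 3 by simp_all
        \<comment> \<open>A cup around the pair also encloses both partners.\<close>
        have in_i: "a < x \<and> x < w a \<and> a < y \<and> y < w a" if "a < i" "Suc i < w a"
          using nc[of a i] nc[of a "Suc i"] wi that by simp
        consider "b = i" | "b = Suc i" | "b = x" | "b = y" | "b \<noteq> i" "b \<noteq> Suc i" "b \<noteq> x" "b \<noteq> y" by blast
        then show ?thesis
        proof cases
          case 1
          then have "a < Suc i \<and> Suc i < w a" using lt wa by linarith
          then show ?thesis using 1 ub ua by simp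
        next
          case 2
          then have "a < i \<and> i < w a" using lt a by linarith
          then show ?thesis using 2 ub ua by simp
        next
          case 3
          then have "a < i \<and> i < w a" using nc[OF lt] wx by simp
          then have "a < i" "Suc i < w a" using wa by linarith+
          then show ?thesis using in_i 3 ub ua ne by simp
        next
          case 4
          then have "a < Suc i \<and> Suc i < w a" using nc[OF lt] wy by simp
          then have "a < i" "Suc i < w a" using a by linarith+
          then show ?thesis using in_i 4 ub ua ne by simp
        next
          case 5
          then show ?thesis using nc[OF lt] ub ua by simp
        qed
      qed
    qed
  qed
  then show ?thesis by (simp add: u_def)
qed

section \<open>Link vectors and their equivariance\<close>

context nonzero_parameter
begin

text \<open>A cup is seen from both of its ends. The factor q is charged at the left end only, so
  the product over all sites gives each cup the coefficient 1 for (up, down), q for (down, up) and 0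
  for equal spins.\<close>

definition site_weight :: "link \<Rightarrow> spins \<Rightarrow> nat \<Rightarrow> complex" where
  "site_weight w S k =
     (if w k = k then (if S k then 0 else 1)
      else if S (w k) = S k then 0
      else if S k \<and> k < w k then q else 1)"

definition link_vec :: "nat \<Rightarrow> link \<Rightarrow> tensor" where
  "link_vec n w S = (if downs S \<subseteq> {1..n} then \<Prod>k\<in>{1..n}. site_weight w S k else 0)"

text \<open>Isolates the set A of sites where the picture changes. The factors outside A are common
  to w and u and do not see the spins at i and i + 1, so an identity about \<open>tl_e\<close>
  becomes one about the few sites in A.\<close>

lemma link_vec_split:
  assumes "A \<subseteq> {1..n}" "i \<in> A" "Suc i \<in> A"
    and "\<And>k. k \<in> {1..n} - A \<Longrightarrow> u k = w k \<and> w k \<noteq> i \<and> w k \<noteq> Suc i"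
  shows "link_vec n u (S(i := a, Suc i := b)) =
    (if downs S - A \<subseteq> {1..n} then
       (\<Prod>k\<in>A. site_weight u (S(i := a, Suc i := b)) k) * (\<Prod>k\<in>{1..n} - A. site_weight w S k) else 0)"
proof -
  have "(\<Prod>k\<in>{1..n} - A. site_weight u (S(i := a, Suc i := b)) k) = (\<Prod>k\<in>{1..n} - A. site_weight w S k)"
    using assms by (intro prod.cong refl) (auto simp: site_weight_def)
  moreover have "downs (S(i := a, Suc i := b)) \<subseteq> {1..n} \<longleftrightarrow> downs S - A \<subseteq> {1..n}"
  proof
    assume *: "downs (S(i := a, Suc i := b)) \<subseteq> {1..n}"
    show "downs S - A \<subseteq> {1..n}"
    proof
      fix k assume "k \<in> downs S - A"
      then have "k \<in> downs (S(i := a, Suc i := b))" using assms(2,3) by auto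
      then show "k \<in> {1..n}" using * by blast
    qed
  next
    assume *: "downs S - A \<subseteq> {1..n}"
    show "downs (S(i := a, Suc i := b)) \<subseteq> {1..n}"
    proof
      fix k assume "k \<in> downs (S(i := a, Suc i := b))"
      then have "k \<in> A \<or> k \<in> downs S - A" using assms(2,3) by (auto split: if_splits)
      then show "k \<in> {1..n}" using * assms(1) by blast
    qed
  qed
  moreover have "(\<Prod>k\<in>{1..n}. site_weight u (S(i := a, Suc i := b)) k) =
     (\<Prod>k\<in>{1..n} - A. site_weight u (S(i := a, Suc i := b)) k) * (\<Prod>k\<in>A. site_weight u (S(i := a, Suc i := b)) k)"
    by (rule prod.subset_diff[OF assms(1)]) simp
  ultimately show ?thesis
    unfolding link_vec_def by (simp only: mult.commute)
qed

text \<open>Only i, i + 1 and their partners matter, so after \<open>link_vec_split\<close> a check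
  over at most four spins remains. Two through strands give 0 because both spins are up, where
  \<open>tl_e\<close> vanishes.\<close>

lemma link_vec_equivariant:
  assumes w: "w \<in> link_states n p" and i: "1 \<le> i" "Suc i \<le> n"
  shows "tl_e i (link_vec n w) =
    (if w i = Suc i then fscale loop (link_vec n w)
     else if w i = i \<and> w (Suc i) = Suc i then 0
     else link_vec n (link_join i w))"
proof (rule ext)
  fix S :: spins
  note inv = link_statesD(2)[OF w] and nc = link_statesD(3)[OF w]
  obtain S0 a b where S: "S = S0(i := a, Suc i := b)" by (rule spins_cases2)
  define x y where "x = w i" and "y = w (Suc i)"
  have wx: "w x = i" and wy: "w y = Suc i" by (simp_all add: x_def y_def inv)
  have out: "w k \<noteq> i" "w k \<noteq> Suc i" if "k \<noteq> x" "k \<noteq> y" for k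
    using that inv[of k] by (auto simp: x_def y_def)
  consider (cup) "x = Suc i" | (through) "x = i" "y = Suc i" | (left) "x = i" "y \<noteq> Suc i"
    | (right) "x \<noteq> i" "y = Suc i" | (both) "x \<noteq> Suc i" "x \<noteq> i" "y \<noteq> Suc i" by blast
  then show "tl_e i (link_vec n w) S = (if w i = Suc i then fscale loop (link_vec n w)
     else if w i = i \<and> w (Suc i) = Suc i then 0
     else link_vec n (link_join i w)) S"
  proof cases
    case cup
    then have y: "y = i" using wx y_def by simp
    have *: "link_vec n w (S0(i := a, Suc i := b)) =
      (if downs S0 - {i, Suc i} \<subseteq> {1..n} then
       (\<Prod>k\<in>{i, Suc i}. site_weight w (S0(i := a, Suc i := b)) k) * (\<Prod>k\<in>{1..n} - {i, Suc i}. site_weight w S0 k) else 0)"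
      for a b
      using i cup y out by (intro link_vec_split) auto
    show ?thesis
      using cup y unfolding S x_def y_def
      by (cases a; cases b) (simp_all add: tl_e_def upd_sort * site_weight_def field_simps)
  next
    case through
    have *: "link_vec n w (S0(i := a, Suc i := b)) =
      (if downs S0 - {i, Suc i} \<subseteq> {1..n} then
       (\<Prod>k\<in>{i, Suc i}. site_weight w (S0(i := a, Suc i := b)) k) * (\<Prod>k\<in>{1..n} - {i, Suc i}. site_weight w S0 k) else 0)"
      for a b
      using i through out by (intro link_vec_split) auto
    show ?thesis
      using through unfolding S x_def y_def
      by (cases a; cases b) (simp_all add: tl_e_def upd_sort * site_weight_def field_simps)
  next
    case left
    have y1: "Suc i < y"
    proof (rule ccontr)
      assume "\<not> Suc i < y"
      then have "y < i" using left wx wy by (metis Suc_lessI linorder_neqE_nat n_not_Suc_n not_less_eq)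
      then show False using nc[of y i] wy left x_def by auto
    qed
    have yn: "y \<le> n" using link_states_range(4)[OF w, of "Suc i"] left y_def by auto
    define u where "u = link_join i w"
    have u: "u i = Suc i" "u (Suc i) = i" "u y = y" "\<And>k. k \<noteq> i \<Longrightarrow> k \<noteq> Suc i \<Longrightarrow> k \<noteq> y \<Longrightarrow> u k = w k"
      using left y1 by (auto simp: u_def link_join_def x_def y_def)
    have *: "link_vec n w (S0(i := a, Suc i := b)) =
      (if downs S0 - {i, Suc i, y} \<subseteq> {1..n} then
       (\<Prod>k\<in>{i, Suc i, y}. site_weight w (S0(i := a, Suc i := b)) k) * (\<Prod>k\<in>{1..n} - {i, Suc i, y}. site_weight w S0 k) else 0)"
      for a b
      using i left y1 yn out by (intro link_vec_split) auto
    have **: "link_vec n u (S0(i := a, Suc i := b)) =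
      (if downs S0 - {i, Suc i, y} \<subseteq> {1..n} then
       (\<Prod>k\<in>{i, Suc i, y}. site_weight u (S0(i := a, Suc i := b)) k) * (\<Prod>k\<in>{1..n} - {i, Suc i, y}. site_weight w S0 k) else 0)"
      for a b
      using i left y1 yn out u(4) by (intro link_vec_split) auto
    have f: "w i = i" "w (Suc i) = y" "i < y" using left y1 by (auto simp: x_def y_def)
    show ?thesis
      using y1 left unfolding S u_def[symmetric]
      by (cases a; cases b; cases "S0 y") (simp_all add: f wy tl_e_def upd_sort * ** u(1-3) site_weight_def)
  next
    case right
    have x1: "x < i"
    proof (rule ccontr)
      assume "\<not> x < i"
      then have "Suc i < x" using right wx y_def by (metis Suc_lessI linorder_neqE_nat)
      then show False using nc[of i "Suc i"] right x_def y_def by auto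
    qed
    have x0: "1 \<le> x" using link_states_range(3)[OF w, of i] right x_def by auto
    define u where "u = link_join i w"
    have u: "u i = Suc i" "u (Suc i) = i" "u x = x" "\<And>k. k \<noteq> i \<Longrightarrow> k \<noteq> Suc i \<Longrightarrow> k \<noteq> x \<Longrightarrow> u k = w k"
      using right x1 by (auto simp: u_def link_join_def x_def y_def)
    have *: "link_vec n w (S0(i := a, Suc i := b)) =
      (if downs S0 - {i, Suc i, x} \<subseteq> {1..n} then
       (\<Prod>k\<in>{i, Suc i, x}. site_weight w (S0(i := a, Suc i := b)) k) * (\<Prod>k\<in>{1..n} - {i, Suc i, x}. site_weight w S0 k) else 0)"
      for a b
      using i right x1 x0 out by (intro link_vec_split) auto
    have **: "link_vec n u (S0(i := a, Suc i := b)) =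
      (if downs S0 - {i, Suc i, x} \<subseteq> {1..n} then
       (\<Prod>k\<in>{i, Suc i, x}. site_weight u (S0(i := a, Suc i := b)) k) * (\<Prod>k\<in>{1..n} - {i, Suc i, x}. site_weight w S0 k) else 0)"
      for a b
      using i right x1 x0 out u(4) by (intro link_vec_split) auto
    have f: "w (Suc i) = Suc i" "w i = x" using right by (auto simp: x_def y_def)
    show ?thesis
      using x1 right unfolding S u_def[symmetric]
      by (cases a; cases b; cases "S0 x") (simp_all add: f wx tl_e_def upd_sort * ** u(1-3) site_weight_def)
  next
    case both
    have yi: "y \<noteq> i" using wy both x_def by auto
    have xy: "x \<noteq> y" using wx wy by auto
    have rng: "1 \<le> x" "x \<le> n" "1 \<le> y" "y \<le> n"
      using link_states_range(3,4)[OF w, of i] link_states_range(3,4)[OF w, of "Suc i"] both x_def y_def by auto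
    have pos: "x < i \<and> Suc i < y \<or> y < x \<and> x < i \<or> Suc i < y \<and> y < x"
    proof (cases "x < i")
      case True
      show ?thesis
      proof (cases "Suc i < y")
        case False
        then have "y < i" using both yi by auto
        moreover have "y < x"
          using nc[of y i] \<open>y < i\<close> wy x_def True by auto
        ultimately show ?thesis using True by auto
      qed (use True in auto)
    next
      case False
      then have "Suc i < x" using both by auto
      then show ?thesis using nc[of i "Suc i"] both x_def y_def by auto
    qed
    define u where "u = link_join i w"
    have u: "u i = Suc i" "u (Suc i) = i" "u x = y" "u y = x"
        "\<And>k. k \<noteq> i \<Longrightarrow> k \<noteq> Suc i \<Longrightarrow> k \<noteq> x \<Longrightarrow> k \<noteq> y \<Longrightarrow> u k = w k"
      using both yi xy by (auto simp: u_def link_join_def x_def y_def)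
    have *: "link_vec n w (S0(i := a, Suc i := b)) =
      (if downs S0 - {i, Suc i, x, y} \<subseteq> {1..n} then
       (\<Prod>k\<in>{i, Suc i, x, y}. site_weight w (S0(i := a, Suc i := b)) k) * (\<Prod>k\<in>{1..n} - {i, Suc i, x, y}. site_weight w S0 k) else 0)"
      for a b
      using i both rng out by (intro link_vec_split) auto
    have **: "link_vec n u (S0(i := a, Suc i := b)) =
      (if downs S0 - {i, Suc i, x, y} \<subseteq> {1..n} then
       (\<Prod>k\<in>{i, Suc i, x, y}. site_weight u (S0(i := a, Suc i := b)) k) * (\<Prod>k\<in>{1..n} - {i, Suc i, x, y}. site_weight w S0 k) else 0)"
      for a b
      using i both rng out u(5) by (intro link_vec_split) auto
    have f: "w (Suc i) = y" "w i = x" by (auto simp: x_def y_def)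
    have ne: "x \<noteq> i" "x \<noteq> Suc i" "y \<noteq> i" "y \<noteq> Suc i" "x \<noteq> y" "y \<noteq> x" "i \<noteq> x" "i \<noteq> y" "Suc i \<noteq> x" "Suc i \<noteq> y"
      using both yi xy by auto
    have "tl_e i (link_vec n w) (S0(i := a, Suc i := b)) = link_vec n u (S0(i := a, Suc i := b))"
      using pos
      apply (elim disjE conjE)
      by (cases a; cases b; cases "S0 x"; cases "S0 y";
          simp add: f ne wx wy tl_e_def upd_sort * ** u(1-4) site_weight_def)+
    then show ?thesis
      using both yi unfolding S u_def f by simp
  qed
qed

end

section \<open>Adding a cup and cutting the last strand\<close>

lemma finite_link_states: "finite (link_states n p)"
  by (rule finite_subset[of _ "{w. w permutes {1..n}}"]) (auto simp: link_states_def intro: finite_permutations)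

lemma link_states_0: "link_states n 0 = {id}"
proof (intro equalityI subsetI)
  fix w assume w: "w \<in> link_states n 0"
  then have "{k. w k \<noteq> k} = {}"
    using link_states_card[OF w] finite_link_support[OF w] by simp
  then show "w \<in> {id}" by (auto simp: fun_eq_iff)
qed (auto intro!: link_statesI)

lemma link_states_empty:
  assumes "n < 2 * p" shows "link_states n p = {}"
proof -
  have False if w: "w \<in> link_states n p" for w
  proof -
    have "card {k \<in> {1..n}. w k \<noteq> k} \<le> card {1..n}" by (intro card_mono) auto
    then show False using link_statesD(4)[OF w] assms by simp
  qed
  then show ?thesis by blast
qed

definition link_cup :: "nat \<Rightarrow> link \<Rightarrow> link" where
  "link_cup n w = w(Suc n := Suc (Suc n), Suc (Suc n) := Suc n)"

text \<open>The other end of the strand at n + 1 becomes a through strand, and n + 1 becomes an idle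
  point outside the range. On tensors this is \<open>tail\<close>.\<close>

definition link_cut :: "nat \<Rightarrow> link \<Rightarrow> link" where
  "link_cut n w = w(w (Suc n) := w (Suc n), Suc n := Suc n)"

lemma link_states_outside:
  assumes "w \<in> link_states n p" "k = 0 \<or> n < k" shows "w k = k"
  using link_states_range[OF assms(1), of k] assms(2) by fastforce

lemma link_cup_in_link_states:
  assumes w: "w \<in> link_states n p"
  shows "link_cup n w \<in> link_states (Suc (Suc n)) (Suc p)"
proof (rule link_statesI)
  define u where "u = link_cup n w"
  have o: "w (Suc n) = Suc n" "w (Suc (Suc n)) = Suc (Suc n)" using link_states_outside[OF w] by auto
  have u: "u (Suc n) = Suc (Suc n)" "u (Suc (Suc n)) = Suc n" 
    "\<And>k. k \<noteq> Suc n \<Longrightarrow> k \<noteq> Suc (Suc n) \<Longrightarrow> u k = w k" by (auto simp: u_def link_cup_def)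
  show "link_cup n w (link_cup n w k) = k" for k
    using u link_statesD(2)[OF w, of k] o unfolding u_def[symmetric] by metis
  show "1 \<le> k \<and> k \<le> Suc (Suc n)" if "link_cup n w k \<noteq> k" for k
    using that link_states_range[OF w, of k] u(3)[of k] unfolding u_def[symmetric] by fastforce
  show "a < link_cup n w b \<and> link_cup n w b < link_cup n w a \<and> link_cup n w b \<noteq> b"
    if ab: "a < b" "b < link_cup n w a" for a b
  proof -
    have a: "a \<noteq> Suc n" "a \<noteq> Suc (Suc n)" using ab u unfolding u_def[symmetric] by auto
    then have "a < b" "b < w a" using ab u unfolding u_def[symmetric] by auto
    moreover from this have "w a \<le> n" using link_states_range(4)[OF w, of a] by simp
    ultimately show ?thesis using link_statesD(3)[OF w, of a b] a u unfolding u_def[symmetric] by auto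
  qed
  have "u k \<noteq> k \<longleftrightarrow> k = Suc n \<or> k = Suc (Suc n) \<or> w k \<noteq> k" for k
    using u(1,2) u(3)[of k] o by (cases "k = Suc n"; cases "k = Suc (Suc n)") auto
  then have "{k. u k \<noteq> k} = insert (Suc n) (insert (Suc (Suc n)) {k. w k \<noteq> k})" by blast
  then show "card {k. link_cup n w k \<noteq> k} = 2 * Suc p"
    using link_states_card[OF w] finite_link_support[OF w] o by (simp add: u_def)
qed

lemma link_cup_decompose:
  assumes w: "w \<in> link_states (Suc (Suc n)) p" and c: "w (Suc n) = Suc (Suc n)"
  obtains w' where "w' \<in> link_states n (p - 1)" "w = link_cup n w'" "0 < p"
proof
  have c': "w (Suc (Suc n)) = Suc n" using c link_statesD(2)[OF w, of "Suc n"] by simp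
  have "Suc n \<in> {k. w k \<noteq> k}" using c by simp
  then show p: "0 < p" using link_states_card[OF w] finite_link_support[OF w]
    by (metis card_gt_0_iff empty_iff nat_0_less_mult_iff)
  define u where "u = w(Suc n := Suc n, Suc (Suc n) := Suc (Suc n))"
  have u: "u (Suc n) = Suc n" "u (Suc (Suc n)) = Suc (Suc n)" 
    "\<And>k. k \<noteq> Suc n \<Longrightarrow> k \<noteq> Suc (Suc n) \<Longrightarrow> u k = w k" by (auto simp: u_def)
  show "w = link_cup n u" using c c' by (auto simp: u_def link_cup_def fun_eq_iff)
  show "u \<in> link_states n (p - 1)"
  proof (rule link_statesI)
    show "u (u k) = k" for k
      using u link_statesD(2)[OF w, of k] c c' by metis
    show "1 \<le> k \<and> k \<le> n" if "u k \<noteq> k" for k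
      using that u link_states_range[OF w, of k] by (cases "k = Suc n"; cases "k = Suc (Suc n)") auto
    show "a < u b \<and> u b < u a \<and> u b \<noteq> b" if ab: "a < b" "b < u a" for a b
    proof -
      have a: "a \<noteq> Suc n" "a \<noteq> Suc (Suc n)" using ab u by auto
      have wa: "w a \<noteq> Suc n" "w a \<noteq> Suc (Suc n)" using a c c' link_statesD(2)[OF w, of a] by metis+
      have "b < w a" using ab u a by auto
      moreover from this have "w a \<le> Suc (Suc n)" using link_states_range(4)[OF w, of a] ab by simp
      ultimately have "b < Suc n" using wa by linarith
      then show ?thesis using link_statesD(3)[OF w, of a b] ab a u by auto
    qed
    have "w k \<noteq> k \<longleftrightarrow> k = Suc n \<or> k = Suc (Suc n) \<or> u k \<noteq> k" for k
      using u(1,2) u(3)[of k] c c' by (cases "k = Suc n"; cases "k = Suc (Suc n)") auto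
    then have "{k. w k \<noteq> k} = insert (Suc n) (insert (Suc (Suc n)) {k. u k \<noteq> k})" by blast
    moreover from this have "finite {k. u k \<noteq> k}" using finite_link_support[OF w] by simp
    ultimately show "card {k. u k \<noteq> k} = 2 * (p - 1)"
      using link_states_card[OF w] u p by simp
  qed
qed

lemma link_states_mono:
  assumes "w \<in> link_states n p" shows "w \<in> link_states (Suc n) p"
proof (rule link_statesI)
  show "1 \<le> k \<and> k \<le> Suc n" if "w k \<noteq> k" for k using link_states_range[OF assms that] by auto
qed (use link_statesD[OF assms] link_states_card[OF assms] in auto)

lemma link_states_through:
  assumes w: "w \<in> link_states (Suc n) p" and c: "w (Suc n) = Suc n"
  shows "w \<in> link_states n p"
proof (rule link_statesI)
  show "1 \<le> k \<and> k \<le> n" if "w k \<noteq> k" for k 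
    using link_states_range[OF w that] that c by (cases "k = Suc n") auto
qed (use link_statesD[OF w] link_states_card[OF w] in auto)

lemma link_cut_in_link_states:
  assumes w: "w \<in> link_states (Suc n) p" and c: "w (Suc n) \<noteq> Suc n"
  shows "link_cut n w \<in> link_states n (p - 1)" and "0 < p"
proof -
  define a where "a = w (Suc n)"
  have wa: "w a = Suc n" using link_statesD(2)[OF w] by (simp add: a_def)
  have a: "1 \<le> a" "a \<le> n" "a \<noteq> Suc n" using link_states_range(3,4)[OF w c] c by (auto simp: a_def)
  have "Suc n \<in> {k. w k \<noteq> k}" using c by simp
  then show p: "0 < p" using link_states_card[OF w] finite_link_support[OF w]
    by (metis card_gt_0_iff empty_iff nat_0_less_mult_iff)
  define u where "u = link_cut n w"
  have u: "u (Suc n) = Suc n" "u a = a" 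
    "\<And>k. k \<noteq> Suc n \<Longrightarrow> k \<noteq> a \<Longrightarrow> u k = w k" by (auto simp: u_def link_cut_def a_def)
  have "u \<in> link_states n (p - 1)"
  proof (rule link_statesI)
    show "u (u k) = k" for k
      using u link_statesD(2)[OF w, of k] wa a_def by metis
    show "1 \<le> k \<and> k \<le> n" if "u k \<noteq> k" for k
      using that u link_states_range[OF w, of k] by (cases "k = Suc n"; cases "k = a") auto
    show "b < u d \<and> u d < u b \<and> u d \<noteq> d" if bd: "b < d" "d < u b" for b d
    proof -
      have b: "b \<noteq> Suc n" "b \<noteq> a" using bd u by auto
      have wb: "w b \<noteq> Suc n" "w b \<noteq> a" using b wa a_def link_statesD(2)[OF w, of b] by metis+
      have d: "d < w b" using bd u b by auto
      moreover from this have le: "w b \<le> Suc n" using link_states_range(4)[OF w, of b] bd by simp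
      ultimately have "d \<noteq> Suc n" using wb by linarith
      \<comment> \<open>A cup around a would cross the strand from a to the last point.\<close>
      moreover have "d \<noteq> a" using link_statesD(3)[OF w, of b a] bd(1) d wa le by auto
      ultimately show ?thesis using link_statesD(3)[OF w, of b d] bd b u by auto
    qed
    have "w k \<noteq> k \<longleftrightarrow> k = Suc n \<or> k = a \<or> u k \<noteq> k" for k
      using u(1,2) u(3)[of k] wa a a_def by (cases "k = Suc n"; cases "k = a") auto
    then have "{k. w k \<noteq> k} = insert (Suc n) (insert a {k. u k \<noteq> k})" by blast
    moreover from this have "finite {k. u k \<noteq> k}" using finite_link_support[OF w] by simp
    ultimately show "card {k. u k \<noteq> k} = 2 * (p - 1)"
      using link_states_card[OF w] u p a by simp
  qed
  then show "link_cut n w \<in> link_states n (p - 1)" by (simp add: u_def)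
qed

text \<open>The cut strand can be recovered: it started at the rightmost through strand of the
  result, since any through strand further right would have been enclosed by it.\<close>

lemma link_cut_inject:
  assumes w: "w \<in> link_states (Suc n) p" "w (Suc n) \<noteq> Suc n"
    and v: "v \<in> link_states (Suc n) p" "v (Suc n) \<noteq> Suc n"
    and eq: "link_cut n w = link_cut n v"
  shows "w = v"
proof -
  define a b where "a = w (Suc n)" and "b = v (Suc n)"
  have wa: "w a = Suc n" "v b = Suc n" 
    using link_statesD(2)[OF w(1)] link_statesD(2)[OF v(1)] by (simp_all add: a_def b_def)
  have r: "a \<le> n" "b \<le> n" using link_states_range(4)[OF w] link_states_range(4)[OF v] w(2) v(2) by (auto simp: a_def b_def)
  have eqk: "(if k = Suc n then Suc n else if k = a then a else w k) = 
     (if k = Suc n then Suc n else if k = b then b else v k)" for k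
    using fun_cong[OF eq, of k] unfolding link_cut_def fun_upd_def a_def b_def .
  have "a = b"
  proof (rule ccontr)
    assume "a \<noteq> b"
    then have "w b = b" "v a = a" using eqk[of b] eqk[of a] r by auto
    then show False
      using \<open>a \<noteq> b\<close> link_statesD(3)[OF w(1), of a b] link_statesD(3)[OF v(1), of b a] wa r 
      by (cases "a < b") auto
  qed
  show ?thesis
  proof
    fix k show "w k = v k"
      using eqk[of k] \<open>a = b\<close> wa a_def b_def by (cases "k = Suc n"; cases "k = a") auto
  qed
qed

text \<open>Take a cup of minimal width. If its ends were not adjacent, the point after its left end
  would open a strictly shorter cup inside it.\<close>

lemma adjacent_cup_exists:
  assumes w: "w \<in> link_states n p" and "0 < p"
  obtains j where "1 \<le> j" "Suc j \<le> n" "w j = Suc j"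
proof -
  let ?P = "\<lambda>a. a < w a"
  have "{k. w k \<noteq> k} \<noteq> {}" using link_states_card[OF w] assms(2) by (metis card.empty mult_is_0 neq0_conv zero_neq_numeral)
  then obtain k where "w k \<noteq> k" by blast
  then have "?P k \<or> ?P (w k)" using link_statesD(2)[OF w, of k] by auto
  then obtain b where b: "?P b" by blast
  obtain a where a: "?P a" and min: "\<And>c. ?P c \<Longrightarrow> w a - a \<le> w c - c"
    using ex_has_least_nat[of ?P b "\<lambda>c. w c - c"] b by blast
  have "w a = Suc a"
  proof (rule ccontr)
    assume "w a \<noteq> Suc a"
    then have lt: "Suc a < w a" using a by auto
    note nc = link_statesD(3)[OF w, of a "Suc a", OF lessI lt]
    then have "Suc a < w (Suc a)" by auto
    from min[OF this] nc show False using lt by auto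
  qed
  then show ?thesis using that[of a] link_states_range[OF w, of a] by auto
qed

lemma downs_subset_Suc:
  assumes "\<not> S (Suc n)" shows "downs S \<subseteq> {1..Suc n} \<longleftrightarrow> downs S \<subseteq> {1..n}"
proof -
  have "{1..Suc n} = insert (Suc n) {1..n}" by auto
  moreover have "Suc n \<notin> downs S" using assms by simp
  ultimately show ?thesis by (metis subset_insert)
qed

context nonzero_parameter
begin

text \<open>At a configuration of nonzero weight each cup has exactly one down end and each through
  strand is up, so the down spins together with their partners make up the 2p ends.\<close>

lemma link_vec_graded:
  assumes w: "w \<in> link_states n p" shows "link_vec n w \<in> graded n p"
proof (rule gradedI)
  fix S assume nz: "link_vec n w S \<noteq> 0"
  then have sub: "downs S \<subseteq> {1..n}" by (auto simp: link_vec_def split: if_splits)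
  then have site: "site_weight w S k \<noteq> 0" if "k \<in> {1..n}" for k
    using nz that by (auto simp: link_vec_def)
  have s1: "S k \<Longrightarrow> w k \<noteq> k" "w k \<noteq> k \<Longrightarrow> S (w k) = (\<not> S k)" for k
    using site[of k] sub downs_iff[of k S] link_states_range[OF w, of k] 
    by (auto simp: site_weight_def split: if_splits simp del: downs_iff)
  have inv: "w (w k) = k" for k by (rule link_statesD(2)[OF w])
  have un: "{k. w k \<noteq> k} = downs S \<union> w ` downs S"
  proof (intro equalityI subsetI)
    fix k assume "k \<in> {k. w k \<noteq> k}"
    then show "k \<in> downs S \<union> w ` downs S"
      using s1(2)[of k] inv[of k] by (cases "S k") (auto intro: rev_image_eqI[of "w k"])
  next
    fix k assume "k \<in> downs S \<union> w ` downs S"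
    then show "k \<in> {k. w k \<noteq> k}"
      using s1(1) inv by (auto) metis
  qed
  have "downs S \<inter> w ` downs S = {}" using s1 by auto
  moreover have "inj_on w (downs S)" using inv by (metis inj_onI)
  moreover have "finite (downs S)" using sub by (rule finite_spins)
  ultimately have "card {k. w k \<noteq> k} = 2 * card (downs S)"
    unfolding un by (subst card_Un_disjoint) (auto simp: card_image)
  then show "downs S \<subseteq> {1..n} \<and> card (downs S) = p"
    using sub link_states_card[OF w] by simp
qed

lemma link_vec_through:
  assumes "w \<in> link_states n p" shows "link_vec (Suc n) w = link_vec n w"
proof
  fix S :: spins
  have o: "w (Suc n) = Suc n" using link_states_outside[OF assms] by auto
  show "link_vec (Suc n) w S = link_vec n w S"
  proof (cases "S (Suc n)")
    case True
    then have "Suc n \<in> downs S" by simp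
    then have "\<not> downs S \<subseteq> {1..n}" by (meson Suc_n_not_le_n atLeastAtMost_iff subsetD)
    moreover have "site_weight w S (Suc n) = 0" using True o by (simp add: site_weight_def)
    ultimately show ?thesis by (auto simp: link_vec_def)
  next
    case False
    then have "downs S \<subseteq> {1..Suc n} \<longleftrightarrow> downs S \<subseteq> {1..n}"
      by (rule downs_subset_Suc)
    moreover have "site_weight w S (Suc n) = 1" using False o by (simp add: site_weight_def)
    ultimately show ?thesis by (simp add: link_vec_def)
  qed
qed

lemma tail_graded_zero: "f \<in> graded n k \<Longrightarrow> tail n f = 0"
  using gradedD[of f n k _ "Suc n"] by (auto simp: tail_def fun_eq_iff)

text \<open>If the right end n + 1 of a cup is down, its left end has to be up and carries the
  coefficient 1, exactly like a through strand.\<close>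

lemma tail_link_vec:
  assumes w: "w \<in> link_states (Suc n) p" and c: "w (Suc n) \<noteq> Suc n"
  shows "tail n (link_vec (Suc n) w) = link_vec n (link_cut n w)"
proof
  fix S :: spins
  define a where "a = w (Suc n)"
  define u where "u = link_cut n w"
  have wa: "w a = Suc n" using link_statesD(2)[OF w] by (simp add: a_def)
  have a: "1 \<le> a" "a \<le> n" "a \<noteq> Suc n" using link_states_range(3,4)[OF w c] c by (auto simp: a_def)
  have u: "u (Suc n) = Suc n" "u a = a" 
    "\<And>k. k \<noteq> Suc n \<Longrightarrow> k \<noteq> a \<Longrightarrow> u k = w k" by (auto simp: u_def link_cut_def a_def)
  have w': "w k \<noteq> Suc n" if "k \<noteq> a" for k using that link_statesD(2)[OF w, of k] by (auto simp: a_def)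
  show "tail n (link_vec (Suc n) w) S = link_vec n (link_cut n w) S"
  proof (cases "S (Suc n)")
    case True
    then have "Suc n \<in> downs S" by simp
    then have "\<not> downs S \<subseteq> {1..n}" by (meson Suc_n_not_le_n atLeastAtMost_iff subsetD)
    then show ?thesis using True by (simp add: tail_def link_vec_def)
  next
    case False
    then have "downs (S(Suc n := True)) \<subseteq> {1..Suc n} \<longleftrightarrow> downs S \<subseteq> {1..n}"
      using downs_subset_Suc[of S n] by (simp add: downs_upd)
    moreover have "site_weight w (S(Suc n := True)) k = site_weight u S k" if "k \<in> {1..n}" for k
      using that u(2,3) w'[of k] wa a False by (cases "k = a") (auto simp: site_weight_def)
    then have "(\<Prod>k\<in>{1..n}. site_weight w (S(Suc n := True)) k) = (\<Prod>k\<in>{1..n}. site_weight u S k)"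
      by (rule prod.cong[OF refl])
    moreover have "site_weight w (S(Suc n := True)) (Suc n) = (if S a then 0 else 1)"
      using a c by (auto simp: site_weight_def a_def[symmetric])
    moreover have "(\<Prod>k\<in>{1..n}. site_weight u S k) = 0" if "S a"
    proof (rule prod_zero)
      show "\<exists>k\<in>{1..n}. site_weight u S k = 0"
        using that a u(2) by (intro bexI[of _ a]) (auto simp: site_weight_def)
    qed simp
    ultimately show ?thesis using False
      by (cases "S a") (simp_all add: tail_def link_vec_def u_def[symmetric])
  qed
qed

lemma link_vec_cup:
  assumes w: "w \<in> link_states n p"
  shows "link_vec (Suc (Suc n)) (link_cup n w) = cup n (link_vec n w)"
proof
  fix S :: spins
  define u where "u = link_cup n w"
  have u: "u (Suc n) = Suc (Suc n)" "u (Suc (Suc n)) = Suc n" 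
    "\<And>k. k \<noteq> Suc n \<Longrightarrow> k \<noteq> Suc (Suc n) \<Longrightarrow> u k = w k" by (auto simp: u_def link_cup_def)
  obtain S0 a b where S: "S = S0(Suc n := a, Suc (Suc n) := b)" by (rule spins_cases2[of S "Suc n"])
  define T where "T = S0(Suc n := False, Suc (Suc n) := False)"
  have "insert (Suc n) (insert (Suc (Suc n)) (downs S)) = insert (Suc n) (insert (Suc (Suc n)) (downs T))"
    unfolding S T_def by (cases a; cases b) (auto simp: downs_upd)
  then have "downs S \<subseteq> {1..Suc (Suc n)} \<longleftrightarrow> downs T \<subseteq> {1..Suc (Suc n)}"
    by (metis atLeastAtMost_iff insert_subset le_Suc_eq Suc_le_eq le_refl zero_less_Suc One_nat_def)
  moreover have "\<not> T (Suc n)" "\<not> T (Suc (Suc n))" by (simp_all add: T_def)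
  ultimately have "downs S \<subseteq> {1..Suc (Suc n)} \<longleftrightarrow> downs T \<subseteq> {1..n}"
    using downs_subset_Suc[of T "Suc n"] downs_subset_Suc[of T n] by blast
  moreover have wk: "w k \<le> n" if "k \<in> {1..n}" for k
    using that link_states_range(4)[OF w, of k] by (cases "w k = k") auto
  have "site_weight u S k = site_weight w T k" if "k \<in> {1..n}" for k
    using that u(3)[of k] wk[OF that] unfolding S T_def by (auto simp: site_weight_def)
  then have "(\<Prod>k\<in>{1..n}. site_weight u S k) = (\<Prod>k\<in>{1..n}. site_weight w T k)"
    by (rule prod.cong[OF refl])
  moreover have "site_weight u S (Suc n) * site_weight u S (Suc (Suc n)) = (if a = b then 0 else if a then q else 1)"
    unfolding S by (simp add: site_weight_def u)
  ultimately have "link_vec (Suc (Suc n)) u S =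
      (if downs T \<subseteq> {1..n} then (\<Prod>k\<in>{1..n}. site_weight w T k) * (if a = b then 0 else if a then q else 1) else 0)"
    unfolding link_vec_def by (simp add: mult.assoc del: mult_eq_0_iff)
  moreover have "cup n (link_vec n w) S = (if a = b then 0 else (if a then q else 1) * link_vec n w T)"
    unfolding S T_def cup_def by (simp add: upd_sort)
  ultimately show "link_vec (Suc (Suc n)) (link_cup n w) S = cup n (link_vec n w) S"
    unfolding u_def[symmetric] by (simp add: link_vec_def)
qed

end

section \<open>Standard representations inside tensor space\<close>

lemma span_maps_into:
  fixes L :: "('a \<Rightarrow> complex) \<Rightarrow> ('b \<Rightarrow> complex)"
  assumes "\<And>f g. L (f + g) = L f + L g" "\<And>c f. L (fscale c f) = fscale c (L f)"
    and "\<And>b. b \<in> B \<Longrightarrow> L b \<in> V" "fun_vs.subspace V" "f \<in> fun_vs.span B"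
  shows "L f \<in> V"
proof -
  have "fun_vs.subspace {f. L f \<in> V}"
  proof (rule fun_vs.subspaceI)
    have *: "fscale 0 g = 0" for g :: "'c \<Rightarrow> complex" by (rule ext) simp
    have "L 0 = 0" using assms(2)[of 0 0] unfolding * .
    then show "0 \<in> {f. L f \<in> V}" using fun_vs.subspace_0[OF assms(4)] by simp
  qed (use assms(1,2,4) in \<open>auto simp: fun_vs.subspace_add fun_vs.subspace_scale\<close>)
  then have "fun_vs.span B \<subseteq> {f. L f \<in> V}"
    using assms(3) by (intro fun_vs.span_minimal) auto
  then show ?thesis using assms(5) by auto
qed

context nonzero_parameter
begin

lemma cup_diff: "cup n (f - g) = cup n f - cup n g"
  by (auto simp: cup_def fun_eq_iff algebra_simps)

lemma graded_cap:
  assumes "f \<in> graded (Suc (Suc n)) (Suc k)" shows "cap n f \<in> graded n k"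
proof (rule gradedI)
  fix S assume nz: "cap n f S \<noteq> 0"
  then have S: "\<not> S (Suc n)" "\<not> S (Suc (Suc n))" by (auto simp: cap_def split: if_splits)
  then have "f (S(Suc (Suc n) := True)) \<noteq> 0 \<or> f (S(Suc n := True)) \<noteq> 0"
    using nz by (auto simp: cap_def)
  then obtain m where m: "m = Suc n \<or> m = Suc (Suc n)" "f (S(m := True)) \<noteq> 0" by blast
  then have *: "insert m (downs S) \<subseteq> {1..Suc (Suc n)}" "card (insert m (downs S)) = Suc k"
    using graded_supp[OF assms m(2)] by (simp_all only: downs_upd)
  then have "downs S \<subseteq> {1..n}"
    using downs_subset_Suc[of S "Suc n"] downs_subset_Suc[of S n] S by simp
  moreover have "finite (downs S)" using calculation by (rule finite_spins)
  ultimately show "downs S \<subseteq> {1..n} \<and> card (downs S) = k"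
    using * m(1) S by auto
qed

definition standard :: "nat \<Rightarrow> nat \<Rightarrow> tensor set" where
  "standard n p = fun_vs.span (link_vec n ` link_states n p)"

definition link_comb :: "nat \<Rightarrow> nat \<Rightarrow> (link \<Rightarrow> complex) \<Rightarrow> tensor" where
  "link_comb n p a = (\<lambda>S. \<Sum>w\<in>link_states n p. a w * link_vec n w S)"

lemma subspace_standard: "fun_vs.subspace (standard n p)"
  by (simp add: standard_def)

lemma link_vec_in_standard: "w \<in> link_states n p \<Longrightarrow> link_vec n w \<in> standard n p"
  unfolding standard_def by (intro fun_vs.span_base) auto

lemma standard_0: "standard n p \<subseteq> V" if "\<And>w. w \<in> link_states n p \<Longrightarrow> link_vec n w \<in> V" "fun_vs.subspace V"
  unfolding standard_def using that by (intro fun_vs.span_minimal) auto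

lemma link_comb_eq_sum: "link_comb n p a = (\<Sum>w\<in>link_states n p. fscale (a w) (link_vec n w))"
  by (rule ext) (simp add: link_comb_def sum_fun_apply)

lemma link_comb_in_standard: "link_comb n p a \<in> standard n p"
  unfolding link_comb_eq_sum
  by (intro fun_vs.subspace_sum subspace_standard fun_vs.subspace_scale link_vec_in_standard)

lemma standard_eq: "standard n p = range (link_comb n p)"
proof (intro equalityI)
  show "standard n p \<subseteq> range (link_comb n p)"
  proof (rule standard_0)
    fix w assume w: "w \<in> link_states n p"
    have "link_vec n w S = (\<Sum>v\<in>link_states n p. (if v = w then 1 else 0) * link_vec n v S)" for S
      using w finite_link_states[of n p] by (simp add: if_distrib[of "\<lambda>x. x * _"] cong: if_cong)
    then have "link_vec n w = link_comb n p (\<lambda>v. if v = w then 1 else 0)"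
      unfolding link_comb_def by (rule ext)
    then show "link_vec n w \<in> range (link_comb n p)" by blast
  next
    show "fun_vs.subspace (range (link_comb n p))"
    proof (rule fun_vs.subspaceI)
      have "link_comb n p (\<lambda>_. 0) = 0" by (simp add: link_comb_def fun_eq_iff)
      then show "0 \<in> range (link_comb n p)" by (metis rangeI)
      fix x y assume "x \<in> range (link_comb n p)" "y \<in> range (link_comb n p)"
      then obtain a b where "x = link_comb n p a" "y = link_comb n p b" by blast
      then have "x + y = link_comb n p (\<lambda>w. a w + b w)"
        by (simp add: link_comb_def fun_eq_iff sum.distrib algebra_simps)
      then show "x + y \<in> range (link_comb n p)" by blast
    next
      fix c x assume "x \<in> range (link_comb n p)"
      then obtain a where "x = link_comb n p a" by blast
      then have "fscale c x = link_comb n p (\<lambda>w. c * a w)"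
        by (simp add: link_comb_def fun_eq_iff sum_distrib_left algebra_simps)
      then show "fscale c x \<in> range (link_comb n p)" by blast
    qed
  qed
qed (use link_comb_in_standard in auto)

lemma standard_graded: "f \<in> standard n p \<Longrightarrow> f \<in> graded n p"
  using standard_0[OF link_vec_graded subspace_graded] by blast

lemma tl_e_standard:
  assumes "f \<in> standard n p" "1 \<le> j" "Suc j \<le> n" shows "tl_e j f \<in> standard n p"
proof (rule span_maps_into[where L = "tl_e j" and B = "link_vec n ` link_states n p", OF tl_e_add tl_e_scale _ subspace_standard])
  fix b assume "b \<in> link_vec n ` link_states n p"
  then obtain w where w: "w \<in> link_states n p" "b = link_vec n w" by blast
  show "tl_e j b \<in> standard n p"
    unfolding w(2) link_vec_equivariant[OF w(1) assms(2,3)]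
    using link_join_in_link_states[OF w(1) assms(2,3)] link_vec_in_standard[OF w(1)]
    by (auto simp: fun_vs.subspace_0[OF subspace_standard] fun_vs.subspace_scale[OF subspace_standard] intro: link_vec_in_standard)
qed (use assms(1) in \<open>simp add: standard_def\<close>)

lemma standard_mono: "f \<in> standard n p \<Longrightarrow> f \<in> standard (Suc n) p"
proof -
  have "standard n p \<subseteq> standard (Suc n) p"
  proof (rule standard_0)
    fix w assume w: "w \<in> link_states n p"
    then show "link_vec n w \<in> standard (Suc n) p"
      using link_vec_in_standard[OF link_states_mono[OF w]] link_vec_through[OF w] by simp
  qed (rule subspace_standard)
  then show "f \<in> standard n p \<Longrightarrow> f \<in> standard (Suc n) p" by blast
qed

lemma tail_standard:
  assumes "f \<in> standard (Suc n) (Suc p)" shows "tail n f \<in> standard n p"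
proof (rule span_maps_into[where L = "tail n" and B = "link_vec (Suc n) ` link_states (Suc n) (Suc p)", OF tail_add tail_scale _ subspace_standard])
  fix b assume "b \<in> link_vec (Suc n) ` link_states (Suc n) (Suc p)"
  then obtain w where w: "w \<in> link_states (Suc n) (Suc p)" "b = link_vec (Suc n) w" by blast
  show "tail n b \<in> standard n p"
  proof (cases "w (Suc n) = Suc n")
    case True
    note w' = link_states_through[OF w(1) True]
    show ?thesis unfolding w(2) link_vec_through[OF w'] tail_graded_zero[OF link_vec_graded[OF w']]
      by (rule fun_vs.subspace_0[OF subspace_standard])
  next
    case False
    show ?thesis unfolding w(2) tail_link_vec[OF w(1) False]
      using link_cut_in_link_states[OF w(1) False] by (auto intro: link_vec_in_standard)
  qed
qed (use assms in \<open>simp add: standard_def\<close>)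

lemma cup_standard:
  assumes "g \<in> standard n p" shows "cup n g \<in> standard (Suc (Suc n)) (Suc p)"
proof (rule span_maps_into[where L = "cup n" and B = "link_vec n ` link_states n p", OF cup_add cup_scale _ subspace_standard])
  fix b assume "b \<in> link_vec n ` link_states n p"
  then obtain w where w: "w \<in> link_states n p" "b = link_vec n w" by blast
  show "cup n b \<in> standard (Suc (Suc n)) (Suc p)"
    unfolding w(2) link_vec_cup[OF w(1), symmetric]
    by (rule link_vec_in_standard[OF link_cup_in_link_states[OF w(1)]])
qed (use assms in \<open>simp add: standard_def\<close>)

lemma cup_eq_imp_eq:
  assumes "cup n f = cup n g" "f \<in> graded n k" "g \<in> graded n k" shows "f = g"
proof -
  have "cup n (f - g) = 0" unfolding cup_diff using assms(1) by simp
  moreover have "f - g \<in> graded n k" using assms(2,3) by (rule fun_vs.subspace_diff[OF subspace_graded])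
  ultimately have "f - g = 0" by (rule cup_inject)
  then show ?thesis by (metis eq_iff_diff_eq_0)
qed

text \<open>No diagrammatic description of capping is needed: \<open>cup\<close> after
  \<open>cap\<close> is a generator, whose effect on link vectors is known and ends in a cup on the
  last two points, and the injective \<open>cup\<close> can be cancelled.\<close>

lemma cap_standard:
  assumes "f \<in> standard (Suc (Suc n)) (Suc p)" shows "cap n f \<in> standard n p"
proof (rule span_maps_into[where L = "cap n" and B = "link_vec (Suc (Suc n)) ` link_states (Suc (Suc n)) (Suc p)", OF cap_add cap_scale _ subspace_standard])
  fix b assume "b \<in> link_vec (Suc (Suc n)) ` link_states (Suc (Suc n)) (Suc p)"
  then obtain w where w: "w \<in> link_states (Suc (Suc n)) (Suc p)" "b = link_vec (Suc (Suc n)) w" by blast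
  have gr: "cap n b \<in> graded n p" unfolding w(2) by (intro graded_cap link_vec_graded w)
  have eq: "cup n (cap n b) = (if w (Suc n) = Suc (Suc n) then fscale loop (link_vec (Suc (Suc n)) w)
     else if w (Suc n) = Suc n \<and> w (Suc (Suc n)) = Suc (Suc n) then 0
     else link_vec (Suc (Suc n)) (link_join (Suc n) w))"
    unfolding w(2) tl_e_eq_cup_cap[symmetric] by (rule link_vec_equivariant[OF w(1)]) auto
  consider (a) "w (Suc n) = Suc (Suc n)" | (b) "w (Suc n) = Suc n \<and> w (Suc (Suc n)) = Suc (Suc n)"
    | (c) "w (Suc n) \<noteq> Suc (Suc n)" "w (Suc n) \<noteq> Suc n \<or> w (Suc (Suc n)) \<noteq> Suc (Suc n)" by blast
  then show "cap n b \<in> standard n p"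
  proof cases
    case a
    obtain v where v: "v \<in> link_states n (Suc p - 1)" "w = link_cup n v"
      using link_cup_decompose[OF w(1) a] by metis
    have v': "v \<in> link_states n p" using v(1) by simp
    have "b = cup n (link_vec n v)" unfolding w(2) v(2) by (rule link_vec_cup[OF v(1)])
    then have "cap n b = fscale loop (link_vec n v)"
      using cap_cup[OF link_vec_graded[OF v']] by simp
    then show ?thesis
      using fun_vs.subspace_scale[OF subspace_standard link_vec_in_standard[OF v'], of loop] by (simp only:)
  next
    case b
    have "cup n (cap n b) = 0" unfolding eq using b by simp
    then have "cap n b = 0" using gr by (rule cup_inject)
    then show ?thesis using fun_vs.subspace_0[OF subspace_standard] by (simp only:)
  next
    case c
    define u where "u = link_join (Suc n) w"
    have u: "u \<in> link_states (Suc (Suc n)) (Suc p)"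
      unfolding u_def by (rule link_join_in_link_states[OF w(1) _ _ c]) auto
    have u': "u (Suc n) = Suc (Suc n)" by (simp add: u_def link_join_def)
    obtain v where v: "v \<in> link_states n (Suc p - 1)" "u = link_cup n v"
      using link_cup_decompose[OF u u'] by metis
    have v': "v \<in> link_states n p" using v(1) by simp
    have "cup n (cap n b) = link_vec (Suc (Suc n)) u"
      unfolding eq u_def using c by auto
    also have "\<dots> = cup n (link_vec n v)" unfolding v(2) by (rule link_vec_cup[OF v(1)])
    finally have "cap n b = link_vec n v"
      using gr link_vec_graded[OF v'] by (rule cup_eq_imp_eq)
    then show ?thesis using link_vec_in_standard[OF v'] by (simp only:)
  qed
qed (use assms in \<open>simp add: standard_def\<close>)

text \<open>Moving an adjacent cup one place to the right and back, the relation e_j e_{j+1} e_j =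
  e_j on link states.\<close>

lemma link_join_back:
  assumes w: "w \<in> link_states n p" and j: "w j = Suc j"
  shows "link_join j (link_join (Suc j) w) = w"
proof
  fix k
  have inv: "w (w k) = k" for k by (rule link_statesD(2)[OF w])
  have wj: "w (Suc j) = j" using inv[of j] j by simp
  define b where "b = w (Suc (Suc j))"
  have wb: "w b = Suc (Suc j)" using inv b_def by simp
  have b: "b \<noteq> j" "b \<noteq> Suc j" using wb j wj by auto
  define u where "u = link_join (Suc j) w"
  have u: "u k = (if k = Suc j then Suc (Suc j) else if k = Suc (Suc j) then Suc j
      else if k = j then (if b = Suc (Suc j) then j else b) else if k = b then j else w k)" for k
    using wj b by (auto simp: u_def link_join_def b_def)
  show "link_join j (link_join (Suc j) w) k = w k"
    unfolding u_def[symmetric]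
  proof (cases "b = Suc (Suc j)")
    case True
    show "link_join j u k = w k"
      using True wb wj j by (auto simp: link_join_def u)
  next
    case False
    show "link_join j u k = w k"
      using False wb wj j b inv[of "Suc (Suc j)"] b_def by (auto simp: link_join_def u)
  qed
qed

text \<open>The working induction principle: V_{n+2,p+1} is generated by the states with a cup on
  the last two points, since an adjacent cup of any state can be pushed to the right end by
  generators and brought back. A property stable under linear combinations and generators need only
  be checked on \<open>cup n g\<close>.\<close>

lemma standard_generated:
  assumes N: "fun_vs.subspace N" and st: "\<And>f j. f \<in> N \<Longrightarrow> 1 \<le> j \<Longrightarrow> j \<le> Suc n \<Longrightarrow> tl_e j f \<in> N"
    and gen: "\<And>g. g \<in> standard n p \<Longrightarrow> cup n g \<in> N"
  shows "standard (Suc (Suc n)) (Suc p) \<subseteq> N"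
proof (rule standard_0[OF _ N])
  have *: "link_vec (Suc (Suc n)) w \<in> N" if "w \<in> link_states (Suc (Suc n)) (Suc p)" "1 \<le> j" "j \<le> Suc n" "w j = Suc j" for w j
    using that(3,2,1,4)
  proof (induction arbitrary: w rule: inc_induct)
    case base
    obtain v where v: "v \<in> link_states n (Suc p - 1)" "w = link_cup n v"
      using link_cup_decompose[OF base(2,3)] by metis
    show ?case using gen[OF link_vec_in_standard[of v n p]] v link_vec_cup[OF v(1)] by simp
  next
    case (step j)
    have wj: "w (Suc j) = j" using link_statesD(2)[OF step(5), of j] step(6) by simp
    define u where "u = link_join (Suc j) w"
    have u: "u \<in> link_states (Suc (Suc n)) (Suc p)"
      unfolding u_def using wj step by (intro link_join_in_link_states) auto
    have uj: "u (Suc j) = Suc (Suc j)" by (simp add: u_def link_join_def)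
    have "link_vec (Suc (Suc n)) u \<in> N" using step.IH[of u] u uj by simp
    then have "tl_e j (link_vec (Suc (Suc n)) u) \<in> N" using step by (intro st) auto
    moreover have "u j \<noteq> Suc j" 
      using link_statesD(2)[OF u, of j] uj by auto
    then have "tl_e j (link_vec (Suc (Suc n)) u) = link_vec (Suc (Suc n)) (link_join j u)"
      using link_vec_equivariant[OF u, of j] step uj by simp
    ultimately show ?case using link_join_back[OF step(5,6)] by (simp add: u_def)
  qed
  fix w assume w: "w \<in> link_states (Suc (Suc n)) (Suc p)"
  obtain j where "1 \<le> j" "Suc j \<le> Suc (Suc n)" "w j = Suc j" by (rule adjacent_cup_exists[OF w]) auto
  then show "link_vec (Suc (Suc n)) w \<in> N" using *[OF w] by auto
qed

lemma link_comb_split: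
  "tail n (link_comb (Suc n) p a) =
    link_comb n (p - 1) (\<lambda>u. \<Sum>w\<in>{w \<in> link_states (Suc n) p. w (Suc n) \<noteq> Suc n \<and> link_cut n w = u}. a w)"
proof -
  let ?L = "link_states (Suc n) p"
  let ?L2 = "{w \<in> ?L. w (Suc n) \<noteq> Suc n}"
  have fin: "finite ?L" by (rule finite_link_states)
  have "tail n (link_comb (Suc n) p a) S = (\<Sum>w\<in>?L. a w * tail n (link_vec (Suc n) w) S)" for S
    by (simp add: tail_def link_comb_def)
  also have "\<And>S. (\<Sum>w\<in>?L. a w * tail n (link_vec (Suc n) w) S) = (\<Sum>w\<in>?L2. a w * tail n (link_vec (Suc n) w) S)"
  proof (rule sum.mono_neutral_right[OF fin])
    fix S show "\<forall>w\<in>?L - ?L2. a w * tail n (link_vec (Suc n) w) S = 0"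
    proof
      fix w assume "w \<in> ?L - ?L2"
      then have w: "w \<in> ?L" "w (Suc n) = Suc n" by auto
      note w' = link_states_through[OF w]
      have "tail n (link_vec (Suc n) w) = 0"
        unfolding link_vec_through[OF w'] by (rule tail_graded_zero[OF link_vec_graded[OF w']])
      then show "a w * tail n (link_vec (Suc n) w) S = 0" by simp
    qed
  qed auto
  also have "\<And>S. (\<Sum>w\<in>?L2. a w * tail n (link_vec (Suc n) w) S) = (\<Sum>w\<in>?L2. a w * link_vec n (link_cut n w) S)"
    by (intro sum.cong refl) (auto simp: tail_link_vec)
  also have "\<And>S. (\<Sum>w\<in>?L2. a w * link_vec n (link_cut n w) S) =
     (\<Sum>u\<in>link_states n (p - 1). \<Sum>w\<in>{w \<in> ?L2. link_cut n w = u}. a w * link_vec n (link_cut n w) S)"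
    using fin link_cut_in_link_states by (intro sum.group[symmetric] finite_link_states) auto
  also have "\<And>S. \<dots> S = (\<Sum>u\<in>link_states n (p - 1). (\<Sum>w\<in>{w \<in> ?L. w (Suc n) \<noteq> Suc n \<and> link_cut n w = u}. a w) * link_vec n u S)"
    by (intro sum.cong refl) (auto simp: sum_distrib_right intro!: sum.cong)
  finally show ?thesis by (simp add: link_comb_def fun_eq_iff)
qed

text \<open>Distinct states with a cup ending at n + 1 have distinct cuts, so the inner sums of
  \<open>link_comb_split\<close> have one term each. Independence on n points is the hypothesis
  \<open>ind\<close>, which lets the lemma serve inside the induction for independence as well as
  after it.\<close>

lemma link_comb_tail_zero:
  assumes ind: "\<And>p a. link_comb n p a = 0 \<Longrightarrow> \<forall>w\<in>link_states n p. a w = 0"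
    and "tail n (link_comb (Suc n) p a) = 0"
  shows "\<forall>w\<in>link_states (Suc n) p. w (Suc n) \<noteq> Suc n \<longrightarrow> a w = 0"
    and "link_comb (Suc n) p a = link_comb n p a"
proof -
  let ?L = "link_states (Suc n) p"
  show *: "\<forall>w\<in>?L. w (Suc n) \<noteq> Suc n \<longrightarrow> a w = 0"
  proof (intro ballI impI)
    fix w assume w: "w \<in> ?L" "w (Suc n) \<noteq> Suc n"
    have "(\<Sum>v\<in>{v \<in> ?L. v (Suc n) \<noteq> Suc n \<and> link_cut n v = link_cut n w}. a v) = 0"
      using ind[of "p - 1"] assms(2) link_cut_in_link_states[OF w] unfolding link_comb_split by blast
    moreover have "{v \<in> ?L. v (Suc n) \<noteq> Suc n \<and> link_cut n v = link_cut n w} = {w}"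
      using w link_cut_inject by blast
    ultimately show "a w = 0" by simp
  qed
  have sub: "link_states n p \<subseteq> ?L" using link_states_mono by blast
  have "link_comb (Suc n) p a S = link_comb n p a S" for S
  proof -
    have "link_comb (Suc n) p a S = (\<Sum>w\<in>link_states n p. a w * link_vec (Suc n) w S)"
      unfolding link_comb_def
      using * link_states_through by (intro sum.mono_neutral_right finite_link_states sub) auto
    also have "\<dots> = link_comb n p a S"
      unfolding link_comb_def by (intro sum.cong refl) (simp add: link_vec_through)
    finally show ?thesis .
  qed
  then show "link_comb (Suc n) p a = link_comb n p a" by (rule ext)
qed

text \<open>This holds for every nonzero q. \<open>tail\<close> detects the coefficients of the
  states with a cup ending at n + 1; the remaining states already live on n points.\<close>

lemma link_comb_independent: "link_comb n p a = 0 \<Longrightarrow> \<forall>w\<in>link_states n p. a w = 0"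
proof (induction n arbitrary: p a)
  case 0
  show ?case
  proof (cases p)
    case 0
    have "link_comb 0 0 a (\<lambda>_. False) = a id"
      by (simp add: link_comb_def link_states_0 link_vec_def downs_def)
    moreover have "link_comb 0 0 a (\<lambda>_. False) = 0" using "0.prems" 0 by simp
    ultimately have "a id = 0" by simp
    then show ?thesis using 0 link_states_0[of 0] by (metis singletonD)
  qed (simp add: link_states_empty)
next
  case (Suc n)
  have t: "tail n (link_comb (Suc n) p a) = 0" by (simp only: Suc.prems tail_zero)
  note * = link_comb_tail_zero[OF Suc.IH t]
  have "\<forall>w\<in>link_states n p. a w = 0" by (rule Suc.IH) (metis *(2) Suc.prems)
  then show ?case using *(1) link_states_through by blast
qed

lemma standard_tail_zero:
  assumes "f \<in> standard (Suc n) p" "tail n f = 0" shows "f \<in> standard n p"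
proof -
  obtain a where a: "f = link_comb (Suc n) p a" using assms(1) standard_eq by blast
  show ?thesis
    using link_comb_tail_zero(2)[OF link_comb_independent, of n p a] assms(2) a link_comb_in_standard by simp
qed

end

section \<open>Raising and lowering operators\<close>

context nonzero_parameter
begin

text \<open>The group-like factor of the coproduct on the sites to the left of the one acted on. Its
  signs are dictated by the plus sign in the cup vector, which both \<open>raise\<close> and
  \<open>lower\<close> have to annihilate.\<close>

fun spin_phase :: "nat \<Rightarrow> spins \<Rightarrow> complex" where
  "spin_phase 0 S = 1"
| "spin_phase (Suc n) S = spin_phase n S * (if S (Suc n) then - inverse q else - q)"

fun raise :: "nat \<Rightarrow> tensor \<Rightarrow> tensor" where
  "raise 0 f S = 0"
| "raise (Suc n) f S = raise n f S + (if S (Suc n) then 0 else spin_phase n S * f (S(Suc n := True)))"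

fun lower :: "nat \<Rightarrow> tensor \<Rightarrow> tensor" where
  "lower 0 f S = 0"
| "lower (Suc n) f S = lower n f S + (if S (Suc n) then spin_phase n S * f (S(Suc n := False)) else 0)"

text \<open>The sum of f over configurations on n points with weight (-q) to the sum of the down
  positions. These weights are the coordinates of \<open>sym_vec\<close>, which is why the
  functional vanishes on the image of each generator.\<close>

fun weighted_sum :: "nat \<Rightarrow> tensor \<Rightarrow> complex" where
  "weighted_sum 0 f = f (\<lambda>_. False)"
| "weighted_sum (Suc n) f = weighted_sum n f + (- q) ^ Suc n * weighted_sum n (tail n f)"

lemma raise_add: "raise n (f + g) = raise n f + raise n g"
  by (rule ext, induction n) (auto simp: algebra_simps)
lemma raise_scale: "raise n (fscale c f) = fscale c (raise n f)"
  by (rule ext, induction n) (auto simp: algebra_simps)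
lemma raise_diff: "raise n (f - g) = raise n f - raise n g"
  by (rule ext, induction n) (auto simp: algebra_simps)
lemma raise_zero [simp]: "raise n 0 = 0"
  by (rule ext, induction n) auto
lemma lower_add: "lower n (f + g) = lower n f + lower n g"
  by (rule ext, induction n) (auto simp: algebra_simps)
lemma lower_scale: "lower n (fscale c f) = fscale c (lower n f)"
  by (rule ext, induction n) (auto simp: algebra_simps)
lemma lower_zero [simp]: "lower n 0 = 0"
  by (rule ext, induction n) auto

lemma spin_phase_upd: "n < k \<Longrightarrow> spin_phase n (S(k := b)) = spin_phase n S"
  by (induction n) auto

text \<open>A neighbouring pair with one up and one down spin contributes (-q)(-q^-1) = 1 in either
  order.\<close>

lemma spin_phase_neutral:
  "Suc (Suc i) \<le> n \<Longrightarrow> S (Suc i) \<noteq> S (Suc (Suc i)) \<Longrightarrow> T (Suc i) \<noteq> T (Suc (Suc i)) \<Longrightarrow>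
    (\<And>k. k \<noteq> Suc i \<Longrightarrow> k \<noteq> Suc (Suc i) \<Longrightarrow> S k = T k) \<Longrightarrow> spin_phase n S = spin_phase n T"
proof (induction n rule: dec_induct)
  case base
  have "spin_phase i S = spin_phase i T"
  proof -
    have "m \<le> i \<Longrightarrow> spin_phase m S = spin_phase m T" for m
      using base(3) by (induction m) auto
    then show ?thesis by simp
  qed
  then show ?case using base by auto
next
  case (step n)
  then show ?case by auto
qed

lemma raise_tl_e_below:
  assumes "n < j" shows "raise n (tl_e j f) = tl_e j (raise n f)"
  using assms
proof (induction n)
  case 0
  show ?case by (rule ext) (simp add: tl_e_def)
next
  case (Suc n)
  show ?case
  proof (rule ext)
    fix S :: spins
    have tw: "T(Suc n := x, j := y) = T(j := y, Suc n := x)" "T(Suc n := x, Suc j := y) = T(Suc j := y, Suc n := x)" for T :: spins and x y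
      using Suc.prems by (auto simp: fun_eq_iff)
    have "raise n (tl_e j f) S = tl_e j (raise n f) S" using Suc by simp
    then show "raise (Suc n) (tl_e j f) S = tl_e j (raise (Suc n) f) S"
      using Suc.prems by (auto simp: tl_e_def spin_phase_upd tw algebra_simps)
  qed
qed

lemma raise_tl_e:
  assumes "1 \<le> j" "Suc j \<le> n" shows "raise n (tl_e j f) = tl_e j (raise n f)"
  using assms(2)
proof (induction n rule: dec_induct)
  case base
  obtain i where j: "j = Suc i" using assms(1) not0_implies_Suc by (metis not_one_le_zero)
  show ?case
  proof (rule ext)
    fix S :: spins
    obtain S0 a b where S: "S = S0(j := a, Suc j := b)" by (rule spins_cases2[of S j])
    have "raise i (tl_e j f) S = tl_e j (raise i f) S" using raise_tl_e_below[of i j f] j by simp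
    then show "raise (Suc j) (tl_e j f) S = tl_e j (raise (Suc j) f) S"
      unfolding S j by (cases a; cases b) (simp_all add: tl_e_def spin_phase_upd upd_sort field_simps)
  qed
next
  case (step n)
  show ?case
  proof (rule ext)
    fix S :: spins
    have tw: "T(Suc n := x, j := y) = T(j := y, Suc n := x)" "T(Suc n := x, Suc j := y) = T(Suc j := y, Suc n := x)" for T :: spins and x y
      using step by (auto simp: fun_eq_iff)
    obtain i where j: "j = Suc i" using assms(1) not0_implies_Suc by (metis not_one_le_zero)
    have ph: "spin_phase n (S(j := x, Suc j := \<not> x)) = spin_phase n S" if "S j \<noteq> S (Suc j)" for x
      using step that unfolding j by (intro spin_phase_neutral[of i]) auto
    have "raise n (tl_e j f) S = tl_e j (raise n f) S" using step by simp
    then show "raise (Suc n) (tl_e j f) S = tl_e j (raise (Suc n) f) S"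
      using step(1) ph[of True] ph[of False] by (auto simp: tl_e_def tw algebra_simps)
  qed
qed

lemma lower_tl_e_below:
  assumes "n < j" shows "lower n (tl_e j f) = tl_e j (lower n f)"
  using assms
proof (induction n)
  case 0
  show ?case by (rule ext) (simp add: tl_e_def)
next
  case (Suc n)
  show ?case
  proof (rule ext)
    fix S :: spins
    have tw: "T(Suc n := x, j := y) = T(j := y, Suc n := x)" "T(Suc n := x, Suc j := y) = T(Suc j := y, Suc n := x)" for T :: spins and x y
      using Suc.prems by (auto simp: fun_eq_iff)
    have "lower n (tl_e j f) S = tl_e j (lower n f) S" using Suc by simp
    then show "lower (Suc n) (tl_e j f) S = tl_e j (lower (Suc n) f) S"
      using Suc.prems by (auto simp: tl_e_def spin_phase_upd tw algebra_simps)
  qed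
qed

lemma lower_tl_e:
  assumes "1 \<le> j" "Suc j \<le> n" shows "lower n (tl_e j f) = tl_e j (lower n f)"
  using assms(2)
proof (induction n rule: dec_induct)
  case base
  obtain i where j: "j = Suc i" using assms(1) not0_implies_Suc by (metis not_one_le_zero)
  show ?case
  proof (rule ext)
    fix S :: spins
    obtain S0 a b where S: "S = S0(j := a, Suc j := b)" by (rule spins_cases2[of S j])
    have "lower i (tl_e j f) S = tl_e j (lower i f) S" using lower_tl_e_below[of i j f] j by simp
    then show "lower (Suc j) (tl_e j f) S = tl_e j (lower (Suc j) f) S"
      unfolding S j by (cases a; cases b) (simp_all add: tl_e_def spin_phase_upd upd_sort field_simps)
  qed
next
  case (step n)
  show ?case
  proof (rule ext)
    fix S :: spins
    have tw: "T(Suc n := x, j := y) = T(j := y, Suc n := x)" "T(Suc n := x, Suc j := y) = T(Suc j := y, Suc n := x)" for T :: spins and x y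
      using step by (auto simp: fun_eq_iff)
    obtain i where j: "j = Suc i" using assms(1) not0_implies_Suc by (metis not_one_le_zero)
    have ph: "spin_phase n (S(j := x, Suc j := \<not> x)) = spin_phase n S" if "S j \<noteq> S (Suc j)" for x
      using step that unfolding j by (intro spin_phase_neutral[of i]) auto
    have "lower n (tl_e j f) S = tl_e j (lower n f) S" using step by simp
    then show "lower (Suc n) (tl_e j f) S = tl_e j (lower (Suc n) f) S"
      using step(1) ph[of True] ph[of False] by (auto simp: tl_e_def tw algebra_simps)
  qed
qed

lemma raise_cup_below: "m \<le> n \<Longrightarrow> raise m (cup n g) = cup n (raise m g)"
proof (induction m)
  case 0
  show ?case by (rule ext) (simp add: cup_def)
next
  case (Suc m)
  show ?case
  proof (rule ext)
    fix S :: spins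
    have tw: "T(Suc n := y, Suc m := x) = T(Suc m := x, Suc n := y)" 
      "T(Suc (Suc n) := y, Suc m := x) = T(Suc m := x, Suc (Suc n) := y)" for T :: spins and x y
      using Suc.prems by (auto simp: fun_eq_iff)
    have "raise m (cup n g) S = cup n (raise m g) S" using Suc by simp
    then show "raise (Suc m) (cup n g) S = cup n (raise (Suc m) g) S"
      using Suc.prems by (auto simp: cup_def spin_phase_upd tw algebra_simps)
  qed
qed

lemma lower_cup_below: "m \<le> n \<Longrightarrow> lower m (cup n g) = cup n (lower m g)"
proof (induction m)
  case 0
  show ?case by (rule ext) (simp add: cup_def)
next
  case (Suc m)
  show ?case
  proof (rule ext)
    fix S :: spins
    have tw: "T(Suc n := y, Suc m := x) = T(Suc m := x, Suc n := y)" 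
      "T(Suc (Suc n) := y, Suc m := x) = T(Suc m := x, Suc (Suc n) := y)" for T :: spins and x y
      using Suc.prems by (auto simp: fun_eq_iff)
    have "lower m (cup n g) S = cup n (lower m g) S" using Suc by simp
    then show "lower (Suc m) (cup n g) S = cup n (lower (Suc m) g) S"
      using Suc.prems by (auto simp: cup_def spin_phase_upd tw algebra_simps)
  qed
qed

lemma raise_cup: "raise (Suc (Suc n)) (cup n g) = cup n (raise n g)"
proof (rule ext)
  fix S :: spins
  obtain S0 a b where S: "S = S0(Suc n := a, Suc (Suc n) := b)" by (rule spins_cases2[of S "Suc n"])
  have "raise n (cup n g) S = cup n (raise n g) S" by (simp add: raise_cup_below)
  then show "raise (Suc (Suc n)) (cup n g) S = cup n (raise n g) S"
    unfolding S by (cases a; cases b) (simp_all add: cup_def spin_phase_upd upd_sort)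
qed

lemma lower_cup: "lower (Suc (Suc n)) (cup n g) = cup n (lower n g)"
proof (rule ext)
  fix S :: spins
  obtain S0 a b where S: "S = S0(Suc n := a, Suc (Suc n) := b)" by (rule spins_cases2[of S "Suc n"])
  have "lower n (cup n g) S = cup n (lower n g) S" by (simp add: lower_cup_below)
  then show "lower (Suc (Suc n)) (cup n g) S = cup n (lower n g) S"
    unfolding S by (cases a; cases b) (simp_all add: cup_def spin_phase_upd upd_sort field_simps)
qed

lemma tail_raise: "tail n (raise (Suc n) f) = raise n (tail n f)"
proof (rule ext)
  fix S :: spins
  have "m \<le> n \<Longrightarrow> raise m f (S(Suc n := True)) = raise m (tail n f) S" if "\<not> S (Suc n)" for m
    using that by (induction m) (auto simp: tail_def spin_phase_upd fun_upd_twist)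
  moreover have "m \<le> n \<Longrightarrow> raise m (tail n f) S = 0" if "S (Suc n)" for m
    using that by (induction m) (auto simp: tail_def)
  ultimately show "tail n (raise (Suc n) f) S = raise n (tail n f) S"
    by (simp add: tail_def)
qed

lemma graded_raise: assumes f: "f \<in> graded n (Suc k)" shows "raise n f \<in> graded n k"
proof (rule gradedI)
  fix S assume nz: "raise n f S \<noteq> 0"
  have "raise m f S \<noteq> 0 \<Longrightarrow> \<exists>a. \<not> S a \<and> f (S(a := True)) \<noteq> 0" for m
  proof (induction m)
    case (Suc m)
    show ?case
    proof (cases "raise m f S = 0")
      case True
      then have "\<not> S (Suc m) \<and> f (S(Suc m := True)) \<noteq> 0" using Suc.prems by (auto split: if_splits)
      then show ?thesis by blast
    qed (rule Suc.IH)
  qed simp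
  from this[OF nz] obtain a where a: "\<not> S a" "f (S(a := True)) \<noteq> 0" by blast
  have *: "insert a (downs S) \<subseteq> {1..n}" "card (insert a (downs S)) = Suc k"
    using graded_supp[OF f a(2)] by (simp_all only: downs_upd)
  then have "finite (downs S)" using finite_spins by auto
  then show "downs S \<subseteq> {1..n} \<and> card (downs S) = k" using * a(1) by simp
qed

lemma graded_lower: assumes f: "f \<in> graded n k" shows "lower n f \<in> graded n (Suc k)"
proof (rule gradedI)
  fix S assume nz: "lower n f S \<noteq> 0"
  have "lower m f S \<noteq> 0 \<Longrightarrow> \<exists>a. 1 \<le> a \<and> a \<le> m \<and> S a \<and> f (S(a := False)) \<noteq> 0" for m
    by (induction m) (force split: if_splits)+
  from this[OF nz] obtain a where a: "1 \<le> a" "a \<le> n" "S a" "f (S(a := False)) \<noteq> 0" by blast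
  have *: "downs S - {a} \<subseteq> {1..n}" "card (downs S - {a}) = k"
    using graded_supp[OF f a(4)] by (simp_all only: downs_upd)
  then have s: "downs S \<subseteq> {1..n}" using a by auto
  moreover have "card (downs S) = Suc (card (downs S - {a}))"
    using a s by (intro card.remove finite_spins) auto
  ultimately show "downs S \<subseteq> {1..n} \<and> card (downs S) = Suc k" using * by simp
qed

end

section \<open>Singular vectors\<close>

lemma downs_none [simp]: "downs (\<lambda>_. False) = {}"
  by (simp add: downs_def)

context nonzero_parameter
begin

lemma weighted_sum_add: "weighted_sum n (f + g) = weighted_sum n f + weighted_sum n g"
  by (induction n arbitrary: f g) (simp_all add: tail_add algebra_simps)
lemma weighted_sum_scale: "weighted_sum n (fscale c f) = c * weighted_sum n f"
  by (induction n arbitrary: f) (simp_all add: tail_scale algebra_simps)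
lemma weighted_sum_zero [simp]: "weighted_sum n 0 = 0"
  using weighted_sum_scale[of n 0 0] by (metis fun_vs.scale_zero_left mult_zero_left)

lemma weighted_sum_cong:
  assumes "\<And>S. downs S \<subseteq> {1..n} \<Longrightarrow> f S = g S" shows "weighted_sum n f = weighted_sum n g"
  using assms
proof (induction n arbitrary: f g)
  case 0
  have "downs (\<lambda>_. False) \<subseteq> {1..0}" by (auto simp: downs_def)
  from 0[OF this] show ?case by simp
next
  case (Suc n)
  have mono: "downs S \<subseteq> {1..n} \<Longrightarrow> downs S \<subseteq> {1..Suc n}" for S by (meson atLeastatMost_subset_iff le_SucI order_refl order_trans)
  have "weighted_sum n f = weighted_sum n g" using Suc.prems mono by (intro Suc.IH) blast
  moreover have "weighted_sum n (tail n f) = weighted_sum n (tail n g)"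
  proof (rule Suc.IH)
    fix S assume S: "downs S \<subseteq> {1..n}"
    then have "insert (Suc n) (downs S) \<subseteq> {1..Suc n}" using mono by simp
    then have "f (S(Suc n := True)) = g (S(Suc n := True))"
      using Suc.prems[of "S(Suc n := True)"] by (simp only: downs_upd)
    then show "tail n f S = tail n g S" by (simp add: tail_def)
  qed
  ultimately show ?case by simp
qed

text \<open>Moving the down spin from n + 1 to n + 2 multiplies the weight by -q and divides the
  value of h by q, so the two contributions cancel.\<close>

lemma weighted_sum_pair:
  assumes "\<And>S. S (Suc n) = S (Suc (Suc n)) \<Longrightarrow> h S = 0"
    and "\<And>S. \<not> S (Suc n) \<Longrightarrow> \<not> S (Suc (Suc n)) \<Longrightarrow> h (S(Suc n := True)) = q * h (S(Suc (Suc n) := True))"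
  shows "weighted_sum (Suc (Suc n)) h = 0"
proof -
  define X where "X = (\<lambda>S :: spins. h (S(Suc (Suc n) := True)))"
  have out: "\<not> S (Suc n) \<and> \<not> S (Suc (Suc n))" if "downs S \<subseteq> {1..n}" for S
    using that downs_iff[of "Suc n" S] downs_iff[of "Suc (Suc n)" S]
    by (metis Suc_n_not_le_n atLeastAtMost_iff le_SucI subsetD Suc_leD)
  have "weighted_sum n h = weighted_sum n 0"
    using out assms(1) by (intro weighted_sum_cong) auto
  then have 1: "weighted_sum n h = 0" by (simp only: weighted_sum_zero)
  have 2: "weighted_sum n (tail n h) = weighted_sum n (fscale q X)"
    using out assms(2) by (intro weighted_sum_cong) (auto simp: tail_def X_def)
  have 3: "weighted_sum n (tail (Suc n) h) = weighted_sum n X"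
    using out by (intro weighted_sum_cong) (auto simp: tail_def X_def)
  have "weighted_sum n (tail n (tail (Suc n) h)) = weighted_sum n 0"
    using out assms(1) by (intro weighted_sum_cong) (auto simp: tail_def)
  with 1 2 3 show ?thesis by (simp add: weighted_sum_scale algebra_simps)
qed

lemma weighted_sum_cup: "weighted_sum (Suc (Suc n)) (cup n g) = 0"
  by (rule weighted_sum_pair) (auto simp: cup_def upd_sort)

lemma weighted_sum_tl_e:
  assumes "1 \<le> j" "Suc j \<le> n" shows "weighted_sum n (tl_e j f) = 0"
  using assms(2)
proof (induction n arbitrary: f rule: dec_induct)
  case base
  obtain i where j: "j = Suc i" using assms(1) not0_implies_Suc by (metis not_one_le_zero)
  show ?case unfolding j tl_e_eq_cup_cap by (rule weighted_sum_cup)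
next
  case (step n)
  then show ?case using tl_e_tail[of j n f, symmetric] by simp
qed

lemma standard_small:
  assumes "f \<in> standard n p" "n < 2 * p" shows "f = 0"
  using assms by (simp only: standard_def link_states_empty image_empty fun_vs.span_empty singleton_iff)

text \<open>Read backwards, a nonzero weighted sum is an obstruction to lying in V_{n,k}. For
  \<open>sym_vec\<close> the obstruction is a Gaussian binomial.\<close>

lemma weighted_sum_standard:
  assumes "f \<in> standard n k" "1 \<le> k" shows "weighted_sum n f = 0"
proof (cases "n < 2 * k")
  case True
  then show ?thesis using standard_small[OF assms(1)] weighted_sum_zero by metis
next
  case False
  then have "2 \<le> n" using assms(2) by linarith
  then obtain m where n: "n = Suc (Suc m)" by (metis add_2_eq_Suc le_Suc_ex)
  obtain k' where k: "k = Suc k'" using assms(2) not0_implies_Suc by (metis not_one_le_zero)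
  have "standard (Suc (Suc m)) (Suc k') \<subseteq> {f. weighted_sum n f = 0}"
  proof (rule standard_generated)
    show "fun_vs.subspace {f. weighted_sum n f = 0}"
      by (rule fun_vs.subspaceI) (simp_all add: weighted_sum_add weighted_sum_scale)
  qed (simp_all add: n weighted_sum_tl_e weighted_sum_cup del: weighted_sum.simps)
  then show ?thesis using assms(1) n k by blast
qed

lemma raise_standard:
  assumes "f \<in> standard n k" shows "raise n f = 0"
  using assms
proof (induction k arbitrary: n f)
  case 0
  show ?case
  proof (rule ext)
    fix S
    have "raise m f S = 0" for m
    proof (induction m)
      case (Suc m)
      have "f (S(Suc m := True)) = 0" 
      proof (rule ccontr)
        assume "f (S(Suc m := True)) \<noteq> 0"
        from graded_supp[OF standard_graded[OF 0] this]
        have *: "downs (S(Suc m := True)) \<subseteq> {1..n}" "card (downs (S(Suc m := True))) = 0" by blast+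
        then have "downs (S(Suc m := True)) = {}" using finite_spins[OF *(1)] card_0_eq by blast
        then show False unfolding downs_upd by blast
      qed
      then show ?case using Suc by simp
    qed simp
    then show "raise n f S = 0 S" by simp
  qed
next
  case (Suc k)
  show ?case
  proof (cases "n < 2 * Suc k")
    case True
    then show ?thesis using standard_small[OF Suc.prems] raise_zero by metis
  next
    case False
    then have "2 \<le> n" by simp
    then obtain m where n: "n = Suc (Suc m)" by (metis add_2_eq_Suc le_Suc_ex)
    have "standard (Suc (Suc m)) (Suc k) \<subseteq> {f. raise n f = 0}"
    proof (rule standard_generated)
      show "fun_vs.subspace {f. raise n f = 0}"
      proof (rule fun_vs.subspaceI)
        fix x y assume "x \<in> {f. raise n f = 0}" "y \<in> {f. raise n f = 0}"
        then have "raise n x = 0" "raise n y = 0" by blast+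
        then have "raise n (x + y) = 0" by (metis raise_add add.right_neutral)
        then show "x + y \<in> {f. raise n f = 0}" by blast
      next
        fix c x assume "x \<in> {f. raise n f = 0}"
        then have "raise n x = 0" by blast
        then have "raise n (fscale c x) = 0" by (metis raise_scale fun_vs.scale_zero_right)
        then show "fscale c x \<in> {f. raise n f = 0}" by blast
      qed (metis raise_zero mem_Collect_eq)
      fix f j assume "f \<in> {f. raise n f = 0}" "1 \<le> j" "j \<le> Suc m"
      then have "raise n (tl_e j f) = 0" using raise_tl_e[of j n f] n by (metis mem_Collect_eq tl_e_zero Suc_le_mono)
      then show "tl_e j f \<in> {f. raise n f = 0}" by blast
    next
      fix g assume "g \<in> standard m k"
      then have "raise n (cup m g) = 0" using Suc.IH raise_cup n by (metis cup_zero)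
      then show "cup m g \<in> {f. raise n f = 0}" by blast
    qed
    then show ?thesis using Suc.prems n by blast
  qed
qed

definition singular :: "nat \<Rightarrow> tensor \<Rightarrow> bool" where
  "singular n f \<longleftrightarrow> (\<forall>j. 1 \<le> j \<and> j < n \<longrightarrow> tl_e j f = 0)"

text \<open>Vanishing under e_j means that moving a down spin from j to j + 1 multiplies the value
  by -q, whence the exponent: the sum of the down positions.\<close>

definition sym_vec :: "nat \<Rightarrow> nat \<Rightarrow> tensor" where
  "sym_vec n k S = (if downs S \<subseteq> {1..n} \<and> card (downs S) = k then (- q) ^ (\<Sum>i\<in>downs S. i) else 0)"

lemma sym_vec_graded: "sym_vec n k \<in> graded n k"
  by (rule gradedI) (auto simp: sym_vec_def split: if_splits)

lemma sym_vec_singular: "singular n (sym_vec n k)"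
  unfolding singular_def
proof (intro allI impI, rule ext)
  fix j and S :: spins assume j: "1 \<le> j \<and> j < n"
  obtain S0 a b where S: "S = S0(j := a, Suc j := b)" by (rule spins_cases2[of S j])
  define D where "D = downs S0 - {j, Suc j}"
  have d: "downs (S0(j := True, Suc j := False)) = insert j D" "downs (S0(j := False, Suc j := True)) = insert (Suc j) D"
    by (auto simp: D_def split: if_splits)
  have D: "j \<notin> D" "Suc j \<notin> D" by (auto simp: D_def)
  have sub: "insert j D \<subseteq> {1..n} \<longleftrightarrow> D \<subseteq> {1..n}" "insert (Suc j) D \<subseteq> {1..n} \<longleftrightarrow> D \<subseteq> {1..n}"
    using j by auto
  have "q * sym_vec n k (S0(j := True, Suc j := False)) + sym_vec n k (S0(j := False, Suc j := True)) = 0"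
  proof (cases "D \<subseteq> {1..n}")
    case True
    then have "finite D" by (rule finite_subset) simp
    then show ?thesis using True D unfolding sym_vec_def d sub by simp
  next
    case False
    then show ?thesis unfolding sym_vec_def d sub by simp
  qed
  then have *: "sym_vec n k (S0(j := False, Suc j := True)) = - q * sym_vec n k (S0(j := True, Suc j := False))"
    by (simp add: add_eq_0_iff)
  show "tl_e j (sym_vec n k) S = 0 S"
    unfolding S by (cases a; cases b) (simp_all add: tl_e_def upd_sort * )
qed

lemma tail_sym_vec: "tail n (sym_vec (Suc n) (Suc k)) = fscale ((- q) ^ Suc n) (sym_vec n k)"
proof (rule ext)
  fix S :: spins
  show "tail n (sym_vec (Suc n) (Suc k)) S = fscale ((- q) ^ Suc n) (sym_vec n k) S"
  proof (cases "S (Suc n)")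
    case True
    then have "Suc n \<in> downs S" by simp
    then have "\<not> downs S \<subseteq> {1..n}" by (meson Suc_n_not_le_n atLeastAtMost_iff subsetD)
    then show ?thesis using True by (simp add: tail_def sym_vec_def)
  next
    case False
    have "insert (Suc n) (downs S) \<subseteq> {1..Suc n} \<longleftrightarrow> downs S \<subseteq> {1..n}"
      using downs_subset_Suc[of S n] False by simp
    moreover have "finite (downs S)" "Suc n \<notin> downs S" if "downs S \<subseteq> {1..n}" 
      using that finite_spins False by auto
    ultimately show ?thesis using False
      by (auto simp: tail_def sym_vec_def downs_upd power_add)
  qed
qed

lemma singular_tail: "singular (Suc n) f \<Longrightarrow> singular n (tail n f)"
  unfolding singular_def using tl_e_tail by (metis Suc_leI less_SucI tail_zero)

text \<open>The last spin is up throughout the support. Comparing it with its neighbour by the last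
  generator forces that spin up too, and so on to the left, until no room is left for the k + 1 down
  spins.\<close>

lemma singular_tail_zero:
  assumes "f \<in> graded n (Suc k)" "singular (Suc n) f" shows "f = 0"
  using assms
proof (induction n)
  case 0
  have "f S = 0" for S
  proof (rule ccontr)
    assume "f S \<noteq> 0"
    from graded_supp[OF 0(1) this] have "downs S \<subseteq> {1..0}" "card (downs S) = Suc k" by blast+
    then have "downs S = {}" "card (downs S) = Suc k" by simp_all
    then show False by (metis card.empty nat.distinct(1))
  qed
  then show ?case by (simp add: fun_eq_iff)
next
  case (Suc n)
  have e: "tl_e (Suc n) f = 0" using Suc.prems(2) by (simp add: singular_def)
  have "tail n f S = 0" for S
  proof (cases "S (Suc n) \<or> S (Suc (Suc n))")
    case True
    have "f (S(Suc n := True)) = 0" if "\<not> S (Suc n)"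
      by (rule gradedD[OF Suc.prems(1), of _ "Suc (Suc n)"]) (use that True in auto)
    then show ?thesis by (auto simp: tail_def)
  next
    case False
    have "tl_e (Suc n) f (S(Suc n := True)) = 0" using e by simp
    moreover have "f (S(Suc n := False, Suc (Suc n) := True)) = 0"
      by (rule gradedD[OF Suc.prems(1), of _ "Suc (Suc n)"]) auto
    ultimately show ?thesis using False by (simp add: tl_e_def tail_def)
  qed
  then have "tail n f = 0" by (simp add: fun_eq_iff)
  then have "f \<in> graded n (Suc k)" by (rule graded_tail_zero[OF Suc.prems(1)])
  moreover have "singular (Suc n) f" using Suc.prems(2) by (auto simp: singular_def)
  ultimately show ?case by (rule Suc.IH)
qed

lemma singular_scale: "singular n f \<Longrightarrow> singular n (fscale c f)"
  unfolding singular_def tl_e_scale by (metis fun_vs.scale_zero_right)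

lemma singular_diff: "singular n f \<Longrightarrow> singular n g \<Longrightarrow> singular n (f - g)"
  unfolding singular_def tl_e_diff by simp

text \<open>By induction the tail is a multiple of the symmetric vector on n points. Subtracting the
  matching multiple of \<open>sym_vec\<close> leaves a singular vector without tail, which is zero
  when k > 0.\<close>

lemma singular_eq_sym_vec:
  assumes "f \<in> graded n k" "singular n f" shows "\<exists>c. f = fscale c (sym_vec n k)"
  using assms
proof (induction n arbitrary: k f)
  case 0
  have *: "f S = f (\<lambda>_. False) * sym_vec 0 k S" for S
  proof (cases "downs S = {}")
    case True
    then have "S = (\<lambda>_. False)" by (auto simp: downs_def fun_eq_iff)
    moreover have "card (downs (\<lambda>_. False)) = 0" by (simp add: downs_def)
    ultimately show ?thesis using graded_card[OF 0(1), of S] by (auto simp: sym_vec_def True)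
  next
    case False
    then have "f S = 0" using graded_supp[OF 0(1), of S] by auto
    then show ?thesis using False by (simp add: sym_vec_def)
  qed
  have "f = fscale (f (\<lambda>_. False)) (sym_vec 0 k)"
  proof (rule ext)
    fix S show "f S = fscale (f (\<lambda>_. False)) (sym_vec 0 k) S" unfolding fscale_apply by (rule *)
  qed
  then show ?case by (rule exI)
next
  case (Suc n)
  show ?case
  proof (cases k)
    case 0
    have *: "f S = f (\<lambda>_. False) * sym_vec (Suc n) k S" for S
    proof (cases "downs S = {}")
      case True
      then have "S = (\<lambda>_. False)" by (auto simp: downs_def fun_eq_iff)
      then show ?thesis using 0 by (simp add: sym_vec_def True)
    next
      case False
      have nz: "\<not> (downs S \<subseteq> {1..Suc n} \<and> card (downs S) = k)"
        using False finite_spins[of S "Suc n"] card_0_eq[of "downs S"] unfolding 0 by blast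
      then have "f S = 0" using graded_supp[OF Suc.prems(1), of S] by blast
      moreover have "sym_vec (Suc n) k S = 0" unfolding sym_vec_def using nz by (rule if_not_P)
      ultimately show ?thesis by simp
    qed
    have "f = fscale (f (\<lambda>_. False)) (sym_vec (Suc n) k)"
  proof (rule ext)
    fix S show "f S = fscale (f (\<lambda>_. False)) (sym_vec (Suc n) k) S" unfolding fscale_apply by (rule *)
  qed
    then show ?thesis by (rule exI)
  next
    case (Suc k')
    obtain c where c: "tail n f = fscale c (sym_vec n k')"
      using Suc.IH[OF graded_tail singular_tail] Suc.prems Suc by metis
    \<comment> \<open>The division undoes the factor picked up in
      \<open>tail_sym_vec\<close>.\<close>
    define g where "g = f - fscale (c / (- q) ^ Suc n) (sym_vec (Suc n) k)"
    have "tail n g = 0"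
      unfolding g_def tail_diff tail_scale Suc tail_sym_vec c by (rule ext) simp
    moreover have "g \<in> graded (Suc n) k"
      unfolding g_def by (intro fun_vs.subspace_diff subspace_graded fun_vs.subspace_scale Suc.prems sym_vec_graded)
    ultimately have "g \<in> graded n (Suc k')" using graded_tail_zero Suc by blast
    moreover have "singular (Suc n) g"
      unfolding g_def by (intro singular_diff singular_scale sym_vec_singular Suc.prems)
    ultimately have "g = 0" by (rule singular_tail_zero)
    then have "f = fscale (c / (- q) ^ Suc n) (sym_vec (Suc n) k)" unfolding g_def by (metis eq_iff_diff_eq_0)
    then show ?thesis by blast
  qed
qed

text \<open>The Pascal rule for Gaussian binomials: a down spin at n + 1 contributes (-q)^(n+1)
  twice, once from the functional and once from the vector.\<close>

lemma weighted_sum_sym_vec_Suc: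
  "weighted_sum (Suc n) (sym_vec (Suc n) (Suc k)) =
     weighted_sum n (sym_vec n (Suc k)) + (q ^ 2) ^ Suc n * weighted_sum n (sym_vec n k)"
proof -
  have "weighted_sum n (sym_vec (Suc n) (Suc k)) = weighted_sum n (sym_vec n (Suc k))"
  proof (rule weighted_sum_cong)
    fix S assume S: "downs S \<subseteq> {1..n}"
    then have "downs S \<subseteq> {1..Suc n}" by (meson atLeastatMost_subset_iff le_SucI order_refl order_trans)
    then show "sym_vec (Suc n) (Suc k) S = sym_vec n (Suc k) S" using S by (simp add: sym_vec_def)
  qed
  moreover have "(- q) ^ Suc n * (- q) ^ Suc n = (q ^ 2) ^ Suc n"
    by (simp only: power_mult_distrib[symmetric] power2_eq_square minus_mult_minus)
  ultimately show ?thesis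
    unfolding weighted_sum.simps tail_sym_vec weighted_sum_scale by (simp only: mult.assoc[symmetric])
qed

lemma sum_sym_vec_0: "weighted_sum n (sym_vec n 0) = 1"
proof -
  have e: "downs (\<lambda>_. False) = {}" by (auto simp: downs_def)
  have "weighted_sum n (sym_vec m 0) = 1" if "n \<le> m" for m
    using that
  proof (induction n arbitrary: m)
    case 0
    show ?case by (simp add: sym_vec_def e)
  next
    case (Suc n)
    have "tail n (sym_vec m 0) = 0"
    proof (rule ext)
      fix S
      have "\<not> (downs (S(Suc n := True)) \<subseteq> {1..m} \<and> card (downs (S(Suc n := True))) = 0)"
        using finite_spins[of "S(Suc n := True)" m] by (auto simp: downs_upd card_gt_0_iff simp del: downs_iff)
      then have "sym_vec m 0 (S(Suc n := True)) = 0" unfolding sym_vec_def by (rule if_not_P)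
      then show "tail n (sym_vec m 0) S = 0 S" by (simp add: tail_def)
    qed
    then show ?case using Suc by simp
  qed
  then show ?thesis by simp
qed

lemma sum_sym_vec_empty: "weighted_sum 0 (sym_vec 0 (Suc k)) = 0"
  by (simp add: sym_vec_def downs_def)

end

section \<open>Gaussian polynomials and the action of quantum sl_2 on symmetric vectors\<close>

context nonzero_parameter
begin

text \<open>The product of the q-binomial theorem in base q^2: its k-th coefficient is the Gaussian
  binomial of n and k times q^(k(k+1)).\<close>

definition gauss_poly :: "nat \<Rightarrow> complex poly" where
  "gauss_poly n = (\<Prod>s\<in>{1..n}. [:1, (q ^ 2) ^ s:])"

lemma gauss_poly_Suc: "gauss_poly (Suc n) = gauss_poly n * [:1, (q ^ 2) ^ Suc n:]"
  by (simp add: gauss_poly_def)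

lemma gauss_poly_0: "gauss_poly 0 = 1"
  by (simp add: gauss_poly_def)

lemma coeff_gauss_poly_Suc:
  "coeff (gauss_poly (Suc n)) (Suc k) = coeff (gauss_poly n) (Suc k) + (q ^ 2) ^ Suc n * coeff (gauss_poly n) k"
  unfolding gauss_poly_Suc by (simp add: coeff_pCons)

lemma coeff_gauss_poly_0: "coeff (gauss_poly n) 0 = 1"
proof (induction n)
  case (Suc n)
  then show ?case unfolding gauss_poly_Suc by (simp add: coeff_pCons)
qed (simp add: gauss_poly_0)

lemma coeff_gauss_poly: "coeff (gauss_poly n) k = weighted_sum n (sym_vec n k)"
proof (induction n arbitrary: k)
  case 0
  show ?case
    by (cases k) (simp_all add: gauss_poly_0 sum_sym_vec_0 sum_sym_vec_empty del: weighted_sum.simps)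
next
  case (Suc n)
  show ?case
  proof (cases k)
    case 0
    then show ?thesis by (simp only: coeff_gauss_poly_0 sum_sym_vec_0)
  next
    case (Suc k')
    show ?thesis unfolding Suc coeff_gauss_poly_Suc weighted_sum_sym_vec_Suc Suc.IH ..
  qed
qed

lemma coeff_gauss_poly_top: "(\<forall>k>n. coeff (gauss_poly n) k = 0) \<and> coeff (gauss_poly n) n \<noteq> 0"
proof (induction n)
  case 0
  show ?case by (auto simp: gauss_poly_0)
next
  case (Suc n)
  have "coeff (gauss_poly (Suc n)) k = 0" if "k > Suc n" for k
  proof -
    obtain k' where "k = Suc k'" using \<open>k > Suc n\<close> Suc_lessE by blast
    then show ?thesis using Suc that by (simp only: coeff_gauss_poly_Suc) simp
  qed
  then show ?case using Suc by (simp add: coeff_gauss_poly_Suc)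
qed

lemma coeff_gauss_poly_1: "(q ^ 2 - 1) * coeff (gauss_poly n) 1 = q ^ 2 * ((q ^ 2) ^ n - 1)"
proof (induction n)
  case 0
  show ?case by (simp add: gauss_poly_0)
next
  case (Suc n)
  have "coeff (gauss_poly (Suc n)) 1 = coeff (gauss_poly n) 1 + (q ^ 2) ^ Suc n"
    using coeff_gauss_poly_Suc[of n 0] by (simp add: coeff_gauss_poly_0)
  then show ?case using Suc by (simp add: algebra_simps)
qed

text \<open>\<open>tail\<close> lowers n and k together and preserves both symmetry and membership
  in the standard representation. So k can be reduced, with n - k fixed, to a value where the
  Gaussian binomial is easy to evaluate.\<close>

lemma sym_vec_descend:
  assumes "sym_vec (n + r) (k + r) \<in> standard (n + r) (k + r)" shows "sym_vec n k \<in> standard n k"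
  using assms
proof (induction r)
  case (Suc r)
  have "fscale ((- q) ^ Suc (n + r)) (sym_vec (n + r) (k + r)) \<in> standard (n + r) (k + r)"
    using tail_standard[of "sym_vec (n + Suc r) (k + Suc r)" "n + r" "k + r"] Suc.prems by (simp add: tail_sym_vec)
  then have "fscale (inverse ((- q) ^ Suc (n + r))) (fscale ((- q) ^ Suc (n + r)) (sym_vec (n + r) (k + r))) \<in> standard (n + r) (k + r)"
    by (rule fun_vs.subspace_scale[OF subspace_standard])
  moreover have "inverse ((- q) ^ Suc (n + r)) * (- q) ^ Suc (n + r) = 1" by (rule left_inverse) simp
  ultimately have "sym_vec (n + r) (k + r) \<in> standard (n + r) (k + r)"
    by (simp only: fun_vs.scale_scale fun_vs.scale_one)
  then show ?case by (rule Suc.IH)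
qed simp

lemma link_vec_vacuum: "link_vec n id (\<lambda>_. False) = 1"
  by (simp add: link_vec_def site_weight_def)

lemma graded_0_apply:
  assumes "f \<in> graded n 0" "S \<noteq> (\<lambda>_. False)" shows "f S = 0"
proof (rule ccontr)
  assume "f S \<noteq> 0"
  from graded_supp[OF assms(1) this] have "downs S = {}"
    using finite_spins card_0_eq by blast
  then have "S = (\<lambda>_. False)" by (auto simp: downs_def)
  with assms(2) show False ..
qed

lemma graded_0_eq:
  assumes "f \<in> graded n 0" shows "f = fscale (f (\<lambda>_. False)) (link_vec m id)"
proof (rule ext)
  fix S
  have "link_vec m id \<in> graded m 0"
    by (rule link_vec_graded) (simp add: link_states_0)
  then show "f S = fscale (f (\<lambda>_. False)) (link_vec m id) S"
    using graded_0_apply[OF assms, of S] graded_0_apply[of "link_vec m id" m S] link_vec_vacuum[of m]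
    by (cases "S = (\<lambda>_. False)") simp_all
qed

lemma link_vec_id_standard: "link_vec n id \<in> standard n 0"
  by (rule link_vec_in_standard) (simp add: link_states_0)

lemma graded_0_standard: "f \<in> graded n 0 \<Longrightarrow> f \<in> standard m 0"
  using graded_0_eq fun_vs.subspace_scale[OF subspace_standard link_vec_id_standard] by metis

text \<open>Right exactness of the restriction sequence. By \<open>standard_generated\<close> it
  suffices to lift cups, which \<open>tail_zigzag\<close> does from a lift on fewer points; for k =
  0 a cup on the vacuum is a lift.\<close>

lemma tail_surjective:
  assumes "f \<in> standard n k" "2 * Suc k \<le> Suc n"
  shows "\<exists>g\<in>standard (Suc n) (Suc k). tail n g = f"
  using assms
proof (induction k arbitrary: n f)
  case 0
  then obtain m where n: "n = Suc m" by (cases n) auto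
  define v where "v = link_vec m id"
  have v: "v \<in> standard m 0" unfolding v_def by (rule link_vec_id_standard)
  have g: "tail n (cup m v) \<in> graded n 0"
    using graded_tail[OF standard_graded[OF cup_standard[OF v]]] n by simp
  have "tail n (cup m v) (\<lambda>_. False) = 1"
  proof -
    have "(\<lambda>_. False)(Suc n := True, Suc m := False, Suc (Suc m) := False) = (\<lambda>_. False)"
      by (auto simp: n fun_eq_iff)
    then show ?thesis using link_vec_vacuum[of m] by (simp add: tail_def cup_def v_def n)
  qed
  then have t: "tail n (cup m v) = link_vec n id" using graded_0_eq[OF g, of n] by simp
  have "f = fscale (f (\<lambda>_. False)) (link_vec n id)" using graded_0_eq[OF standard_graded[OF 0(1)]] .
  then have "tail n (fscale (f (\<lambda>_. False)) (cup m v)) = f" unfolding tail_scale t ..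
  moreover have "fscale (f (\<lambda>_. False)) (cup m v) \<in> standard (Suc n) (Suc 0)"
    using fun_vs.subspace_scale[OF subspace_standard cup_standard[OF v]] n by simp
  ultimately show ?case by blast
next
  case (Suc k)
  have "2 \<le> n" using Suc.prems(2) by simp
  then obtain m where n: "n = Suc (Suc m)" by (metis add_2_eq_Suc le_Suc_ex)
  let ?N = "{f. \<exists>g\<in>standard (Suc n) (Suc (Suc k)). tail n g = f}"
  have "standard (Suc (Suc m)) (Suc k) \<subseteq> ?N"
  proof (rule standard_generated)
    show "fun_vs.subspace ?N"
    proof (rule fun_vs.subspaceI)
      show "0 \<in> ?N" using fun_vs.subspace_0[OF subspace_standard] tail_zero by blast
      fix x y assume "x \<in> ?N" "y \<in> ?N"
      then obtain g h where "g \<in> standard (Suc n) (Suc (Suc k))" "tail n g = x" 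
        "h \<in> standard (Suc n) (Suc (Suc k))" "tail n h = y" by blast
      then have "g + h \<in> standard (Suc n) (Suc (Suc k))" "tail n (g + h) = x + y"
        by (auto simp only: tail_add intro: fun_vs.subspace_add[OF subspace_standard])
      then show "x + y \<in> ?N" by blast
    next
      fix c x assume "x \<in> ?N"
      then obtain g where "g \<in> standard (Suc n) (Suc (Suc k))" "tail n g = x" by blast
      then have "fscale c g \<in> standard (Suc n) (Suc (Suc k))" "tail n (fscale c g) = fscale c x"
        by (auto simp only: tail_scale intro: fun_vs.subspace_scale[OF subspace_standard])
      then show "fscale c x \<in> ?N" by blast
    qed
    fix x j assume "x \<in> ?N" and j: "1 \<le> j" "j \<le> Suc m"
    then obtain g where g: "g \<in> standard (Suc n) (Suc (Suc k))" "tail n g = x" by blast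
    have "tl_e j g \<in> standard (Suc n) (Suc (Suc k))" using g j n by (intro tl_e_standard) auto
    moreover have "tail n (tl_e j g) = tl_e j x" using tl_e_tail[of j n g] g j n by simp
    ultimately show "tl_e j x \<in> ?N" by blast
  next
    fix h assume h: "h \<in> standard m k"
    obtain h' where h': "h' \<in> standard (Suc m) (Suc k)" "tail m h' = h"
      using Suc.IH[OF h] Suc.prems(2) n by auto
    have "tl_e (Suc m) (cup (Suc m) h') \<in> standard (Suc n) (Suc (Suc k))"
      using cup_standard[OF h'(1)] n by (intro tl_e_standard) auto
    moreover have "tail n (tl_e (Suc m) (cup (Suc m) h')) = cup m h"
      using tail_zigzag[OF standard_graded[OF h'(1)]] h' n by simp
    ultimately show "cup m h \<in> ?N" by blast
  qed
  then show ?case using Suc.prems(1) n by blast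
qed

definition count_downs :: "nat \<Rightarrow> spins \<Rightarrow> nat" where
  "count_downs n S = (\<Sum>b\<in>{1..n}. if S b then 1 else 0)"

lemma count_downs_Suc: "count_downs (Suc n) S = count_downs n S + (if S (Suc n) then 1 else 0)"
  by (simp add: count_downs_def)

lemma count_downs_le: "count_downs n S \<le> n"
  by (induction n) (auto simp: count_downs_Suc count_downs_def)

lemma count_downs_card:
  assumes "downs S \<subseteq> {1..n}" shows "count_downs n S = card (downs S)"
proof -
  have "count_downs n S = card ({1..n} \<inter> {b. S b})"
    unfolding count_downs_def by (subst sum.If_cases) simp_all
  moreover have "{1..n} \<inter> {b. S b} = downs S" using assms downs_def[of S] by blast
  ultimately show ?thesis by (simp only:)
qed

lemma spin_phase_eq: "spin_phase n S = (- q) ^ n * inverse (q ^ 2) ^ count_downs n S"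
proof (induction n)
  case (Suc n)
  have "- inverse q = - q * inverse (q ^ 2)" by (simp add: power2_eq_square)
  then show ?case using Suc by (simp add: count_downs_Suc)
qed (simp add: count_downs_def)

text \<open>Removing a down spin at a changes the exponent by a, and the phase restores all of it
  but one factor -q together with a power of q^-2 counting the down spins further left; summing
  gives a geometric series. The factor -q on the left keeps the exponents natural numbers.\<close>

lemma lower_sym_vec_apply:
  assumes "downs S \<subseteq> {1..n}" "card (downs S) = Suc k" "m \<le> n"
  shows "lower m (sym_vec n k) S * (- q) = (- q) ^ (\<Sum>i\<in>downs S. i) * (\<Sum>r<count_downs m S. inverse (q ^ 2) ^ r)"
  using assms(3)
proof (induction m)
  case (Suc m)
  have fin: "finite (downs S)" using assms(1) by (rule finite_spins)
  show ?case
  proof (cases "S (Suc m)")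
    case True
    then have m: "Suc m \<in> downs S" by simp
    have "sym_vec n k (S(Suc m := False)) = (- q) ^ (\<Sum>i\<in>downs S - {Suc m}. i)"
      using assms m fin unfolding sym_vec_def downs_upd by auto
    moreover have "(\<Sum>i\<in>downs S. i) = Suc m + (\<Sum>i\<in>downs S - {Suc m}. i)"
      using fin m by (rule sum.remove)
    ultimately have "spin_phase m S * sym_vec n k (S(Suc m := False)) * (- q) =
        (- q) ^ (\<Sum>i\<in>downs S. i) * inverse (q ^ 2) ^ count_downs m S"
      by (simp add: spin_phase_eq power_add)
    then show ?thesis using Suc True by (simp add: count_downs_Suc algebra_simps)
  qed (use Suc in \<open>simp add: count_downs_Suc\<close>)
qed (simp add: count_downs_def)

lemma lower_sym_vec:
  "lower n (sym_vec n k) = fscale (- inverse q * (\<Sum>r<Suc k. inverse (q ^ 2) ^ r)) (sym_vec n (Suc k))"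
proof (rule ext)
  fix S
  show "lower n (sym_vec n k) S = fscale (- inverse q * (\<Sum>r<Suc k. inverse (q ^ 2) ^ r)) (sym_vec n (Suc k)) S"
  proof (cases "downs S \<subseteq> {1..n} \<and> card (downs S) = Suc k")
    case True
    have "lower n (sym_vec n k) S * (- q) = (- q) ^ (\<Sum>i\<in>downs S. i) * (\<Sum>r<Suc k. inverse (q ^ 2) ^ r)"
      using lower_sym_vec_apply[of S n k n] True count_downs_card[of S n] by simp
    moreover have "lower n (sym_vec n k) S = - inverse q * (lower n (sym_vec n k) S * (- q))" by simp
    ultimately have "lower n (sym_vec n k) S = - inverse q * (\<Sum>r<Suc k. inverse (q ^ 2) ^ r) * (- q) ^ (\<Sum>i\<in>downs S. i)"
      by (simp only: mult_ac)
    then show ?thesis using True by (simp add: sym_vec_def)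
  next
    case False
    then have "lower n (sym_vec n k) S = 0" "sym_vec n (Suc k) S = 0"
      using graded_supp[OF graded_lower[OF sym_vec_graded]] graded_supp[OF sym_vec_graded] by blast+
    then show ?thesis by simp
  qed
qed

text \<open>Here the geometric series runs over the up spins among the first m sites; for m = n
  there are n - k of them, which produces the condition on n - k for a highest weight
  vector.\<close>

lemma raise_sym_vec_apply:
  assumes "downs S \<subseteq> {1..n}" "card (downs S) = k" "m \<le> n"
  shows "raise m (sym_vec n (Suc k)) S * (- q) = (- q) ^ (\<Sum>i\<in>downs S. i) * (\<Sum>r<m - count_downs m S. (q ^ 2) ^ Suc r)"
  using assms(3)
proof (induction m)
  case (Suc m)
  have fin: "finite (downs S)" using assms(1) by (rule finite_spins)
  show ?case
  proof (cases "S (Suc m)")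
    case False
    then have m: "Suc m \<notin> downs S" by simp
    have le: "count_downs m S \<le> m" by (rule count_downs_le)
    have s1: "sym_vec n (Suc k) (S(Suc m := True)) = (- q) ^ (\<Sum>i\<in>insert (Suc m) (downs S). i)"
      using assms m fin Suc.prems unfolding sym_vec_def downs_upd by auto
    have s2: "(\<Sum>i\<in>insert (Suc m) (downs S). i) = Suc m + (\<Sum>i\<in>downs S. i)"
      using fin m by (rule sum.insert)
    have ph: "(- q) ^ m * inverse (q ^ 2) ^ count_downs m S * (- q) ^ Suc m * (- q) = (q ^ 2) ^ Suc (m - count_downs m S)"
    proof -
      have "(- q) ^ m * (- q) ^ Suc m * (- q) = ((- q) * (- q)) ^ Suc m"
        by (simp only: power_mult_distrib power_Suc mult_ac)
      also have "\<dots> = (q ^ 2) ^ (count_downs m S + Suc (m - count_downs m S))"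
        using le by (simp add: power2_eq_square)
      also have "\<dots> = (q ^ 2) ^ count_downs m S * (q ^ 2) ^ Suc (m - count_downs m S)" by (rule power_add)
      finally have "(- q) ^ m * (- q) ^ Suc m * (- q) = (q ^ 2) ^ count_downs m S * (q ^ 2) ^ Suc (m - count_downs m S)" .
      moreover have "inverse (q ^ 2) ^ count_downs m S * (q ^ 2) ^ count_downs m S = 1"
        by (simp add: power_mult_distrib[symmetric])
      moreover have "x * i * y * z = w" if "x * y * z = p * w" "i * p = 1" for x y z i p w :: complex
      proof -
        have "x * i * y * z = i * (x * y * z)" by (simp only: mult_ac)
        also have "\<dots> = (i * p) * w" unfolding that(1) by (simp only: mult_ac)
        finally show ?thesis using that(2) by simp
      qed
      ultimately show ?thesis by blast
    qed
    have "spin_phase m S * sym_vec n (Suc k) (S(Suc m := True)) * (- q) =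
        (- q) ^ (\<Sum>i\<in>downs S. i) * ((- q) ^ m * inverse (q ^ 2) ^ count_downs m S * (- q) ^ Suc m * (- q))"
      by (simp only: spin_phase_eq s1 s2 power_add mult_ac)
    then have "spin_phase m S * sym_vec n (Suc k) (S(Suc m := True)) * (- q) =
        (- q) ^ (\<Sum>i\<in>downs S. i) * (q ^ 2) ^ Suc (m - count_downs m S)"
      unfolding ph .
    then show ?thesis using Suc False le by (simp add: count_downs_Suc Suc_diff_le algebra_simps)
  qed (use Suc in \<open>simp add: count_downs_Suc\<close>)
qed (simp add: count_downs_def)

lemma raise_sym_vec_eq_0:
  assumes "(\<Sum>r<n - k. (q ^ 2) ^ Suc r) = 0" shows "raise n (sym_vec n (Suc k)) = 0"
proof (rule ext)
  fix S
  show "raise n (sym_vec n (Suc k)) S = 0 S"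
  proof (cases "downs S \<subseteq> {1..n} \<and> card (downs S) = k")
    case True
    then have "raise n (sym_vec n (Suc k)) S * (- q) = 0"
      using raise_sym_vec_apply[of S n k n] count_downs_card[of S n] assms by (simp del: power_Suc)
    then show ?thesis by simp
  next
    case False
    then show ?thesis using graded_supp[OF graded_raise[OF sym_vec_graded]] by (metis zero_fun_apply)
  qed
qed

definition head :: "nat \<Rightarrow> tensor \<Rightarrow> tensor" where
  "head n f S = (if S (Suc n) then 0 else f S)"

lemma graded_head: "f \<in> graded (Suc n) k \<Longrightarrow> head n f \<in> graded n k"
proof (rule gradedI)
  fix S assume f: "f \<in> graded (Suc n) k" and "head n f S \<noteq> 0"
  then have "\<not> S (Suc n)" "f S \<noteq> 0" by (auto simp: head_def split: if_splits)
  then show "downs S \<subseteq> {1..n} \<and> card (downs S) = k"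
    using graded_supp[OF f, of S] downs_subset_Suc[of S n] by blast
qed

lemma head_tail_zero:
  assumes "head n f = 0" "tail n f = 0" shows "f = 0"
proof (rule ext)
  fix S
  show "f S = 0 S"
  proof (cases "S (Suc n)")
    case True
    then have "S(Suc n := False, Suc n := True) = S" by (auto simp: fun_eq_iff)
    then have "f S = tail n f (S(Suc n := False))" by (simp add: tail_def)
    then show ?thesis using assms(2) by simp
  next
    case False
    then have "f S = head n f S" by (simp add: head_def)
    then show ?thesis using assms(1) by simp
  qed
qed

text \<open>The coproduct on n sites and one last site. The phase is constant because the tail has
  exactly k down spins.\<close>

lemma head_raise:
  assumes f: "f \<in> graded (Suc n) (Suc k)"
  shows "head n (raise (Suc n) f) = raise n (head n f) + fscale ((- q) ^ n * inverse (q ^ 2) ^ k) (tail n f)"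
proof (rule ext)
  fix S
  have z: "m \<le> n \<Longrightarrow> raise m (head n f) S = (if S (Suc n) then 0 else raise m f S)" for m
    by (induction m) (auto simp: head_def)
  show "head n (raise (Suc n) f) S = (raise n (head n f) + fscale ((- q) ^ n * inverse (q ^ 2) ^ k) (tail n f)) S"
  proof (cases "S (Suc n)")
    case True
    then show ?thesis using z[of n] by (simp add: head_def tail_def)
  next
    case False
    have "spin_phase n S * tail n f S = (- q) ^ n * inverse (q ^ 2) ^ k * tail n f S"
    proof (cases "tail n f S = 0")
      case False
      from graded_supp[OF graded_tail[OF f] this] show ?thesis
        using count_downs_card[of S n] by (simp add: spin_phase_eq)
    qed simp
    then show ?thesis using False z[of n] by (simp add: head_def tail_def)
  qed
qed

text \<open>Only two terms of the q-binomial expansion survive, as raising the last site twice gives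
  zero; the coefficient of the second is the quantum integer of r up to a power of q. The bound on r
  keeps the down spins from running out.\<close>

lemma head_raise_funpow:
  assumes "f \<in> graded (Suc n) (Suc k)" "r \<le> Suc k"
  shows "head n ((raise (Suc n) ^^ r) f) = (raise n ^^ r) (head n f) +
    fscale ((- q) ^ n * inverse (q ^ 2) ^ k * (\<Sum>s<r. (q ^ 2) ^ s)) ((raise n ^^ (r - 1)) (tail n f))"
  using assms
proof (induction r arbitrary: k f)
  case 0
  show ?case by (rule ext) simp
next
  case (Suc r)
  have lin: "(raise n ^^ r) (g + h) = (raise n ^^ r) g + (raise n ^^ r) h"
    "(raise n ^^ r) (fscale c g) = fscale c ((raise n ^^ r) g)" for r g h c
    by (induction r) (simp_all only: funpow.simps id_apply o_apply raise_add raise_scale)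
  show ?case
  proof (cases r)
    case 0
    show ?thesis
      by (simp only: 0 funpow.simps o_apply id_apply head_raise[OF Suc.prems(1)] sum.lessThan_Suc lessThan_0
          sum.empty power_0 add_0 mult_1_right diff_Suc_1)
  next
    case (Suc r')
    then obtain k' where k: "k = Suc k'" using Suc.prems(2) by (cases k) auto
    define c where "c = (- q) ^ n * inverse (q ^ 2) ^ k"
    define d where "d = (- q) ^ n * inverse (q ^ 2) ^ k' * (\<Sum>s<r. (q ^ 2) ^ s)"
    define h t where "h = head n f" and "t = tail n f"
    have g: "raise (Suc n) f \<in> graded (Suc n) (Suc k')" using graded_raise[OF Suc.prems(1)] k by simp
    have "head n ((raise (Suc n) ^^ Suc r) f) = head n ((raise (Suc n) ^^ r) (raise (Suc n) f))"
      by (simp only: funpow_Suc_right o_apply)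
    also have "\<dots> = (raise n ^^ r) (head n (raise (Suc n) f)) + fscale d ((raise n ^^ (r - 1)) (tail n (raise (Suc n) f)))"
      unfolding d_def by (rule Suc.IH[OF g]) (use Suc.prems(2) k in simp)
    also have "\<dots> = (raise n ^^ r) (raise n h + fscale c t) + fscale d ((raise n ^^ (r - 1)) (raise n t))"
      unfolding head_raise[OF Suc.prems(1)] tail_raise c_def h_def t_def ..
    also have "(raise n ^^ (r - 1)) (raise n t) = (raise n ^^ r) t"
      unfolding Suc by (simp only: diff_Suc_1 funpow_Suc_right o_apply)
    also have "(raise n ^^ r) (raise n h + fscale c t) = (raise n ^^ Suc r) h + fscale c ((raise n ^^ r) t)"
      unfolding lin by (simp only: funpow_Suc_right o_apply)
    also have "(raise n ^^ Suc r) h + fscale c ((raise n ^^ r) t) + fscale d ((raise n ^^ r) t) =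
        (raise n ^^ Suc r) h + fscale (c + d) ((raise n ^^ r) t)"
      by (simp only: fun_vs.scale_left_distrib add.assoc)
    \<comment> \<open>Passing from k to k' = k - 1 supplies a factor q^2, which shifts the old
      geometric sum by one place.\<close>
    also have "c + d = (- q) ^ n * inverse (q ^ 2) ^ k * (\<Sum>s<Suc r. (q ^ 2) ^ s)"
    proof -
      have "inverse (q ^ 2) ^ k' = inverse (q ^ 2) ^ k * q ^ 2" unfolding k by simp
      moreover have "(\<Sum>s<Suc r. (q ^ 2) ^ s) = 1 + q ^ 2 * (\<Sum>s<r. (q ^ 2) ^ s)"
        unfolding sum.lessThan_Suc_shift by (simp add: sum_distrib_left)
      ultimately show ?thesis unfolding c_def d_def by (simp only: algebra_simps mult_1_right mult_1_left)
    qed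
    finally show ?thesis unfolding h_def t_def by (simp only: diff_Suc_1)
  qed
qed

end

section \<open>Gaussian binomials at roots of unity\<close>

locale root_of_unity = nonzero_parameter +
  fixes l :: nat
  assumes l_ge_2: "2 \<le> l" and root: "q ^ (2 * l) = 1"
    and root_minimal: "\<And>m. 0 < m \<Longrightarrow> m < l \<Longrightarrow> q ^ (2 * m) \<noteq> 1"
begin

lemma power_eq_1_iff: "(q ^ 2) ^ n = 1 \<longleftrightarrow> l dvd n"
proof -
  have 1: "(q ^ 2) ^ l = 1" using root by (simp add: power_mult)
  have "(q ^ 2) ^ n = ((q ^ 2) ^ l) ^ (n div l) * (q ^ 2) ^ (n mod l)"
    by (metis mult_div_mod_eq power_add power_mult)
  then have *: "(q ^ 2) ^ n = (q ^ 2) ^ (n mod l)" using 1 by simp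
  show ?thesis
  proof (cases "n mod l = 0")
    case True
    then show ?thesis using * by auto
  next
    case False
    then have "q ^ (2 * (n mod l)) \<noteq> 1" using l_ge_2 by (intro root_minimal) auto
    then show ?thesis using * False by (auto simp: power_mult)
  qed
qed

lemma square_ne_1: "q ^ 2 \<noteq> 1"
  using power_eq_1_iff[of 1] l_ge_2 by auto

lemma geometric_eq_0_iff: "(\<Sum>r<n. (q ^ 2) ^ r) = 0 \<longleftrightarrow> l dvd n"
  using power_eq_1_iff[of n] square_ne_1 by (auto simp: geometric_sum)

lemma inverse_geometric_ne_0:
  assumes "0 < n" "n < l" shows "(\<Sum>r<n. inverse (q ^ 2) ^ r) \<noteq> 0"
proof -
  have "inverse (q ^ 2) \<noteq> 1" using square_ne_1 by (metis inverse_1 inverse_inverse_eq)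
  moreover have "inverse (q ^ 2) ^ n \<noteq> 1"
    using power_eq_1_iff[of n] assms by (auto simp: power_inverse dest: dvd_imp_le)
  ultimately show ?thesis by (simp add: geometric_sum)
qed

lemma loop_eq_0_iff: "loop = 0 \<longleftrightarrow> l = 2"
proof -
  have "loop = 0 \<longleftrightarrow> q ^ 2 = - 1"
    by (auto simp: field_simps power2_eq_square add_eq_0_iff)
  also have "\<dots> \<longleftrightarrow> (q ^ 2) ^ 2 = 1"
    using square_ne_1 power2_eq_1_iff[of "q ^ 2"] by blast
  also have "\<dots> \<longleftrightarrow> l = 2"
    unfolding power_eq_1_iff using l_ge_2 by (auto dest: dvd_imp_le)
  finally show ?thesis .
qed

lemma gauss_poly_add: "gauss_poly (l + m) = gauss_poly l * gauss_poly m"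
proof (induction m)
  case (Suc m)
  have "(q ^ 2) ^ Suc (l + m) = (q ^ 2) ^ Suc m"
    using power_eq_1_iff[of l] by (simp add: power_add)
  then show ?case unfolding add_Suc_right gauss_poly_Suc Suc by (simp only: mult.assoc)
qed (simp add: gauss_poly_0)

text \<open>Multiplying the variable by \<open>q\<^sup>2\<close> permutes the factors of \<open>gauss_poly l\<close> cyclically.\<close>

lemma coeff_gauss_poly_root: "0 < k \<Longrightarrow> k < l \<Longrightarrow> coeff (gauss_poly l) k = 0"
proof -
  assume k: "0 < k" "k < l"
  have "pcompose (gauss_poly l) [:0, q ^ 2:] = (\<Prod>s\<in>{1..l}. [:1, (q ^ 2) ^ Suc s:])"
    unfolding gauss_poly_def pcompose_prod by (simp add: pcompose_pCons mult.commute)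
  also have "\<dots> = (\<Prod>s\<in>{2..Suc l}. [:1, (q ^ 2) ^ s:])"
    by (rule prod.reindex_bij_witness[of _ "\<lambda>s. s - 1" Suc]) auto
  finally have pc: "pcompose (gauss_poly l) [:0, q ^ 2:] = (\<Prod>s\<in>{2..Suc l}. [:1, (q ^ 2) ^ s:])" .
  have "{1..Suc l} = insert 1 {2..Suc l}" by auto
  then have "(\<Prod>s\<in>{1..Suc l}. [:1, (q ^ 2) ^ s:]) = [:1, (q ^ 2) ^ 1:] * (\<Prod>s\<in>{2..Suc l}. [:1, (q ^ 2) ^ s:])"
    by (simp only: prod.insert[of "{2..Suc l}" 1] finite_atLeastAtMost) simp
  then have "pcompose (gauss_poly l) [:0, q ^ 2:] * [:1, (q ^ 2) ^ 1:] = (\<Prod>s\<in>{1..Suc l}. [:1, (q ^ 2) ^ s:])"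
    unfolding pc by (simp only: mult.commute)
  also have "\<dots> = gauss_poly l * [:1, (q ^ 2) ^ Suc l:]"
    by (simp add: gauss_poly_def)
  also have "(q ^ 2) ^ Suc l = (q ^ 2) ^ 1" using power_eq_1_iff[of l] by simp
  finally have "pcompose (gauss_poly l) [:0, q ^ 2:] = gauss_poly l \<or> [:1, (q ^ 2) ^ 1:] = 0"
    using mult_cancel_right by blast
  then have "pcompose (gauss_poly l) [:0, q ^ 2:] = gauss_poly l" by simp
  then have "coeff (gauss_poly l) k = (q ^ 2) ^ k * coeff (gauss_poly l) k"
    using coeff_pcompose_linear[of "gauss_poly l" "q ^ 2" k] by simp
  moreover have "(q ^ 2) ^ k \<noteq> 1" unfolding power_eq_1_iff using k by (auto dest: dvd_imp_le)
  ultimately show ?thesis by auto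
qed

text \<open>The polynomial for l has only its constant and its l-th coefficient within degrees 0 to
  l, so multiplying by it shifts the l-th coefficient additively.\<close>

lemma coeff_gauss_poly_shift:
  "coeff (gauss_poly (l + m)) l = coeff (gauss_poly m) l + coeff (gauss_poly l) l"
proof -
  have "coeff (gauss_poly (l + m)) l = (\<Sum>i\<le>l. coeff (gauss_poly l) i * coeff (gauss_poly m) (l - i))"
    unfolding gauss_poly_add coeff_mult ..
  also have "\<dots> = (\<Sum>i\<in>{0, l}. coeff (gauss_poly l) i * coeff (gauss_poly m) (l - i))"
    using coeff_gauss_poly_root by (intro sum.mono_neutral_right) auto
  also have "\<dots> = coeff (gauss_poly m) l + coeff (gauss_poly l) l"
    using l_ge_2 by (simp add: coeff_gauss_poly_0)
  finally show ?thesis .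
qed

text \<open>This is where characteristic zero enters.\<close>

lemma coeff_gauss_poly_critical: "coeff (gauss_poly (a * l + (l - 1))) l = of_nat a * coeff (gauss_poly l) l"
proof (induction a)
  case 0
  show ?case using coeff_gauss_poly_top[of "l - 1"] l_ge_2 by simp
next
  case (Suc a)
  then show ?case using coeff_gauss_poly_shift[of "a * l + (l - 1)"] by (simp add: algebra_simps)
qed

text \<open>Both conditions come from descending to a case where the weighted sum is explicit: to
  one down spin for the congruence, and to l down spins for the bound.\<close>

lemma sym_vec_standardD:
  assumes "sym_vec n k \<in> standard n k" "1 \<le> k" "k \<le> n"
  shows "k < l" "l dvd n + 1 - k"
proof -
  obtain m where m: "n = m + (k - 1)" using assms(2,3) by (metis le_add_diff_inverse2 diff_le_self order_trans)
  have "sym_vec m 1 \<in> standard m 1"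
    by (rule sym_vec_descend[of m "k - 1" 1]) (use assms m in simp)
  then have "coeff (gauss_poly m) 1 = 0"
    unfolding coeff_gauss_poly by (intro weighted_sum_standard) auto
  then have "(q ^ 2) ^ m = 1" using coeff_gauss_poly_1[of m] by simp
  then show d: "l dvd n + 1 - k" using m assms(2) by (simp add: power_eq_1_iff)
  show "k < l"
  proof (rule ccontr)
    assume "\<not> k < l"
    obtain a where a: "n + 1 - k = a * l" using d by (metis dvdE mult.commute)
    \<comment> \<open>This is n - k + l, the number of points left once k has been lowered to l; the
      l-th coefficient there is a nonzero multiple of a, while a itself is positive.\<close>
    define m where "m = a * l + (l - 1)"
    have n: "n = m + (k - l)" "k = l + (k - l)" using a assms \<open>\<not> k < l\<close> l_ge_2 by (simp_all add: m_def)
    have "sym_vec m l \<in> standard m l"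
      by (rule sym_vec_descend[of m "k - l" l]) (use assms n in simp)
    then have "coeff (gauss_poly m) l = 0"
      unfolding coeff_gauss_poly using l_ge_2 by (intro weighted_sum_standard) auto
    then have "a = 0" unfolding m_def coeff_gauss_poly_critical using coeff_gauss_poly_top[of l] by simp
    then show False using a assms by simp
  qed
qed

lemma singularD:
  assumes "f \<in> standard n k" "singular n f" "f \<noteq> 0"
  shows "\<exists>c. c \<noteq> 0 \<and> f = fscale c (sym_vec n k)" "sym_vec n k \<in> standard n k" "2 * k \<le> n"
proof -
  show k: "2 * k \<le> n" using standard_small[OF assms(1)] assms(3) by linarith
  obtain c where c: "f = fscale c (sym_vec n k)"
    using singular_eq_sym_vec[OF standard_graded[OF assms(1)] assms(2)] by blast
  have c0: "c \<noteq> 0"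
  proof
    assume "c = 0"
    then have "f = 0" unfolding c by (rule ssubst) (rule fun_vs.scale_zero_left)
    with assms(3) show False by (rule notE)
  qed
  then show "\<exists>c. c \<noteq> 0 \<and> f = fscale c (sym_vec n k)" using c by blast
  have "fscale (inverse c) f \<in> standard n k"
    using assms(1) by (rule fun_vs.subspace_scale[OF subspace_standard])
  moreover have "fscale (inverse c) f = sym_vec n k"
    unfolding c by (rule ext) (use c0 in simp)
  ultimately show "sym_vec n k \<in> standard n k" by simp
qed

lemma singular_condition:
  assumes "f \<in> standard n k" "singular n f" "f \<noteq> 0" "1 \<le> k"
  shows "k < l" "l dvd n + 1 - k"
  using sym_vec_standardD[OF singularD(2)[OF assms(1-3)] assms(4)] singularD(3)[OF assms(1-3)] by auto

text \<open>As in sl_2 theory, a power of the raising operator is injective far enough below weight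
  zero; \<open>k < l\<close> keeps the quantum integers that occur nonzero. The exponent r is
  general because splitting off the last spin changes it to r + 1 for the head and r - 1 for the
  tail.\<close>

lemma raise_injective:
  assumes "f \<in> graded n k" "k < l" "1 \<le> r" "r + n \<le> 2 * k" "(raise n ^^ r) f = 0"
  shows "f = 0"
  using assms
proof (induction n arbitrary: k r f)
  case 0
  have "f S = 0" for S
  proof (rule ccontr)
    assume "f S \<noteq> 0"
    from graded_supp[OF 0(1) this] have "downs S \<subseteq> {1..0}" "card (downs S) = k" by blast+
    then have "k = 0" by simp
    then show False using 0 by simp
  qed
  then show ?case by (simp add: fun_eq_iff)
next
  case (Suc n)
  show ?case
  proof (cases "k \<le> Suc n")
    case False
    have "f S = 0" for S
    proof (rule ccontr)
      assume "f S \<noteq> 0"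
      from graded_supp[OF Suc.prems(1) this] have "downs S \<subseteq> {1..Suc n}" "card (downs S) = k" by blast+
      then show False using False card_mono[of "{1..Suc n}" "downs S"] by simp
    qed
    then show ?thesis by (simp add: fun_eq_iff)
  next
    case True
    obtain k' where k: "k = Suc k'" using Suc.prems by (cases k) auto
    have rk: "r \<le> Suc k'" using Suc.prems(4) True k by simp
    define h t where "h = head n f" and "t = tail n f"
    have h: "h \<in> graded n (Suc k')" and t: "t \<in> graded n k'"
      using graded_head graded_tail Suc.prems(1) k unfolding h_def t_def by blast+
    have "tail n ((raise (Suc n) ^^ m) g) = (raise n ^^ m) (tail n g)" for m g
      by (induction m) (simp_all only: funpow.simps id_apply o_apply tail_raise)
    then have rt: "(raise n ^^ r) t = 0" using Suc.prems(5) unfolding t_def by (metis tail_zero)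
    define c where "c = (- q) ^ n * inverse (q ^ 2) ^ k' * (\<Sum>s<r. (q ^ 2) ^ s)"
    have c0: "c \<noteq> 0"
    proof -
      have "\<not> l dvd r" using Suc.prems(2,3) rk k by (auto dest: dvd_imp_le)
      then show ?thesis using geometric_eq_0_iff[of r] by (simp add: c_def)
    qed
    have "head n ((raise (Suc n) ^^ r) f) = (raise n ^^ r) h + fscale c ((raise n ^^ (r - 1)) t)"
      unfolding c_def h_def t_def using Suc.prems(1) rk unfolding k by (rule head_raise_funpow)
    moreover have "head n ((raise (Suc n) ^^ r) f) = 0"
      unfolding Suc.prems(5) by (rule ext) (simp add: head_def)
    ultimately have e: "(raise n ^^ r) h + fscale c ((raise n ^^ (r - 1)) t) = 0" by simp
    have r1: "Suc (r - 1) = r" using Suc.prems(3) by simp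
    \<comment> \<open>One more application of \<open>raise\<close> removes the tail term, since its
      r-th raise is already zero, and isolates the head.\<close>
    have "raise n ((raise n ^^ r) h + fscale c ((raise n ^^ (r - 1)) t)) = 0"
      unfolding e by (rule raise_zero)
    then have "(raise n ^^ Suc r) h + fscale c ((raise n ^^ Suc (r - 1)) t) = 0"
      by (simp only: raise_add raise_scale funpow.simps o_apply)
    then have "(raise n ^^ Suc r) h = 0" unfolding r1 rt by (metis fun_vs.scale_zero_right add.right_neutral)
    then have h0: "h = 0"
      by (rule Suc.IH[OF h, of "Suc r", rotated 3]) (use Suc.prems(2-4) k in simp_all)
    have raise0: "(raise n ^^ m) 0 = 0" for m 
      by (induction m) (simp_all only: funpow.simps id_apply o_apply raise_zero)
    have "fscale c ((raise n ^^ (r - 1)) t) = 0" using e unfolding h0 raise0 by (metis add.left_neutral)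
    then have "(raise n ^^ (r - 1)) t = 0" using c0 fun_vs.scale_eq_0_iff by blast
    then have "t = 0"
    proof (cases "r = 1")
      case False
      show ?thesis
        by (rule Suc.IH[OF t, of "r - 1", rotated 3, OF \<open>(raise n ^^ (r - 1)) t = 0\<close>])
          (use Suc.prems(2-4) k False in simp_all)
    next
      case True
      then show ?thesis using \<open>(raise n ^^ (r - 1)) t = 0\<close> by (simp only: diff_self_eq_0 funpow.simps id_apply)
    qed
    then show ?thesis using h0 head_tail_zero unfolding h_def t_def by blast
  qed
qed

text \<open>Converse of \<open>raise_standard\<close> for k < l. A preimage of the tail inside
  V_{n+1,k} is subtracted; the rest lives on n points and is covered by induction, or by injectivity
  when n < 2k.\<close>

lemma raise_kernel:
  assumes "f \<in> graded n k" "k < l" "2 * k \<le> n" "raise n f = 0"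
  shows "f \<in> standard n k"
  using assms
proof (induction n arbitrary: k f)
  case 0
  then show ?case using graded_0_standard by simp
next
  case (Suc n)
  show ?case
  proof (cases k)
    case 0
    then show ?thesis using graded_0_standard Suc.prems(1) by blast
  next
    case (Suc k')
    have "raise n (tail n f) = 0" using tail_raise[of n f] Suc.prems(4) by (metis tail_zero)
    then have "tail n f \<in> standard n k'"
      using Suc.IH[of "tail n f" k'] graded_tail Suc.prems Suc by simp
    then obtain g where g: "g \<in> standard (Suc n) k" "tail n g = tail n f"
      using tail_surjective[of "tail n f" n k'] Suc.prems(3) Suc by auto
    define h where "h = f - g"
    have "raise (Suc n) h = 0" unfolding h_def raise_diff Suc.prems(4) raise_standard[OF g(1)] by (rule diff_0_right)
    have t0: "tail n h = 0" unfolding h_def tail_diff g(2) by (rule diff_self)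
    have "h \<in> graded (Suc n) k"
      unfolding h_def by (rule fun_vs.subspace_diff[OF subspace_graded Suc.prems(1) standard_graded[OF g(1)]])
    then have hg: "h \<in> graded n k" using t0 by (rule graded_tail_zero)
    have "head n (raise (Suc n) h) = raise n (head n h) + fscale ((- q) ^ n * inverse (q ^ 2) ^ k') (tail n h)"
      using \<open>h \<in> graded (Suc n) k\<close> unfolding Suc by (rule head_raise)
    moreover have "head n h = h"
    proof (rule ext)
      fix S show "head n h S = h S" using gradedD[OF hg, of S "Suc n"] by (auto simp: head_def)
    qed
    moreover have "head n 0 = 0" by (rule ext) (simp add: head_def)
    ultimately have r0: "raise n h = 0"
      unfolding \<open>raise (Suc n) h = 0\<close> t0 by (metis fun_vs.scale_zero_right add.right_neutral)
    have "h \<in> standard (Suc n) k"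
    proof (cases "2 * k \<le> n")
      case True
      then show ?thesis using Suc.IH[OF hg Suc.prems(2) True r0] standard_mono by blast
    next
      case False
      have "(raise n ^^ 1) h = 0" using r0 by (simp only: funpow.simps One_nat_def id_apply o_apply)
      then have "h = 0" using raise_injective[OF hg Suc.prems(2), of 1] False by simp
      then show ?thesis using fun_vs.subspace_0[OF subspace_standard] by (simp only:)
    qed
    then have "h + g \<in> standard (Suc n) k" using g(1) by (rule fun_vs.subspace_add[OF subspace_standard])
    then show ?thesis unfolding h_def by (simp only: diff_add_cancel)
  qed
qed

lemma sym_vec_standard:
  assumes "1 \<le> k" "k < l" "2 * k \<le> n" "l dvd n + 1 - k"
  shows "sym_vec n k \<in> standard n k"
proof -
  obtain k' where k: "k = Suc k'" using assms(1) by (cases k) auto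
  have "(\<Sum>r<n - k'. (q ^ 2) ^ Suc r) = q ^ 2 * (\<Sum>r<n - k'. (q ^ 2) ^ r)"
    by (simp add: sum_distrib_left)
  also have "\<dots> = 0" using assms(4) k geometric_eq_0_iff[of "n - k'"] by simp
  finally have "raise n (sym_vec n k) = 0" unfolding k by (rule raise_sym_vec_eq_0)
  then show ?thesis by (intro raise_kernel sym_vec_graded assms)
qed

lemma lower_sym_vec_ne_0:
  assumes "Suc k < l" shows "\<exists>c. c \<noteq> 0 \<and> lower n (sym_vec n k) = fscale c (sym_vec n (Suc k))"
  using lower_sym_vec[of n k] inverse_geometric_ne_0[of "Suc k"] assms
  by (intro exI[of _ "- inverse q * (\<Sum>r<Suc k. inverse (q ^ 2) ^ r)"]) (simp del: sum.lessThan_Suc)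

end

section \<open>Submodules of standard representations\<close>

lemma subspace_image:
  assumes "\<And>f g. L (f + g) = L f + L g" "\<And>c f. L (fscale c f) = fscale c (L f)" "fun_vs.subspace A"
  shows "fun_vs.subspace (L ` A)"
proof (rule fun_vs.subspaceI)
  have "L (fscale 0 0) = fscale 0 (L 0)" by (rule assms(2))
  then have "L 0 = 0" by (simp only: fun_vs.scale_zero_left)
  then show "0 \<in> L ` A" using fun_vs.subspace_0[OF assms(3)] by (metis image_eqI)
  fix x y assume "x \<in> L ` A" "y \<in> L ` A"
  then obtain a b where "a \<in> A" "b \<in> A" "x = L a" "y = L b" by blast
  then have "x + y = L (a + b)" "a + b \<in> A" using assms(1) fun_vs.subspace_add[OF assms(3)] by simp_all
  then show "x + y \<in> L ` A" by blast
next
  fix c x assume "x \<in> L ` A"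
  then obtain a where "a \<in> A" "x = L a" by blast
  then have "fscale c x = L (fscale c a)" "fscale c a \<in> A" using assms(2) fun_vs.subspace_scale[OF assms(3)] by simp_all
  then show "fscale c x \<in> L ` A" by blast
qed

context nonzero_parameter
begin

definition submodule :: "nat \<Rightarrow> nat \<Rightarrow> tensor set \<Rightarrow> bool" where
  "submodule n p A \<longleftrightarrow> fun_vs.subspace A \<and> A \<subseteq> standard n p \<and>
     (\<forall>f\<in>A. \<forall>j. 1 \<le> j \<and> j < n \<longrightarrow> tl_e j f \<in> A)"

lemma submoduleD:
  assumes "submodule n p A"
  shows "fun_vs.subspace A" "A \<subseteq> standard n p" "\<And>f j. f \<in> A \<Longrightarrow> 1 \<le> j \<Longrightarrow> j < n \<Longrightarrow> tl_e j f \<in> A" "0 \<in> A"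
  using assms fun_vs.subspace_0 by (auto simp: submodule_def)

lemma submodule_standard: "submodule n p (standard n p)"
  unfolding submodule_def using subspace_standard tl_e_standard by auto

lemma submodule_zero: "submodule n p {0}"
  unfolding submodule_def
proof (intro conjI ballI allI impI)
  show "fun_vs.subspace {0 :: tensor}" by (rule fun_vs.subspace_single_0)
  show "{0} \<subseteq> standard n p" using fun_vs.subspace_0[OF subspace_standard] by blast
  fix f j assume "f \<in> {0 :: tensor}"
  then have "f = 0" by blast
  then show "tl_e j f \<in> {0}" using tl_e_zero by blast
qed

lemma submodule_Int: "submodule n p A \<Longrightarrow> submodule n p B \<Longrightarrow> submodule n p (A \<inter> B)"
  unfolding submodule_def by (auto intro: fun_vs.subspace_inter)

lemma submodule_cap:
  assumes "submodule (Suc (Suc n)) (Suc p) A" shows "submodule n p (cap n ` A)"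
  unfolding submodule_def
proof (intro conjI ballI allI impI)
  show "fun_vs.subspace (cap n ` A)"
    using cap_add cap_scale submoduleD(1)[OF assms] by (rule subspace_image)
  show "cap n ` A \<subseteq> standard n p" using cap_standard submoduleD(2)[OF assms] by blast
  fix f j assume "f \<in> cap n ` A" and j: "1 \<le> j \<and> j < n"
  then obtain a where a: "a \<in> A" "f = cap n a" by blast
  then have "tl_e j f = cap n (tl_e j a)" using tl_e_cap[of j n a] j by simp
  moreover have "tl_e j a \<in> A" using submoduleD(3)[OF assms a(1)] j by simp
  ultimately show "tl_e j f \<in> cap n ` A" by blast
qed

lemma cup_cap_in_submodule:
  assumes "submodule (Suc (Suc n)) p A" "g \<in> cap n ` A" shows "cup n g \<in> A"
proof -
  obtain a where a: "a \<in> A" "g = cap n a" using assms(2) by blast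
  show ?thesis unfolding a(2) tl_e_eq_cup_cap[symmetric] using submoduleD(3)[OF assms(1) a(1)] by simp
qed

lemma submodule_cap_full:
  assumes "submodule (Suc (Suc n)) (Suc p) A" "cap n ` A = standard n p"
  shows "A = standard (Suc (Suc n)) (Suc p)"
proof
  show "A \<subseteq> standard (Suc (Suc n)) (Suc p)" by (rule submoduleD(2)[OF assms(1)])
  show "standard (Suc (Suc n)) (Suc p) \<subseteq> A"
  proof (rule standard_generated[OF submoduleD(1)[OF assms(1)]])
    show "cup n g \<in> A" if "g \<in> standard n p" for g
      using cup_cap_in_submodule[OF assms(1)] assms(2) that by blast
  qed (use submoduleD(3)[OF assms(1)] in simp)
qed

text \<open>From e_j = e_j e_{j+1} e_j: if the last generator maps B into A, descending from it
  shows the same for each of them, so B/A is a trivial module.\<close>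

lemma trivial_action:
  assumes A: "submodule (Suc n) p A" and B: "submodule (Suc n) p B"
    and top: "\<And>b. b \<in> B \<Longrightarrow> tl_e n b \<in> A"
    and "b \<in> B" "1 \<le> j" "j \<le> n"
  shows "tl_e j b \<in> A"
  using assms(6,5,4)
proof (induction arbitrary: b rule: inc_induct)
  case base
  then show ?case using top by simp
next
  case (step j)
  have "tl_e j b \<in> B" using submoduleD(3)[OF B] step by simp
  then have "tl_e (Suc j) (tl_e j b) \<in> A" using step by simp
  then have "tl_e j (tl_e (Suc j) (tl_e j b)) \<in> A" using submoduleD(3)[OF A] step by simp
  then show ?case by (simp only: tl_e_braid1)
qed

lemma singular_of_cap_zero:
  assumes A: "submodule (Suc (Suc n)) p A" and "cap n ` A \<subseteq> {0}" and "f \<in> A"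
  shows "singular (Suc (Suc n)) f"
  unfolding singular_def
proof (intro allI impI)
  fix j assume j: "1 \<le> j \<and> j < Suc (Suc n)"
  have "tl_e j f \<in> {0}"
  proof (rule trivial_action[OF submodule_zero A _ assms(3)])
    fix b assume "b \<in> A"
    then have "cap n b = 0" using assms(2) by blast
    then show "tl_e (Suc n) b \<in> {0}" unfolding tl_e_eq_cup_cap by (metis cup_zero singletonI)
  qed (use j in auto)
  then show "tl_e j f = 0" by blast
qed

lemma standard_0_submodule:
  assumes A: "submodule n 0 A" "A \<noteq> {0}" shows "A = standard n 0"
proof -
  obtain f where f: "f \<in> A" "f \<noteq> 0" using A(2) submoduleD(4)[OF A(1)] by blast
  have fs: "f \<in> standard n 0" using f submoduleD(2)[OF A(1)] by blast
  define c where "c = f (\<lambda>_. False)"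
  have fc: "f = fscale c (link_vec n id)" unfolding c_def by (rule graded_0_eq[OF standard_graded[OF fs]])
  have "c \<noteq> 0" using fc f(2) fun_vs.scale_zero_left by metis
  have "g \<in> A" if g: "g \<in> standard n 0" for g
  proof -
    have "g = fscale (g (\<lambda>_. False)) (link_vec n id)" by (rule graded_0_eq[OF standard_graded[OF g]])
    also have "\<dots> = fscale (g (\<lambda>_. False) / c) f" 
      by (subst fc) (simp only: fun_vs.scale_scale nonzero_eq_divide_eq[OF \<open>c \<noteq> 0\<close>] nonzero_mult_div_cancel_right[OF \<open>c \<noteq> 0\<close>] times_divide_eq_left)
    finally show ?thesis using fun_vs.subspace_scale[OF submoduleD(1)[OF A(1)] f(1)] by metis
  qed
  then show ?thesis using submoduleD(2)[OF A(1)] by blast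
qed

fun cups :: "nat \<Rightarrow> nat \<Rightarrow> tensor \<Rightarrow> tensor" where
  "cups 0 m f = f"
| "cups (Suc i) m f = cup (m + 2 * i) (cups i m f)"

lemma cups_graded_standard: "f \<in> standard m k \<Longrightarrow> cups i m f \<in> standard (m + 2 * i) (k + i)"
  by (induction i) (use cup_standard in simp_all)

lemma cups_eq_0: "f \<in> standard m k \<Longrightarrow> cups i m f = 0 \<Longrightarrow> f = 0"
proof (induction i)
  case (Suc i)
  have "cup (m + 2 * i) (cups i m f) = 0" using Suc.prems(2) by (simp only: cups.simps)
  then have "cups i m f = 0"
    by (rule cup_inject) (rule standard_graded[OF cups_graded_standard[OF Suc.prems(1)]])
  then show ?case by (rule Suc.IH[OF Suc.prems(1)])
qed (simp only: cups.simps)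

end

context root_of_unity
begin

lemma singular_submodule:
  assumes A: "submodule n p A" "f \<in> A" "f \<noteq> 0" "singular n f"
  shows "sym_vec n p \<in> A"
proof -
  obtain c where c: "c \<noteq> 0" "f = fscale c (sym_vec n p)"
    using singularD(1)[of f n p] assms submoduleD(2)[OF A(1)] by blast
  have "fscale (inverse c) f \<in> A" using A(2) by (rule fun_vs.subspace_scale[OF submoduleD(1)[OF A(1)]])
  then show ?thesis unfolding c(2) using c(1) by (simp only: fun_vs.scale_scale left_inverse fun_vs.scale_one not_False_eq_True)
qed

lemma submodule_nonzero_small:
  assumes "submodule n p A" "A \<noteq> {0}" shows "2 * p \<le> n"
proof -
  obtain f where "f \<in> A" "f \<noteq> 0" using assms(2) submoduleD(4)[OF assms(1)] by blast
  then show ?thesis using standard_small[of f n p] submoduleD(2)[OF assms(1)] by (meson not_le subsetD)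
qed

text \<open>Cap until the next cap would give zero. What remains then consists of singular vectors,
  and inserting the i cups again returns to A. The vector depends on A only through i, which the
  congruence will turn out to determine.\<close>

lemma socle:
  assumes "submodule n p A" "A \<noteq> {0}" "A \<noteq> standard n p"
  shows "\<exists>i m. n = m + 2 * i \<and> i < p \<and> p - i < l \<and> l dvd m + 1 - (p - i) \<and> cups i m (sym_vec m (p - i)) \<in> A"
  using assms
proof (induction p arbitrary: n A)
  case 0
  then show ?case using standard_0_submodule by blast
next
  case (Suc p)
  have "2 \<le> n" using submodule_nonzero_small[OF Suc.prems(1,2)] by simp
  then obtain n' where n: "n = Suc (Suc n')" by (metis add_2_eq_Suc le_Suc_ex)
  have A: "submodule (Suc (Suc n')) (Suc p) A" using Suc.prems(1) n by simp
  show ?case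
  proof (cases "cap n' ` A = {0}")
    case True
    obtain f where f: "f \<in> A" "f \<noteq> 0" using Suc.prems(2) submoduleD(4)[OF A] by blast
    have s: "singular n f" using singular_of_cap_zero[OF A _ f(1)] True n by blast
    have fs: "f \<in> standard n (Suc p)" using submoduleD(2)[OF Suc.prems(1)] f by blast
    have "sym_vec n (Suc p) \<in> A" by (rule singular_submodule[OF Suc.prems(1) f s])
    then show ?thesis using singular_condition[OF fs s f(2)] by (intro exI[of _ 0] exI[of _ n]) simp
  next
    case False
    have "cap n' ` A \<noteq> standard n' p" using submodule_cap_full[OF A] Suc.prems(3) n by blast
    from Suc.IH[OF submodule_cap[OF A] False this] obtain i m where im: "n' = m + 2 * i" "i < p" "p - i < l"
      "l dvd m + 1 - (p - i)" "cups i m (sym_vec m (p - i)) \<in> cap n' ` A" by blast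
    have "cup n' (cups i m (sym_vec m (p - i))) \<in> A" by (rule cup_cap_in_submodule[OF A im(5)])
    then have "cups (Suc i) m (sym_vec m (Suc p - Suc i)) \<in> A" using im(1) by simp
    then show ?thesis using im n by (intro exI[of _ "Suc i"] exI[of _ m]) simp
  qed
qed

text \<open>The congruence determines the index occurring in the socle lemma, so it cannot also be
  satisfied one level below.\<close>

lemma cap_level_zero:
  assumes "submodule m p B" "B \<noteq> standard m p" "Suc p < l" "l dvd m + 2 - p"
  shows "B = {0}"
proof (rule ccontr)
  assume "B \<noteq> {0}"
  from socle[OF assms(1) this assms(2)] obtain i m' where i: "m = m' + 2 * i" "i < p" "l dvd m' + 1 - (p - i)" by blast
  have "2 * p \<le> m" by (rule submodule_nonzero_small[OF assms(1) \<open>B \<noteq> {0}\<close>])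
  then have "m + 2 - p = (m' + 1 - (p - i)) + Suc i" using i by simp
  then have "l dvd Suc i" using assms(4) i(3) by (metis dvd_add_right_iff)
  then show False using i(2) assms(3) by (auto dest: dvd_imp_le)
qed

definition trivial_subquotient :: "nat \<Rightarrow> nat \<Rightarrow> bool" where
  "trivial_subquotient n k \<longleftrightarrow>
     (\<exists>A y. submodule n k A \<and> y \<in> standard n k \<and> y \<notin> A \<and> (\<forall>j. 1 \<le> j \<and> j < n \<longrightarrow> tl_e j y \<in> A))"

text \<open>A trivial subquotient restricts to a trivial one, and its class is visible at one end of
  the restriction sequence: in V_{n,k} if the tail of y is not the tail of an element of A,
  otherwise in V_{n,k+1} after correcting y by that element.\<close>

lemma trivial_subquotient_restrict:
  assumes "submodule (Suc n) (Suc k) A" "y \<in> standard (Suc n) (Suc k)" "y \<notin> A"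
    "\<And>j. 1 \<le> j \<Longrightarrow> j < Suc n \<Longrightarrow> tl_e j y \<in> A"
  shows "trivial_subquotient n k \<or> trivial_subquotient n (Suc k)"
proof (cases "\<exists>a\<in>A. tail n y = tail n a")
  case True
  then obtain a where a: "a \<in> A" "tail n y = tail n a" by blast
  have sub: "a \<in> standard (Suc n) (Suc k)" using a submoduleD(2)[OF assms(1)] by blast
  have "tail n (y - a) = 0" unfolding tail_diff a(2) by (rule diff_self)
  moreover have "y - a \<in> standard (Suc n) (Suc k)" by (rule fun_vs.subspace_diff[OF subspace_standard assms(2) sub])
  ultimately have ya: "y - a \<in> standard n (Suc k)" using standard_tail_zero by blast
  have "submodule n (Suc k) (A \<inter> standard n (Suc k))"
    unfolding submodule_def using submoduleD[OF assms(1)] subspace_standard tl_e_standard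
    by (auto intro: fun_vs.subspace_inter)
  moreover have "y - a \<notin> A \<inter> standard n (Suc k)"
  proof
    assume "y - a \<in> A \<inter> standard n (Suc k)"
    then have "y - a + a \<in> A" using a(1) fun_vs.subspace_add[OF submoduleD(1)[OF assms(1)]] by blast
    then show False using assms(3) by (simp only: diff_add_cancel)
  qed
  moreover have "tl_e j (y - a) \<in> A \<inter> standard n (Suc k)" if "1 \<le> j \<and> j < n" for j
  proof
    show "tl_e j (y - a) \<in> A"
      unfolding tl_e_diff using that assms(4) submoduleD(3)[OF assms(1) a(1)]
      by (intro fun_vs.subspace_diff[OF submoduleD(1)[OF assms(1)]]) auto
    show "tl_e j (y - a) \<in> standard n (Suc k)" using that by (intro tl_e_standard ya) auto
  qed
  ultimately have "trivial_subquotient n (Suc k)" using ya unfolding trivial_subquotient_def by blast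
  then show ?thesis ..
next
  case False
  have "submodule n k (tail n ` A)"
    unfolding submodule_def
  proof (intro conjI ballI allI impI)
    show "fun_vs.subspace (tail n ` A)"
      using tail_add tail_scale submoduleD(1)[OF assms(1)] by (rule subspace_image)
    show "tail n ` A \<subseteq> standard n k" using tail_standard submoduleD(2)[OF assms(1)] by blast
    fix f j assume "f \<in> tail n ` A" and j: "1 \<le> j \<and> j < n"
    then obtain a where a: "a \<in> A" "f = tail n a" by blast
    then have "tl_e j f = tail n (tl_e j a)" using tl_e_tail[of j n a] j by simp
    moreover have "tl_e j a \<in> A" using submoduleD(3)[OF assms(1) a(1)] j by simp
    ultimately show "tl_e j f \<in> tail n ` A" by blast
  qed
  moreover have "tl_e j (tail n y) \<in> tail n ` A" if "1 \<le> j \<and> j < n" for j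
    using tl_e_tail[of j n y] that assms(4)[of j] by simp
  ultimately have "trivial_subquotient n k"
    using False tail_standard[OF assms(2)] unfolding trivial_subquotient_def by blast
  then show ?thesis ..
qed

end

section \<open>Shifted cups and the tridiagonal system\<close>

context root_of_unity
begin

text \<open>Solves the system with diagonal \<open>loop\<close> and off-diagonal 1 row by row from
  the first entry t; only the last row, that is the vanishing of the entry after the last, remains
  as a condition on t.\<close>

fun recurrence :: "complex \<Rightarrow> (nat \<Rightarrow> complex) \<Rightarrow> nat \<Rightarrow> complex" where
  "recurrence t \<beta> 0 = t"
| "recurrence t \<beta> (Suc 0) = \<beta> 0 - loop * t"
| "recurrence t \<beta> (Suc (Suc r)) = \<beta> (Suc r) - loop * recurrence t \<beta> (Suc r) - recurrence t \<beta> r"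

lemma recurrence_affine: "recurrence t \<beta> r = recurrence 0 \<beta> r + t * recurrence 1 (\<lambda>_. 0) r"
  by (induction t \<beta> r rule: recurrence.induct) (simp_all add: algebra_simps)

text \<open>The homogeneous solution is (-1)^r times the quantum integer [r+1], a Chebyshev value in
  \<open>loop\<close>. Keeping the factor q - q^-1 avoids quotients.\<close>

lemma recurrence_homogeneous:
  "recurrence 1 (\<lambda>_. 0) r * (q - inverse q) = (- 1) ^ r * (q ^ Suc r - inverse q ^ Suc r)"
proof (induction r rule: induct_nat_012)
  case (ge2 r)
  define i A B where "i = inverse q" and "A = q ^ Suc r" and "B = i ^ Suc r"
  have qi: "q * i = 1" by (simp add: i_def)
  have 0: "recurrence 1 (\<lambda>_. 0) r * (q - i) = (- 1) ^ r * (A - B)"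
    using ge2(1) by (simp only: i_def A_def B_def)
  have 1: "recurrence 1 (\<lambda>_. 0) (Suc r) * (q - i) = (- 1) ^ Suc r * (q * A - i * B)"
    using ge2(2) by (simp only: i_def A_def B_def power_Suc)
  have "recurrence 1 (\<lambda>_. 0) (Suc (Suc r)) * (q - i) =
      - (q + i) * (recurrence 1 (\<lambda>_. 0) (Suc r) * (q - i)) - recurrence 1 (\<lambda>_. 0) r * (q - i)"
    unfolding i_def by (simp add: algebra_simps)
  also have "\<dots> = (- 1) ^ r * ((q + i) * (q * A - i * B) - (A - B))"
    unfolding 0 1 by (simp add: algebra_simps)
  also have "(q + i) * (q * A - i * B) - (A - B) = q * (q * A) - i * (i * B) + (q * i) * (A - B) - (A - B)"
    by (simp add: algebra_simps)
  also have "\<dots> = q * (q * A) - i * (i * B)" unfolding qi by simp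
  finally show ?case by (simp add: i_def A_def B_def)
qed (simp_all add: power2_eq_square algebra_simps)

text \<open>A shooting argument: entry m + 1 is an affine function of the initial value t, with
  slope [m+2] up to sign, and this is nonzero unless l divides m + 2. Hence t can be chosen so that
  the entry vanishes.\<close>

lemma tridiagonal_solvable:
  assumes "\<not> l dvd m + 2"
  obtains c where "loop * c 0 + c 1 = \<beta> 0" "\<And>r. loop * c (Suc r) + c r + c (Suc (Suc r)) = \<beta> (Suc r)" "c (Suc m) = 0"
proof -
  define u where "u = recurrence 1 (\<lambda>_. 0) (Suc m)"
  have "u \<noteq> 0"
  proof
    assume "u = 0"
    then have "q ^ Suc (Suc m) = inverse q ^ Suc (Suc m)"
      using recurrence_homogeneous[of "Suc m"] unfolding u_def by simp
    then have "q ^ Suc (Suc m) * q ^ Suc (Suc m) = inverse q ^ Suc (Suc m) * q ^ Suc (Suc m)" by (simp only:)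
    also have "\<dots> = 1" by (simp only: power_mult_distrib[symmetric]) simp
    finally have "q ^ Suc (Suc m) * q ^ Suc (Suc m) = 1" .
    then have "(q ^ 2) ^ (m + 2) = 1" by (simp only: power2_eq_square power_mult_distrib add_2_eq_Suc')
    then show False using assms power_eq_1_iff by blast
  qed
  define t where "t = - recurrence 0 \<beta> (Suc m) / u"
  have "recurrence t \<beta> (Suc m) = 0"
    using recurrence_affine[of t \<beta> "Suc m"] \<open>u \<noteq> 0\<close> unfolding t_def u_def[symmetric] by simp
  moreover have "loop * recurrence t \<beta> 0 + recurrence t \<beta> 1 = \<beta> 0" by simp
  moreover have "loop * recurrence t \<beta> (Suc r) + recurrence t \<beta> r + recurrence t \<beta> (Suc (Suc r)) = \<beta> (Suc r)" for r
    by simp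
  ultimately show ?thesis using that by blast
qed

text \<open>\<open>shifted_cup m f r\<close> is the vector \<open>f\<close> on \<open>m\<close> points with a cup inserted, as the last two of the
  \<open>m + 2\<close> points for \<open>r = 0\<close> and moved \<open>r\<close> points to the left in general.\<close>

fun shifted_cup :: "nat \<Rightarrow> tensor \<Rightarrow> nat \<Rightarrow> tensor" where
  "shifted_cup m f 0 = cup m f"
| "shifted_cup m f (Suc r) = tl_e (m - r) (shifted_cup m f r)"

lemma tl_e_shifted_cup_same:
  assumes "f \<in> graded m k" shows "tl_e (Suc m - r) (shifted_cup m f r) = fscale loop (shifted_cup m f r)"
proof (cases r)
  case 0
  then show ?thesis by (simp only: shifted_cup.simps diff_zero tl_e_eq_cup_cap cap_cup[OF assms] cup_scale)
next
  case (Suc r')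
  then show ?thesis by (simp only: shifted_cup.simps diff_Suc_Suc tl_e_square)
qed

lemma tl_e_shifted_cup_next:
  assumes "f \<in> graded m k" "r < m" shows "tl_e (Suc m - r) (shifted_cup m f (Suc r)) = shifted_cup m f r"
proof (cases r)
  case 0
  obtain m' where m: "m = Suc m'" using assms(2) by (cases m) auto
  have "cap m (tl_e m (cup m f)) = f" using cap_zigzag assms(1) unfolding m by blast
  then show ?thesis unfolding 0 by (simp only: shifted_cup.simps diff_zero tl_e_eq_cup_cap)
next
  case (Suc r')
  obtain j where j: "j = m - r" "Suc j = m - r'" "Suc j = Suc m - r" using Suc assms(2) by simp
  show ?thesis
    unfolding j(3)[symmetric] shifted_cup.simps j(1)[symmetric] unfolding Suc shifted_cup.simps j(2)[symmetric]
    by (rule tl_e_braid2)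
qed

text \<open>A generator well to the left of the inserted cup commutes with everything that moved the
  cup and reaches the singular vector f.\<close>

lemma tl_e_shifted_cup_left:
  assumes "singular m f" shows "r + 2 \<le> r' \<Longrightarrow> r' \<le> m \<Longrightarrow> tl_e (Suc m - r') (shifted_cup m f r) = 0"
proof (induction r)
  case 0
  have "tl_e (Suc m - r') (cup m f) = cup m (tl_e (Suc m - r') f)" using 0 by (intro tl_e_cup) simp
  moreover have "tl_e (Suc m - r') f = 0"
  proof -
    have "1 \<le> Suc m - r'" "Suc m - r' < m" using 0 by simp_all
    then show ?thesis using assms unfolding singular_def by blast
  qed
  ultimately show ?case by (simp only: shifted_cup.simps cup_zero)
next
  case (Suc r)
  have "tl_e (Suc m - r') (tl_e (m - r) (shifted_cup m f r)) = tl_e (m - r) (tl_e (Suc m - r') (shifted_cup m f r))"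
    using Suc.prems by (intro tl_e_commute) simp
  also have "\<dots> = 0" using Suc by (simp only: tl_e_zero Suc_leD add_Suc)
  finally show ?case by (simp only: shifted_cup.simps)
qed

text \<open>A generator to the right commutes back until it meets the cup on its way; it then
  returns the cup by one place, and the generator next to it is left of the cup and gives
  zero.\<close>

lemma tl_e_shifted_cup_right:
  assumes "singular m f" "f \<in> graded m k"
  shows "r' + 2 \<le> r \<Longrightarrow> r \<le> m \<Longrightarrow> tl_e (Suc m - r') (shifted_cup m f r) = 0"
proof (induction r)
  case (Suc r)
  have "tl_e (Suc m - r') (tl_e (m - r) (shifted_cup m f r)) = tl_e (m - r) (tl_e (Suc m - r') (shifted_cup m f r))"
    using Suc.prems by (intro tl_e_commute[symmetric]) simp
  also have "\<dots> = 0"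
  proof (cases "r = Suc r'")
    case True
    have "tl_e (Suc m - r') (shifted_cup m f r) = shifted_cup m f r'"
      unfolding True using Suc.prems by (intro tl_e_shifted_cup_next[OF assms(2)]) simp
    moreover have "tl_e (Suc m - Suc r) (shifted_cup m f r') = 0"
      using Suc.prems True by (intro tl_e_shifted_cup_left[OF assms(1)]) simp_all
    ultimately show ?thesis by (simp only: diff_Suc_Suc)
  next
    case False
    then have "r' + 2 \<le> r" "r \<le> m" using Suc.prems by simp_all
    then have "tl_e (Suc m - r') (shifted_cup m f r) = 0" by (rule Suc.IH)
    then show ?thesis by (simp only: tl_e_zero)
  qed
  finally show ?case by (simp only: shifted_cup.simps)
qed simp

text \<open>If \<open>y\<close> is invariant modulo the span of the shifted cups, a linear combination of the latter can
  be subtracted to make it singular.\<close>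

lemma make_singular:
  assumes f: "f \<in> graded m k" "singular m f" and m: "\<not> l dvd m + 2"
    and y: "\<And>r. r \<le> m \<Longrightarrow> \<exists>b. tl_e (Suc m - r) y = fscale b (shifted_cup m f r)"
  obtains c where "singular (Suc (Suc m)) (y - (\<Sum>r\<le>m. fscale (c r) (shifted_cup m f r)))"
proof -
  obtain \<beta> where \<beta>: "\<And>r. r \<le> m \<Longrightarrow> tl_e (Suc m - r) y = fscale (\<beta> r) (shifted_cup m f r)"
    using y by metis
  obtain c where c: "loop * c 0 + c 1 = \<beta> 0" "\<And>r. loop * c (Suc r) + c r + c (Suc (Suc r)) = \<beta> (Suc r)" "c (Suc m) = 0"
    using tridiagonal_solvable[OF m] by metis
  let ?s = "shifted_cup m f"
  have "tl_e (Suc m - r) (\<Sum>r'\<le>m. fscale (c r') (?s r')) = fscale (\<beta> r) (?s r)" if r: "r \<le> m" for r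
  proof (rule ext)
    fix S
    \<comment> \<open>Only the cup at position r itself and its two neighbours contribute, which
      makes the system tridiagonal; at r = 0 and r = m one neighbour is missing, in accordance with
      the boundary conditions on c.\<close>
    let ?N = "{r' \<in> {..m}. r' = r \<or> r' = Suc r \<or> Suc r' = r}"
    have "tl_e (Suc m - r) (\<Sum>r'\<le>m. fscale (c r') (?s r')) S = (\<Sum>r'\<le>m. c r' * tl_e (Suc m - r) (?s r') S)"
      by (simp add: tl_e_sum sum_fun_apply tl_e_scale)
    also have "\<dots> = (\<Sum>r'\<in>?N. c r' * tl_e (Suc m - r) (?s r') S)"
    proof (rule sum.mono_neutral_right)
      show "\<forall>r'\<in>{..m} - ?N. c r' * tl_e (Suc m - r) (?s r') S = 0"
      proof
        fix r' assume "r' \<in> {..m} - ?N"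
        then have "r' + 2 \<le> r \<or> r + 2 \<le> r'" "r' \<le> m" by auto
        then have "tl_e (Suc m - r) (?s r') = 0"
          using tl_e_shifted_cup_left[OF f(2), of r' r] tl_e_shifted_cup_right[OF f(2,1), of r r'] r by blast
        then show "c r' * tl_e (Suc m - r) (?s r') S = 0" by simp
      qed
    qed auto
    also have "\<dots> = \<beta> r * ?s r S"
    proof (cases r)
      case 0
      show ?thesis
      proof (cases "m = 0")
        case True
        then have "?N = {0}" using 0 by auto
        then show ?thesis using 0 True c(1,3) tl_e_shifted_cup_same[OF f(1), of 0] by (simp del: shifted_cup.simps) (metis mult.assoc mult.commute)
      next
        case False
        then have "?N = {0, 1}" using 0 by auto
        then show ?thesis using 0 False tl_e_shifted_cup_same[OF f(1), of 0] tl_e_shifted_cup_next[OF f(1), of 0]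
          by (simp add: c(1)[symmetric] algebra_simps del: shifted_cup.simps)
      qed
    next
      case (Suc r')
      have prev: "tl_e (Suc m - r) (?s r') = ?s r" unfolding Suc by simp
      have same: "tl_e (Suc m - r) (?s r) = fscale loop (?s r)" by (rule tl_e_shifted_cup_same[OF f(1)])
      show ?thesis
      proof (cases "r = m")
        case True
        then have "?N = {r, r'}" using Suc by auto
        then have "(\<Sum>r'\<in>?N. c r' * tl_e (Suc m - r) (?s r') S) = c r * (loop * ?s r S) + c r' * ?s r S"
          using Suc prev same by (simp del: shifted_cup.simps)
        also have "\<dots> = \<beta> r * ?s r S" using c(2)[of r'] c(3) True Suc by (simp add: algebra_simps del: shifted_cup.simps) (metis distrib_right mult.commute mult.assoc add.right_neutral)
        finally show ?thesis .
      next
        case False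
        then have N: "?N = {r, r', Suc r}" using Suc r by auto
        have nxt: "tl_e (Suc m - r) (?s (Suc r)) = ?s r" using False r by (intro tl_e_shifted_cup_next[OF f(1)]) simp
        have "(\<Sum>r'\<in>?N. c r' * tl_e (Suc m - r) (?s r') S) = c r * (loop * ?s r S) + c r' * ?s r S + c (Suc r) * ?s r S"
          unfolding N using Suc prev same nxt by (simp del: shifted_cup.simps)
        also have "\<dots> = (loop * c (Suc r') + c r' + c (Suc (Suc r'))) * ?s r S" unfolding Suc by (simp only: algebra_simps)
        also have "\<dots> = \<beta> r * ?s r S" unfolding c(2) Suc ..
        finally show ?thesis .
      qed
    qed
    finally show "tl_e (Suc m - r) (\<Sum>r'\<le>m. fscale (c r') (?s r')) S = fscale (\<beta> r) (?s r) S" by simp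
  qed
  then have *: "tl_e (Suc m - r) (y - (\<Sum>r\<le>m. fscale (c r) (?s r))) = 0" if "r \<le> m" for r
    unfolding tl_e_diff using \<beta>[OF that] that by (metis diff_self)
  have "singular (Suc (Suc m)) (y - (\<Sum>r\<le>m. fscale (c r) (?s r)))"
    unfolding singular_def
  proof (intro allI impI)
    fix j assume "1 \<le> j \<and> j < Suc (Suc m)"
    then have "j = Suc m - (Suc m - j)" "Suc m - j \<le> m" by auto
    then show "tl_e j (y - (\<Sum>r\<le>m. fscale (c r) (?s r))) = 0" using *[of "Suc m - j"] by metis
  qed
  then show ?thesis using that by blast
qed

end

section \<open>Trivial subquotients and chains of submodules\<close>

context root_of_unity
begin

lemma shifted_cup_in_submodule:
  assumes "submodule (Suc (Suc m)) p A" "cup m f \<in> A" shows "r \<le> m \<Longrightarrow> shifted_cup m f r \<in> A"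
proof (induction r)
  case (Suc r)
  then have "shifted_cup m f r \<in> A" by simp
  then have "tl_e (m - r) (shifted_cup m f r) \<in> A" using Suc.prems by (intro submoduleD(3)[OF assms(1)]) auto
  then show ?case by (simp only: shifted_cup.simps)
qed (use assms(2) in \<open>simp only: shifted_cup.simps\<close>)

lemma submodule_singular_multiple:
  assumes "submodule n p A" "f \<in> A" "singular n f" shows "\<exists>c. f = fscale c (sym_vec n p)"
  using assms singular_eq_sym_vec standard_graded submoduleD(2) by blast

text \<open>The case of one cup in the socle vector. The congruence for m - k with k + 2 < l makes
  the second cap of A zero, so \<open>cap m\<close> maps A into the line of the symmetric vector,
  and the tridiagonal system is solvable. Correcting y by shifted cups, all of them in A, leaves a
  nonzero singular vector, and this forces the stated congruence.\<close>

lemma trivial_subquotient_step: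
  assumes A: "submodule (Suc (Suc m)) (Suc (Suc k)) A" "A \<noteq> standard (Suc (Suc m)) (Suc (Suc k))"
    and y: "y \<in> standard (Suc (Suc m)) (Suc (Suc k))" "y \<notin> A" "\<And>j. 1 \<le> j \<Longrightarrow> j \<le> Suc m \<Longrightarrow> tl_e j y \<in> A"
    and sym: "cup m (sym_vec m (Suc k)) \<in> A"
    and k: "Suc (Suc k) < l" "l dvd m - k" "2 * Suc k \<le> m"
  shows "l dvd Suc m - k"
proof -
  have m2: "2 \<le> m" using k(3) by simp
  then obtain m' where m: "m = Suc (Suc m')" by (metis add_2_eq_Suc le_Suc_ex)
  have not_dvd: "\<not> l dvd m + 2"
  proof
    assume "l dvd m + 2"
    moreover have "m + 2 = (m - k) + Suc (Suc k)" using k(3) by simp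
    ultimately have "l dvd Suc (Suc k)" using k(2) by (metis dvd_add_right_iff)
    then show False using k(1) by (auto dest: dvd_imp_le)
  qed
  let ?D = "cap m ` A"
  have D: "submodule m (Suc k) ?D" by (rule submodule_cap[OF A(1)])
  have D_ne: "?D \<noteq> standard m (Suc k)" using submodule_cap_full[OF A(1)] A(2) by blast
  have D': "submodule (Suc (Suc m')) (Suc k) ?D" using D m by simp
  have DD: "cap m' ` ?D = {0}"
  proof (rule cap_level_zero)
    show "submodule m' k (cap m' ` ?D)" by (rule submodule_cap[OF D'])
    show "cap m' ` ?D \<noteq> standard m' k" using submodule_cap_full[OF D'] D_ne m by blast
    show "Suc k < l" "l dvd m' + 2 - k" using k m by simp_all
  qed
  have mult: "\<exists>c. g = fscale c (sym_vec m (Suc k))" if "g \<in> ?D" for g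
    using submodule_singular_multiple[OF D that] singular_of_cap_zero[OF D' _ that] DD m by blast
  define Z where "Z = {z \<in> standard (Suc (Suc m)) (Suc (Suc k)). \<forall>j. 1 \<le> j \<and> j \<le> Suc m \<longrightarrow> tl_e j z \<in> A}"
  \<comment> \<open>By the zigzag, cap z is also the cap of e_m e_{m+1} z, which lies in A although
    z need not.\<close>
  have Zcap: "cap m z \<in> ?D" if z: "z \<in> Z" for z
  proof -
    have zs: "z \<in> standard (Suc (Suc m)) (Suc (Suc k))" and zA: "tl_e (Suc m) z \<in> A" using z by (auto simp: Z_def)
    from zA have "tl_e m (tl_e (Suc m) z) \<in> A" by (rule submoduleD(3)[OF A(1)]) (use m2 in auto)
    moreover have "cap m (tl_e m (tl_e (Suc m) z)) = cap m z"
      using cap_zigzag[OF standard_graded[OF cap_standard[OF zs], unfolded m]] unfolding m by (simp only: tl_e_eq_cup_cap)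
    ultimately show ?thesis by (metis image_eqI)
  qed
  have AZ: "a \<in> Z" if "a \<in> A" for a
    using submoduleD(2,3)[OF A(1)] that unfolding Z_def by auto
  let ?s = "shifted_cup m (sym_vec m (Suc k))"
  \<comment> \<open>The claim covers all of Z because the step applies it to e_{m-r} z, an element
    of A, before e_{m-r} e_{m+1-r} e_{m-r} = e_{m-r} returns to z.\<close>
  have Z_mult: "r \<le> m \<Longrightarrow> z \<in> Z \<Longrightarrow> \<exists>b. tl_e (Suc m - r) z = fscale b (?s r)" for r z
  proof (induction r arbitrary: z)
    case 0
    obtain c where "cap m z = fscale c (sym_vec m (Suc k))" using mult[OF Zcap[OF 0(2)]] by blast
    then have "tl_e (Suc m - 0) z = fscale c (?s 0)"
      by (simp only: diff_zero tl_e_eq_cup_cap cup_scale shifted_cup.simps)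
    then show ?case by blast
  next
    case (Suc r)
    have "1 \<le> m - r \<and> m - r \<le> Suc m" using Suc.prems(1) by auto
    then have "tl_e (m - r) z \<in> A" using Suc.prems(2) unfolding Z_def by blast
    then obtain b where b: "tl_e (Suc m - r) (tl_e (m - r) z) = fscale b (?s r)"
      using Suc.IH[OF _ AZ] Suc.prems(1) by (meson Suc_leD)
    have "Suc (m - r) = Suc m - r" using Suc.prems(1) by simp
    then have "tl_e (m - r) z = tl_e (m - r) (tl_e (Suc m - r) (tl_e (m - r) z))"
      using tl_e_braid1[of "m - r" z] by simp
    also have "\<dots> = fscale b (?s (Suc r))" unfolding b tl_e_scale by (simp only: shifted_cup.simps)
    finally show ?case by (simp only: diff_Suc_Suc) blast
  qed
  have "y \<in> Z" using y unfolding Z_def by auto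
  then obtain c where c: "singular (Suc (Suc m)) (y - (\<Sum>r\<le>m. fscale (c r) (?s r)))"
    using make_singular[OF sym_vec_graded sym_vec_singular not_dvd] Z_mult by metis
  let ?x = "\<Sum>r\<le>m. fscale (c r) (?s r)"
  have x: "?x \<in> A"
    by (intro fun_vs.subspace_sum[OF submoduleD(1)[OF A(1)]] fun_vs.subspace_scale[OF submoduleD(1)[OF A(1)]]
        shifted_cup_in_submodule[OF A(1) sym]) simp
  have nz: "y - ?x \<noteq> 0" using x y(2) by (metis eq_iff_diff_eq_0)
  have "y - ?x \<in> standard (Suc (Suc m)) (Suc (Suc k))"
    using y(1) x submoduleD(2)[OF A(1)] by (intro fun_vs.subspace_diff[OF subspace_standard]) auto
  from singular_condition(2)[OF this c nz] show ?thesis by simp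
qed

text \<open>For nonzero A two congruences meet: one from the socle vector of A and one from the
  restriction of the subquotient to n points. Their difference is a condition on the number i of
  cups in the socle vector, which is too small to be a positive multiple of l.\<close>

theorem trivial_subquotient_condition:
  assumes "trivial_subquotient n k" shows "k = 0 \<or> k < l \<and> l dvd n + 1 - k"
  using assms
proof (induction n arbitrary: k)
  case 0
  then obtain A y where A: "submodule 0 k A" "y \<in> standard 0 k" "y \<notin> A"
    unfolding trivial_subquotient_def by blast
  then have "y \<noteq> 0" using submoduleD(4) by blast
  then show ?case using standard_small[OF A(2)] by auto
next
  case (Suc n)
  obtain A y where A: "submodule (Suc n) k A" and y: "y \<in> standard (Suc n) k" "y \<notin> A"
    "\<And>j. 1 \<le> j \<Longrightarrow> j < Suc n \<Longrightarrow> tl_e j y \<in> A"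
    using Suc.prems unfolding trivial_subquotient_def by blast
  have y0: "y \<noteq> 0" using y(2) submoduleD(4)[OF A] by blast
  have small: "2 * k \<le> Suc n" using standard_small[OF y(1)] y0 by linarith
  have A_ne: "A \<noteq> standard (Suc n) k" using y by blast
  show ?case
  proof (cases k)
    case (Suc k')
    have zero: "k < l \<and> l dvd Suc n + 1 - k" if "A = {0}"
    proof -
      have "singular (Suc n) y" unfolding singular_def using y(3) that by blast
      then show ?thesis using singular_condition[OF y(1) _ y0] Suc by simp
    qed
    have "trivial_subquotient n k' \<or> trivial_subquotient n k"
      using trivial_subquotient_restrict[of n k' A y] A y Suc by simp
    then have cases: "k' = 0 \<or> k' < l \<and> l dvd n + 1 - k' \<or> k < l \<and> l dvd n + 1 - k"
      using Suc.IH Suc by blast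
    have "k < l \<and> l dvd Suc n + 1 - k" if nz: "A \<noteq> {0}"
    proof -
      obtain i m where im: "Suc n = m + 2 * i" "i < k" "k - i < l" "l dvd m + 1 - (k - i)" 
        "cups i m (sym_vec m (k - i)) \<in> A"
        using socle[OF A nz A_ne] by blast
      show ?thesis
      proof (cases i)
        case 0
        then show ?thesis using im by simp
      next
        case (Suc i')
        consider "k' = 0" | "k' < l" "l dvd n + 1 - k'" | "k < l" "l dvd n + 1 - k" using cases by blast
        then show ?thesis
        proof cases
          case 1
          then show ?thesis using im(2) Suc \<open>k = Suc k'\<close> by simp
        next
          case 2
          show ?thesis
          proof (cases "k < l")
            case True
            then show ?thesis using 2 \<open>k = Suc k'\<close> by simp
          next
            case False
            \<comment> \<open>The congruence already is the required one and only the bound on k can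
              fail; then l would divide i, which is positive and less than k = l.\<close>
            then have "k = l" using 2 \<open>k = Suc k'\<close> by simp
            have "n + 1 - k' = (m + 1 - (k - i)) + i" using im(1,2) small \<open>k = Suc k'\<close> by simp
            then have "l dvd i" using 2(2) im(4) by (metis dvd_add_right_iff)
            then show ?thesis using im(2) \<open>k = l\<close> Suc by (auto dest: dvd_imp_le)
          qed
        next
          case 3
          \<comment> \<open>Here restriction kept all k cups, so its congruence is off by one from
            the required one; compared with the socle it leaves only i = 1.\<close>
          have "n + 1 - k = (m + 1 - (k - i)) + i'" using im(1,2) small Suc by simp
          then have "l dvd i'" using 3(2) im(4) by (metis dvd_add_right_iff)
          then have "i' = 0" using im(2) 3(1) Suc by (auto dest: dvd_imp_le)
          then have i: "i = 1" using Suc by simp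
          have n: "n = Suc m" using im(1) i by simp
          have "2 \<le> k" using im(2) i by simp
          then obtain k2 where k2: "k = Suc (Suc k2)" by (metis add_2_eq_Suc le_Suc_ex)
          have "l dvd Suc m - k2"
          proof (rule trivial_subquotient_step)
            show "submodule (Suc (Suc m)) (Suc (Suc k2)) A" using A n k2 by simp
            show "A \<noteq> standard (Suc (Suc m)) (Suc (Suc k2))" using A_ne n k2 by simp
            show "y \<in> standard (Suc (Suc m)) (Suc (Suc k2))" "y \<notin> A" using y n k2 by simp_all
            show "tl_e j y \<in> A" if "1 \<le> j" "j \<le> Suc m" for j using y(3) that n by simp
            show "cup m (sym_vec m (Suc k2)) \<in> A" using im(5) i k2 by simp
            show "Suc (Suc k2) < l" using 3 k2 by simp
            show "l dvd m - k2" using 3 k2 n by simp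
            show "2 * Suc k2 \<le> m" using small k2 n by simp
          qed
          then show ?thesis using 3 k2 n by simp
        qed
      qed
    qed
    then show ?thesis using zero by blast
  qed simp
qed

text \<open>The standard representations have length at most two. If capping does not separate A
  from B, then B/A is trivial; if it does, then by induction cap A is zero and A consists of
  singular vectors. Either way the congruence makes cap B zero too: in the first case B is then a
  line, in the second this contradicts the separation.\<close>

theorem submodule_chain:
  assumes "submodule n p A" "submodule n p B" "A \<subset> B" "B \<noteq> standard n p"
  shows "A = {0}"
  using assms
proof (induction p arbitrary: n A B)
  case 0
  then have "B = {0}" using standard_0_submodule by blast
  then show ?case using 0 submoduleD(4) by blast
next
  case (Suc p)
  show ?case
  proof (rule ccontr)
    assume nz: "A \<noteq> {0}"
    have "2 \<le> n" using submodule_nonzero_small[OF Suc.prems(1) nz] by simp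
    then obtain m where n: "n = Suc (Suc m)" by (metis add_2_eq_Suc le_Suc_ex)
    have A: "submodule (Suc (Suc m)) (Suc p) A" and B: "submodule (Suc (Suc m)) (Suc p) B"
      using Suc.prems n by simp_all
    let ?DA = "cap m ` A" and ?DB = "cap m ` B"
    have DA: "submodule m p ?DA" and DB: "submodule m p ?DB" using submodule_cap[OF A] submodule_cap[OF B] by blast+
    have DB_ne: "?DB \<noteq> standard m p" using submodule_cap_full[OF B] Suc.prems(4) n by blast
    have DA_ne: "?DA \<noteq> standard m p"
      using DB_ne submoduleD(2)[OF DB] image_mono[of A B "cap m"] Suc.prems(3) by blast
    show False
    proof (cases "?DA = ?DB")
      case True
      obtain y where y: "y \<in> B" "y \<notin> A" using Suc.prems(3) by blast
      have "tl_e j y \<in> A" if j: "1 \<le> j" "j \<le> Suc m" for j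
      proof (rule trivial_action[OF A B _ y(1) j])
        fix b assume "b \<in> B"
        then have "cap m b \<in> ?DA" using True by blast
        then show "tl_e (Suc m) b \<in> A"
          unfolding tl_e_eq_cup_cap by (rule cup_cap_in_submodule[OF A])
      qed
      then have "trivial_subquotient n (Suc p)"
        unfolding trivial_subquotient_def using A y submoduleD(2)[OF B] n by (metis less_Suc_eq_le subsetD)
      then have c: "Suc p < l" "l dvd n + 1 - Suc p" using trivial_subquotient_condition by blast+
      have "?DB = {0}" using cap_level_zero[OF DB DB_ne c(1)] c(2) n by simp
      then have mult: "\<exists>c. b = fscale c (sym_vec n (Suc p))" if "b \<in> B" for b
        using submodule_singular_multiple[OF Suc.prems(2) that] singular_of_cap_zero[OF B _ that] n by blast
      obtain a where a: "a \<in> A" "a \<noteq> 0" using nz submoduleD(4)[OF A] by blast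
      have "singular n a" using singular_of_cap_zero[OF A _ a(1)] True \<open>?DB = {0}\<close> n by blast
      then have "sym_vec n (Suc p) \<in> A" by (rule singular_submodule[OF Suc.prems(1) a])
      then have "B \<subseteq> A" using mult fun_vs.subspace_scale[OF submoduleD(1)[OF A]] by blast
      then show False using Suc.prems(3) by blast
    next
      case False
      then have "?DA \<subset> ?DB" using image_mono[of A B "cap m"] Suc.prems(3) by blast
      then have DA0: "?DA = {0}" using Suc.IH[OF DA DB _ DB_ne] by blast
      obtain a where a: "a \<in> A" "a \<noteq> 0" using nz submoduleD(4)[OF A] by blast
      have s: "singular n a" using singular_of_cap_zero[OF A _ a(1)] DA0 n by blast
      have "a \<in> standard n (Suc p)" using a submoduleD(2)[OF Suc.prems(1)] by blast
      from singular_condition[OF this s a(2)] have "Suc p < l" "l dvd m + 2 - p" using n by simp_all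
      then have "?DB = {0}" by (rule cap_level_zero[OF DB DB_ne])
      then show False using False DA0 by blast
    qed
  qed
qed

end

section \<open>The maximal submodule\<close>

context nonzero_parameter
begin

lemma lower_funpow_linear:
  "(lower n ^^ k) (f + g) = (lower n ^^ k) f + (lower n ^^ k) g"
  "(lower n ^^ k) (fscale c f) = fscale c ((lower n ^^ k) f)"
  "(lower n ^^ k) 0 = 0"
  by (induction k) (simp_all only: funpow.simps id_apply o_apply lower_add lower_scale lower_zero)

lemma lower_funpow_tl_e:
  "1 \<le> j \<Longrightarrow> Suc j \<le> n \<Longrightarrow> (lower n ^^ k) (tl_e j f) = tl_e j ((lower n ^^ k) f)"
  by (induction k) (simp_all only: funpow.simps id_apply o_apply lower_tl_e)

lemma lower_funpow_cup: "(lower (Suc (Suc n)) ^^ k) (cup n f) = cup n ((lower n ^^ k) f)"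
  by (induction k) (simp_all only: funpow.simps id_apply o_apply lower_cup)

lemma lower_funpow_cups: "(lower (m + 2 * i) ^^ k) (cups i m f) = cups i m ((lower m ^^ k) f)"
proof (induction i)
  case (Suc i)
  have "m + 2 * Suc i = Suc (Suc (m + 2 * i))" by simp
  then show ?case by (simp only: cups.simps lower_funpow_cup Suc)
qed (simp only: cups.simps mult_0_right add_0_right)

lemma link_vec_id_eq_sym_vec: "link_vec m id = sym_vec m 0"
proof -
  have "sym_vec m 0 = fscale (sym_vec m 0 (\<lambda>_. False)) (link_vec m id)"
    by (rule graded_0_eq[OF sym_vec_graded])
  also have "sym_vec m 0 (\<lambda>_. False) = 1" by (simp add: sym_vec_def)
  finally show ?thesis by (simp only: fun_vs.scale_one)
qed

lemma sym_vec_ne_0: assumes "k \<le> m" shows "sym_vec m k \<noteq> 0"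
proof
  assume "sym_vec m k = 0"
  then have "sym_vec m k (\<lambda>i. i \<in> {1..k}) = 0" by simp
  moreover have "downs (\<lambda>i. i \<in> {1..k}) = {1..k}" by (auto simp: downs_def)
  ultimately show False using assms by (simp add: sym_vec_def)
qed

text \<open>Caps the last pair of points p times, so that only m points remain; for an element of
  V_{m+2p,p} the result is a multiple of the vacuum vector.\<close>

fun caps :: "nat \<Rightarrow> nat \<Rightarrow> tensor \<Rightarrow> tensor" where
  "caps 0 m f = f"
| "caps (Suc p) m f = caps p m (cap (m + 2 * p) f)"

fun top_word :: "nat \<Rightarrow> nat \<Rightarrow> nat list" where
  "top_word m 0 = []"
| "top_word m (Suc p) = Suc (m + 2 * p) # top_word m p"

lemma top_word_range: "j \<in> set (top_word m p) \<Longrightarrow> 1 \<le> j \<and> Suc j \<le> m + 2 * p"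
  by (induction p) auto

lemma caps_linear:
  "caps p m (f + g) = caps p m f + caps p m g" "caps p m (fscale c f) = fscale c (caps p m f)" "caps p m 0 = 0"
  by (induction p arbitrary: f g) (simp_all only: caps.simps cap_add cap_scale cap_zero)

lemma foldr_tl_e_cap:
  "(\<And>j. j \<in> set ws \<Longrightarrow> Suc j \<le> n) \<Longrightarrow> foldr tl_e ws (cap n f) = cap n (foldr tl_e ws f)"
  by (induction ws) (simp_all add: tl_e_cap)

lemma foldr_tl_e_top_word: "foldr tl_e (top_word m p) f = cups p m (caps p m f)"
proof (induction p arbitrary: f)
  case (Suc p)
  have "foldr tl_e (top_word m (Suc p)) f = cup (m + 2 * p) (cap (m + 2 * p) (foldr tl_e (top_word m p) f))"
    by (simp only: top_word.simps foldr_Cons o_apply tl_e_eq_cup_cap)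
  also have "cap (m + 2 * p) (foldr tl_e (top_word m p) f) = foldr tl_e (top_word m p) (cap (m + 2 * p) f)"
    using top_word_range by (intro foldr_tl_e_cap[symmetric]) blast
  finally show ?case by (simp only: Suc cups.simps caps.simps)
qed (simp only: top_word.simps foldr_Nil id_apply cups.simps caps.simps)

lemma cap_graded_0: assumes "f \<in> graded n 0" shows "cap m f = 0"
proof (rule ext)
  fix S :: spins
  have "f (S(a := True)) = 0" for a
  proof (rule graded_0_apply[OF assms])
    show "S(a := True) \<noteq> (\<lambda>_. False)" by (metis fun_upd_same)
  qed
  then show "cap m f S = 0 S" by (simp add: cap_def)
qed

lemma caps_standard: "f \<in> standard (m + 2 * p) (i + p) \<Longrightarrow> caps p m f \<in> standard m i"
proof (induction p arbitrary: f)
  case (Suc p)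
  then have "cap (m + 2 * p) f \<in> standard (m + 2 * p) (i + p)" by (intro cap_standard) simp
  then show ?case using Suc.IH by (simp only: caps.simps)
qed simp

lemma caps_eq_0: "f \<in> standard (m + 2 * p) i \<Longrightarrow> i < p \<Longrightarrow> caps p m f = 0"
proof (induction p arbitrary: f i)
  case (Suc p)
  show ?case
  proof (cases i)
    case 0
    then have "cap (m + 2 * p) f = 0" using Suc.prems by (intro cap_graded_0[OF standard_graded]) simp
    then show ?thesis by (simp only: caps.simps caps_linear)
  next
    case (Suc i')
    then have "cap (m + 2 * p) f \<in> standard (m + 2 * p) i'" using Suc.prems by (intro cap_standard) simp
    then show ?thesis using Suc.IH Suc.prems(2) Suc by simp
  qed
qed simp

lemma top_word_kills:
  assumes "f \<in> standard (m + 2 * p) i" "i < p" shows "foldr tl_e (top_word m p) f = 0"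
proof -
  have z: "cups p m 0 = 0" by (induction p) (simp_all only: cups.simps cup_zero)
  show ?thesis unfolding foldr_tl_e_top_word caps_eq_0[OF assms] by (rule z)
qed

lemma cups_scale: "cups p m (fscale c f) = fscale c (cups p m f)"
  by (induction p) (simp_all only: cups.simps cup_scale)

lemma top_word_rank_one:
  assumes "f \<in> standard (m + 2 * p) p"
  shows "foldr tl_e (top_word m p) f = fscale (caps p m f (\<lambda>_. False)) (cups p m (link_vec m id))"
proof -
  have "caps p m f \<in> standard m 0" using caps_standard[of f m p 0] assms by simp
  from graded_0_eq[OF standard_graded[OF this], of m] show ?thesis
    unfolding foldr_tl_e_top_word by (metis cups_scale)
qed

text \<open>The state with p cups side by side on the right is cyclic. Each cup is peeled off by a
  zigzag; only when no point is left beside it must \<open>loop\<close> be inverted, and this is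
  what excludes l = 2 with n = 2p.\<close>

lemma submodule_cups_full:
  assumes "submodule (m + 2 * p) p A" "cups p m (link_vec m id) \<in> A" "1 \<le> m \<or> loop \<noteq> 0"
  shows "A = standard (m + 2 * p) p"
  using assms
proof (induction p arbitrary: A)
  case 0
  have "link_vec m id \<noteq> 0"
  proof
    assume "link_vec m id = 0"
    then have "link_vec m id (\<lambda>_. False) = 0" by simp
    then show False using link_vec_vacuum by simp
  qed
  then have "A \<noteq> {0}" using 0(2) by (metis cups.simps(1) singletonD)
  then show ?case using standard_0_submodule 0(1) by simp
next
  case (Suc p)
  let ?n = "m + 2 * p" and ?g = "cups p m (link_vec m id)"
  have n: "m + 2 * Suc p = Suc (Suc ?n)" by simp
  have A: "submodule (Suc (Suc ?n)) (Suc p) A" using Suc.prems(1) unfolding n .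
  have g: "?g \<in> standard ?n p" using cups_graded_standard[OF link_vec_id_standard, of p m] by simp
  have cg: "cup ?n ?g \<in> A" using Suc.prems(2) by (simp only: cups.simps)
  have "?g \<in> cap ?n ` A"
  proof (cases "?n")
    case 0
    then have l0: "loop \<noteq> 0" using Suc.prems(3) by simp
    have "fscale (inverse loop) (cup ?n ?g) \<in> A" by (rule fun_vs.subspace_scale[OF submoduleD(1)[OF A] cg])
    moreover have "cap ?n (fscale (inverse loop) (cup ?n ?g)) = ?g"
      unfolding cap_scale cap_cup[OF standard_graded[OF g]] using l0 by (simp only: fun_vs.scale_scale left_inverse fun_vs.scale_one not_False_eq_True)
    ultimately show ?thesis by (metis image_eqI)
  next
    case (Suc n')
    have "tl_e (Suc n') (cup ?n ?g) \<in> A" by (rule submoduleD(3)[OF A cg]) (use Suc in auto)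
    moreover have "cap ?n (tl_e (Suc n') (cup ?n ?g)) = ?g"
      using cap_zigzag[of ?g n' p] standard_graded[OF g] unfolding Suc by blast
    ultimately show ?thesis by (metis image_eqI)
  qed
  then have "cap ?n ` A = standard ?n p" using Suc.IH[OF submodule_cap[OF A]] Suc.prems(3) by blast
  then show ?case using submodule_cap_full[OF A] n by simp
qed

lemma cups_link_vec_standard: "cups p m (link_vec m id) \<in> standard (m + 2 * p) p"
  using cups_graded_standard[OF link_vec_id_standard, of p m] by simp

lemma cups_link_vec_ne_0: "cups p m (link_vec m id) \<noteq> 0"
  using cups_eq_0[OF link_vec_id_standard] sym_vec_ne_0[of 0 m] link_vec_id_eq_sym_vec by auto

lemma caps_surjective:
  assumes "1 \<le> m \<or> loop \<noteq> 0"
  obtains f where "f \<in> standard (m + 2 * p) p" "caps p m f (\<lambda>_. False) \<noteq> 0"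
proof -
  have "\<exists>f\<in>standard (m + 2 * p) p. caps p m f = link_vec m id"
  proof (induction p)
    case 0
    show ?case
      by (intro bexI[of _ "link_vec m id"]) (simp_all only: caps.simps mult_0_right add_0_right link_vec_id_standard)
  next
    case (Suc p)
    then obtain g where g: "g \<in> standard (m + 2 * p) p" "caps p m g = link_vec m id" by blast
    let ?n = "m + 2 * p"
    have "\<exists>f\<in>standard (Suc (Suc ?n)) (Suc p). cap ?n f = g"
    proof (cases ?n)
      case 0
      then have l0: "loop \<noteq> 0" using assms by simp
      have "fscale (inverse loop) (cup ?n g) \<in> standard (Suc (Suc ?n)) (Suc p)"
        by (rule fun_vs.subspace_scale[OF subspace_standard cup_standard[OF g(1)]])
      moreover have "cap ?n (fscale (inverse loop) (cup ?n g)) = g"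
        unfolding cap_scale cap_cup[OF standard_graded[OF g(1)]] using l0 by (simp only: fun_vs.scale_scale left_inverse fun_vs.scale_one not_False_eq_True)
      ultimately show ?thesis by blast
    next
      case (Suc n')
      have "tl_e (Suc n') (cup ?n g) \<in> standard (Suc (Suc ?n)) (Suc p)"
        by (rule tl_e_standard[OF cup_standard[OF g(1)]]) (use Suc in auto)
      moreover have "cap ?n (tl_e (Suc n') (cup ?n g)) = g"
        using cap_zigzag[of g n' p] standard_graded[OF g(1)] unfolding Suc by blast
      ultimately show ?thesis by blast
    qed
    then obtain f where f: "f \<in> standard (Suc (Suc ?n)) (Suc p)" "cap ?n f = g" by blast
    have "m + 2 * Suc p = Suc (Suc ?n)" by simp
    moreover have "caps (Suc p) m f = link_vec m id" unfolding caps.simps f(2) by (rule g(2))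
    ultimately show ?case using f(1) by (intro bexI[of _ f]) (simp_all only:)
  qed
  then show ?thesis using that link_vec_vacuum[of m] by force
qed

end

context root_of_unity
begin

lemma lower_funpow_sym_vec:
  "k < l \<Longrightarrow> \<exists>c. c \<noteq> 0 \<and> (lower m ^^ k) (sym_vec m 0) = fscale c (sym_vec m k)"
proof (induction k)
  case 0
  show ?case by (intro exI[of _ 1] conjI one_neq_zero) (simp only: funpow.simps id_apply fun_vs.scale_one)
next
  case (Suc k)
  obtain c where c: "c \<noteq> 0" "(lower m ^^ k) (sym_vec m 0) = fscale c (sym_vec m k)"
    using Suc.IH[OF Suc_lessD[OF Suc.prems]] by blast
  obtain d where d: "d \<noteq> 0" "lower m (sym_vec m k) = fscale d (sym_vec m (Suc k))"
    using lower_sym_vec_ne_0[OF Suc.prems] by blast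
  have "(lower m ^^ Suc k) (sym_vec m 0) = fscale (c * d) (sym_vec m (Suc k))"
    by (simp only: funpow.simps o_apply c(2) lower_scale d(2) fun_vs.scale_scale)
  then show ?case using c(1) d(1) by (intro exI[of _ "c * d"]) simp
qed

text \<open>The numbers n + 1 - 2p and n + 1 - 2i are mirror images in the multiple n + 1 - p - i of
  l, and \<open>p - i < l\<close> says that this is the first such mirror above n + 1 - 2p.\<close>

definition reflected :: "nat \<Rightarrow> nat \<Rightarrow> nat \<Rightarrow> bool" where
  "reflected n p i \<longleftrightarrow> i < p \<and> p - i < l \<and> l dvd n + 1 - p - i"

lemma reflected_unique:
  assumes "reflected n p i" "reflected n p i'" "2 * p \<le> n" shows "i = i'"
proof -
  have False if "reflected n p i" "reflected n p i'" "i < i'" for i i'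
  proof -
    have "n + 1 - p - i = (n + 1 - p - i') + (i' - i)" using that assms(3) unfolding reflected_def by auto
    then have "l dvd i' - i" using that unfolding reflected_def by (metis dvd_add_right_iff)
    then show False using that unfolding reflected_def by (auto dest: dvd_imp_le)
  qed
  then show ?thesis using assms(1,2) by (meson linorder_neqE_nat)
qed

definition lowered :: "nat \<Rightarrow> nat \<Rightarrow> nat \<Rightarrow> tensor set" where
  "lowered n p i = (lower n ^^ (p - i)) ` standard n i"

text \<open>For i = 0 the vacuum is lowered to a multiple of the symmetric vector, which the
  congruence places in V_{m,k}. Since lowering commutes with cups and generators,
  \<open>standard_generated\<close> carries this to all i.\<close>

lemma lower_funpow_standard:
  assumes "1 \<le> k" "k < l" "2 * k \<le> m" "l dvd m + 1 - k" "f \<in> standard (m + 2 * i) i"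
  shows "(lower (m + 2 * i) ^^ k) f \<in> standard (m + 2 * i) (i + k)"
  using assms(5)
proof (induction i arbitrary: f)
  case 0
  obtain c where c: "(lower m ^^ k) (sym_vec m 0) = fscale c (sym_vec m k)"
    using lower_funpow_sym_vec[OF assms(2)] by blast
  have f: "f \<in> standard m 0" using 0 by simp
  have "f = fscale (f (\<lambda>_. False)) (sym_vec m 0)"
    using graded_0_eq[OF standard_graded[OF f]] link_vec_id_eq_sym_vec by metis
  then have eq: "(lower m ^^ k) f = fscale (f (\<lambda>_. False)) (fscale c (sym_vec m k))"
    by (metis lower_funpow_linear(2) c)
  have "(lower m ^^ k) f \<in> standard m k"
    unfolding eq by (intro fun_vs.subspace_scale[OF subspace_standard] sym_vec_standard assms(1-4))
  then show ?case by simp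
next
  case (Suc i)
  have n: "m + 2 * Suc i = Suc (Suc (m + 2 * i))" by simp
  let ?N = "{f. (lower (Suc (Suc (m + 2 * i))) ^^ k) f \<in> standard (Suc (Suc (m + 2 * i))) (Suc (i + k))}"
  have "standard (Suc (Suc (m + 2 * i))) (Suc i) \<subseteq> ?N"
  proof (rule standard_generated)
    show "fun_vs.subspace ?N"
      by (rule fun_vs.subspaceI)
        (auto simp only: mem_Collect_eq lower_funpow_linear fun_vs.subspace_0[OF subspace_standard]
          intro: fun_vs.subspace_add[OF subspace_standard] fun_vs.subspace_scale[OF subspace_standard])
    show "tl_e j f \<in> ?N" if "f \<in> ?N" "1 \<le> j" "j \<le> Suc (m + 2 * i)" for f j
      using that lower_funpow_tl_e[of j "Suc (Suc (m + 2 * i))" k f] tl_e_standard by auto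
    show "cup (m + 2 * i) g \<in> ?N" if "g \<in> standard (m + 2 * i) i" for g
      using cup_standard[OF Suc.IH[OF that]] by (simp only: mem_Collect_eq lower_funpow_cup)
  qed
  then show ?case using Suc.prems unfolding n add_Suc by blast
qed

lemma reflected_dvd:
  assumes "reflected (m + 2 * i) p i" "2 * p \<le> m + 2 * i" shows "l dvd m + 1 - (p - i)"
proof -
  have "m + 1 - (p - i) = m + 2 * i + 1 - p - i" using assms by (simp add: reflected_def)
  then show ?thesis using assms(1) by (simp only: reflected_def)
qed

lemma reflectedD:
  assumes "reflected n p i" "2 * p \<le> n"
  obtains m k where "n = m + 2 * i" "p = i + k" "1 \<le> k" "k < l" "2 * k \<le> m" "l dvd m + 1 - k"
proof -
  have i: "i < p" "p - i < l" using assms(1) by (simp_all add: reflected_def)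
  then have n: "n = (n - 2 * i) + 2 * i" using assms(2) by simp
  have "l dvd (n - 2 * i) + 1 - (p - i)" using reflected_dvd[of "n - 2 * i" i p] assms n by simp
  then show ?thesis using that[of "n - 2 * i" "p - i"] n i assms(2) by simp
qed

lemma submodule_lowered:
  assumes "submodule n i A" "reflected n p i" "2 * p \<le> n"
  shows "submodule n p ((lower n ^^ (p - i)) ` A)"
  unfolding submodule_def
proof (intro conjI ballI allI impI)
  show "fun_vs.subspace ((lower n ^^ (p - i)) ` A)"
    using lower_funpow_linear(1,2) submoduleD(1)[OF assms(1)] by (rule subspace_image)
  obtain m k where mk: "n = m + 2 * i" "p = i + k" "1 \<le> k" "k < l" "2 * k \<le> m" "l dvd m + 1 - k"
    by (rule reflectedD[OF assms(2,3)])
  show "(lower n ^^ (p - i)) ` A \<subseteq> standard n p"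
    using lower_funpow_standard[OF mk(3-6)] submoduleD(2)[OF assms(1)] mk(1,2) by auto
  fix f j assume "f \<in> (lower n ^^ (p - i)) ` A" and j: "1 \<le> j \<and> j < n"
  then obtain a where a: "a \<in> A" "f = (lower n ^^ (p - i)) a" by blast
  then have "tl_e j f = (lower n ^^ (p - i)) (tl_e j a)" using lower_funpow_tl_e[of j n] j by simp
  moreover have "tl_e j a \<in> A" using submoduleD(3)[OF assms(1) a(1)] j by simp
  ultimately show "tl_e j f \<in> (lower n ^^ (p - i)) ` A" by blast
qed

lemma lowered_submodule: "reflected n p i \<Longrightarrow> 2 * p \<le> n \<Longrightarrow> submodule n p (lowered n p i)"
  unfolding lowered_def by (rule submodule_lowered[OF submodule_standard])

text \<open>As k = p - i is less than l, lowering the vacuum k times gives a nonzero multiple of the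
  symmetric vector, so the image contains the vector of the socle lemma.\<close>

lemma lowered_contains:
  assumes "reflected (m + 2 * i) p i" "2 * p \<le> m + 2 * i"
  shows "cups i m (sym_vec m (p - i)) \<in> lowered (m + 2 * i) p i" "lowered (m + 2 * i) p i \<noteq> {0}"
proof -
  have k: "p - i < l" "p - i \<le> m" using assms by (auto simp: reflected_def)
  obtain c where c: "c \<noteq> 0" "(lower m ^^ (p - i)) (sym_vec m 0) = fscale c (sym_vec m (p - i))"
    using lower_funpow_sym_vec[OF k(1)] by blast
  let ?v = "fscale (inverse c) (cups i m (sym_vec m 0))"
  have v: "?v \<in> standard (m + 2 * i) i"
    using fun_vs.subspace_scale[OF subspace_standard cups_link_vec_standard[of i m]] link_vec_id_eq_sym_vec[of m] by simp
  have "(lower (m + 2 * i) ^^ (p - i)) ?v = cups i m (sym_vec m (p - i))"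
    unfolding lower_funpow_linear lower_funpow_cups c(2) cups_scale
    using c(1) by (simp only: fun_vs.scale_scale left_inverse fun_vs.scale_one not_False_eq_True)
  then show *: "cups i m (sym_vec m (p - i)) \<in> lowered (m + 2 * i) p i"
    unfolding lowered_def using v by (metis image_eqI)
  have "sym_vec m (p - i) \<in> standard m (p - i)"
    using assms k reflected_dvd[OF assms] by (intro sym_vec_standard) (auto simp: reflected_def)
  then have "cups i m (sym_vec m (p - i)) \<noteq> 0"
    using cups_eq_0 sym_vec_ne_0[OF k(2)] by blast
  then show "lowered (m + 2 * i) p i \<noteq> {0}" using * by blast
qed

lemma socle_reflected:
  assumes "submodule n p A" "A \<noteq> {0}" "A \<noteq> standard n p"
  shows "\<exists>i m. n = m + 2 * i \<and> reflected n p i \<and> cups i m (sym_vec m (p - i)) \<in> A"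
proof -
  obtain i m where im: "n = m + 2 * i" "i < p" "p - i < l" "l dvd m + 1 - (p - i)" "cups i m (sym_vec m (p - i)) \<in> A"
    using socle[OF assms] by blast
  have "2 * p \<le> n" by (rule submodule_nonzero_small[OF assms(1,2)])
  then have "m + 1 - (p - i) = n + 1 - p - i" using im by simp
  then show ?thesis using im unfolding reflected_def by metis
qed

text \<open>Both contain the same socle vector because the index i is determined, so their
  intersection is nonzero; a strict inclusion of it in either one would contradict
  \<open>submodule_chain\<close>.\<close>

lemma proper_submodule_unique:
  assumes A: "submodule n p A" "A \<noteq> {0}" "A \<noteq> standard n p"
    and B: "submodule n p B" "B \<noteq> {0}" "B \<noteq> standard n p"
  shows "A = B"
proof -
  have small: "2 * p \<le> n" by (rule submodule_nonzero_small[OF A(1,2)])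
  obtain i m where im: "n = m + 2 * i" "reflected n p i" "cups i m (sym_vec m (p - i)) \<in> A"
    using socle_reflected[OF A] by blast
  obtain i' m' where im': "n = m' + 2 * i'" "reflected n p i'" "cups i' m' (sym_vec m' (p - i')) \<in> B"
    using socle_reflected[OF B] by blast
  have "i' = i" by (rule reflected_unique[OF im'(2) im(2) small])
  then have "m' = m" using im(1) im'(1) by simp
  have refl: "reflected (m + 2 * i) p i" "2 * p \<le> m + 2 * i" using im(1,2) small by simp_all
  have "sym_vec m (p - i) \<in> standard m (p - i)"
    using refl reflected_dvd[OF refl] by (intro sym_vec_standard) (auto simp: reflected_def)
  moreover have "sym_vec m (p - i) \<noteq> 0" using refl by (intro sym_vec_ne_0) (auto simp: reflected_def)
  ultimately have "cups i m (sym_vec m (p - i)) \<noteq> 0" using cups_eq_0 by blast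
  then have ne: "A \<inter> B \<noteq> {0}" using im(3) im'(3) \<open>i' = i\<close> \<open>m' = m\<close> by blast
  have AB: "submodule n p (A \<inter> B)" by (rule submodule_Int[OF A(1) B(1)])
  have "A \<inter> B = A" using submodule_chain[OF AB A(1) _ A(3)] ne by blast
  moreover have "A \<inter> B = B" using submodule_chain[OF AB B(1) _ B(3)] ne by blast
  ultimately show ?thesis by simp
qed

text \<open>If capping kills A, then A has a singular vector, and the bound by l = 2 leaves only
  V_{2,1}. There the generator acts as zero because \<open>loop\<close> is 0, so everything is a
  multiple of the symmetric vector.\<close>

lemma irreducible_half:
  assumes "l = 2" "submodule (2 * p) p A" "A \<noteq> {0}" shows "A = standard (2 * p) p"
  using assms(2,3)
proof (induction p arbitrary: A)
  case 0
  show ?case using standard_0_submodule[OF 0(1)[unfolded mult_0_right] 0(2)] by (simp only: mult_0_right)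
next
  case (Suc p)
  have A: "submodule (Suc (Suc (2 * p))) (Suc p) A" using Suc.prems(1) by simp
  show ?case
  proof (cases "cap (2 * p) ` A = {0}")
    case False
    then have "cap (2 * p) ` A = standard (2 * p) p" using Suc.IH[OF submodule_cap[OF A]] by blast
    then show ?thesis using submodule_cap_full[OF A] by simp
  next
    case True
    obtain f where f: "f \<in> A" "f \<noteq> 0" using Suc.prems(2) submoduleD(4)[OF A] by blast
    have s: "singular (Suc (Suc (2 * p))) f" using singular_of_cap_zero[OF A _ f(1)] True by blast
    have "f \<in> standard (Suc (Suc (2 * p))) (Suc p)" using submoduleD(2)[OF A] f by blast
    from singular_condition(1)[OF this s f(2)] have p: "p = 0" using assms(1) by simp
    have loop0: "loop = 0" using loop_eq_0_iff assms(1) by simp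
    have sA: "sym_vec 2 1 \<in> A" using singular_submodule[OF A f s] p by (simp add: numeral_2_eq_2)
    have "standard (Suc (Suc 0)) (Suc 0) \<subseteq> {g \<in> standard 2 1. tl_e 1 g = 0}"
    proof (rule standard_generated)
      have "fun_vs.subspace {g. tl_e 1 g = 0}"
        by (rule fun_vs.subspaceI) (auto simp only: mem_Collect_eq tl_e_add tl_e_scale tl_e_zero fun_vs.scale_zero_right add_0_right)
      then have "fun_vs.subspace (standard 2 1 \<inter> {g. tl_e 1 g = 0})"
        using subspace_standard by (rule fun_vs.subspace_inter[rotated])
      moreover have "standard 2 1 \<inter> {g. tl_e 1 g = 0} = {g \<in> standard 2 1. tl_e 1 g = 0}" by blast
      ultimately show "fun_vs.subspace {g \<in> standard 2 1. tl_e 1 g = 0}" by simp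
      show "tl_e j g \<in> {g \<in> standard 2 1. tl_e 1 g = 0}"
        if "g \<in> {g \<in> standard 2 1. tl_e 1 g = 0}" "1 \<le> j" "j \<le> Suc 0" for g j
      proof -
        have "j = 1" using that by simp
        then have "tl_e j g = 0" using that by blast
        then show ?thesis using tl_e_zero fun_vs.subspace_0[OF subspace_standard] by auto
      qed
      show "cup 0 g \<in> {g \<in> standard 2 1. tl_e 1 g = 0}" if g: "g \<in> standard 0 0" for g
      proof -
        have "tl_e 1 (cup 0 g) = cup 0 (cap 0 (cup 0 g))" using tl_e_eq_cup_cap[of 0] by simp
        also have "\<dots> = 0" unfolding cap_cup[OF standard_graded[OF g]] loop0 by (simp only: fun_vs.scale_zero_left cup_zero)
        finally show ?thesis using cup_standard[OF g] by (simp add: numeral_2_eq_2)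
      qed
    qed
    then have "g \<in> A" if g2: "g \<in> standard 2 1" for g
    proof -
      have "tl_e 1 g = 0" using g2 \<open>standard (Suc (Suc 0)) (Suc 0) \<subseteq> _\<close> by (auto simp: numeral_2_eq_2)
      moreover have "j = 1" if "1 \<le> j \<and> j < 2" for j :: nat using that by simp
      ultimately have "singular 2 g" unfolding singular_def by metis
      then obtain c where "g = fscale c (sym_vec 2 1)" using singular_eq_sym_vec standard_graded[OF g2] by blast
      then show ?thesis using fun_vs.subspace_scale[OF submoduleD(1)[OF A] sA] by simp
    qed
    then show ?thesis using submoduleD(2)[OF A] p by (auto simp: numeral_2_eq_2)
  qed
qed

text \<open>The word of p caps and cups kills V_{n,i} for i < p, and hence its image under the
  lowering operator, but it is nonzero on V_{n,p} outside the case l = 2, n = 2p.\<close>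

lemma lowered_proper:
  assumes "reflected n p i" "2 * p \<le> n" "2 * p < n \<or> l \<noteq> 2"
  shows "lowered n p i \<noteq> standard n p" and "f \<in> lowered n p i \<Longrightarrow> foldr tl_e (top_word (n - 2 * p) p) f = 0"
proof -
  define m where "m = n - 2 * p"
  have n: "n = m + 2 * p" using assms(2) by (simp add: m_def)
  have i: "i < p" using assms(1) by (simp add: reflected_def)
  have kill: "foldr tl_e (top_word m p) f = 0" if fl: "f \<in> lowered n p i" for f
  proof -
    obtain g where g: "g \<in> standard n i" "f = (lower n ^^ (p - i)) g" using fl unfolding lowered_def by blast
    have "foldr tl_e ws ((lower n ^^ (p - i)) g) = (lower n ^^ (p - i)) (foldr tl_e ws g)"
      if "\<And>j. j \<in> set ws \<Longrightarrow> 1 \<le> j \<and> Suc j \<le> n" for ws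
      using that by (induction ws) (simp_all add: lower_funpow_tl_e)
    then have "foldr tl_e (top_word m p) f = (lower n ^^ (p - i)) (foldr tl_e (top_word m p) g)"
      using top_word_range g(2) unfolding n by blast
    also have "foldr tl_e (top_word m p) g = 0" using g(1) i unfolding n by (rule top_word_kills)
    finally show ?thesis by (simp only: lower_funpow_linear)
  qed
  then show "f \<in> lowered n p i \<Longrightarrow> foldr tl_e (top_word (n - 2 * p) p) f = 0" by (simp add: m_def)
  have "1 \<le> m \<or> loop \<noteq> 0" using assms(3) loop_eq_0_iff by (auto simp: m_def)
  then obtain f where f: "f \<in> standard (m + 2 * p) p" "caps p m f (\<lambda>_. False) \<noteq> 0" by (rule caps_surjective)
  have "foldr tl_e (top_word m p) f \<noteq> 0"
    unfolding top_word_rank_one[OF f(1)] using f(2) cups_link_vec_ne_0[of p m] fun_vs.scale_eq_0_iff by blast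
  then show "lowered n p i \<noteq> standard n p" using kill f(1) n by blast
qed

text \<open>A proper image is irreducible by the bound on chains. If it is everything, then l = 2
  and n = 2p, where V_{n,p} itself is irreducible.\<close>

lemma lowered_irreducible:
  assumes "reflected n p i" "2 * p \<le> n" "submodule n p A" "A \<subseteq> lowered n p i"
  shows "A = {0} \<or> A = lowered n p i"
proof (cases "lowered n p i = standard n p")
  case True
  then have "\<not> (2 * p < n \<or> l \<noteq> 2)" using lowered_proper(1)[OF assms(1,2)] by blast
  then have "l = 2" "n = 2 * p" using assms(2) by auto
  then show ?thesis using irreducible_half assms(3) True by auto
next
  case False
  then show ?thesis using submodule_chain[OF assms(3) lowered_submodule[OF assms(1,2)] _ False] assms(4) by blast
qed

definition lower_kernel :: "nat \<Rightarrow> nat \<Rightarrow> nat \<Rightarrow> tensor set" where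
  "lower_kernel n p i = {f \<in> standard n i. (lower n ^^ (p - i)) f = 0}"

lemma submodule_lower_kernel: "submodule n i (lower_kernel n p i)"
  unfolding submodule_def
proof (intro conjI ballI allI impI)
  have "fun_vs.subspace {f. (lower n ^^ (p - i)) f = 0}"
    by (rule fun_vs.subspaceI) (auto simp only: mem_Collect_eq lower_funpow_linear fun_vs.scale_zero_right add_0_right)
  then have "fun_vs.subspace (standard n i \<inter> {f. (lower n ^^ (p - i)) f = 0})"
    using subspace_standard by (rule fun_vs.subspace_inter[rotated])
  moreover have "standard n i \<inter> {f. (lower n ^^ (p - i)) f = 0} = lower_kernel n p i"
    unfolding lower_kernel_def by blast
  ultimately show "fun_vs.subspace (lower_kernel n p i)" by simp
  fix f j assume f: "f \<in> lower_kernel n p i" and j: "1 \<le> j \<and> j < n"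
  then have "(lower n ^^ (p - i)) (tl_e j f) = tl_e j 0"
    using lower_funpow_tl_e[of j n "p - i" f] by (simp add: lower_kernel_def)
  moreover have "tl_e j f \<in> standard n i" using f j by (intro tl_e_standard) (auto simp: lower_kernel_def)
  ultimately show "tl_e j f \<in> lower_kernel n p i" unfolding lower_kernel_def mem_Collect_eq by (metis tl_e_zero)
qed (auto simp: lower_kernel_def)

text \<open>The image is irreducible, so a submodule above the kernel maps onto zero or onto
  everything. This identifies L_{n,i} with the image inside V_{n,p}.\<close>

lemma lower_kernel_maximal:
  assumes refl: "reflected n p i" "2 * p \<le> n"
  shows "lower_kernel n p i \<noteq> standard n i"
    and "submodule n i A \<Longrightarrow> lower_kernel n p i \<subseteq> A \<Longrightarrow> A = lower_kernel n p i \<or> A = standard n i"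
proof -
  obtain m k where mk: "n = m + 2 * i" "p = i + k" by (rule reflectedD[OF refl])
  have ne: "lowered n p i \<noteq> {0}" using lowered_contains(2)[of m i p] refl mk(1) by simp
  show "lower_kernel n p i \<noteq> standard n i"
  proof
    assume "lower_kernel n p i = standard n i"
    then have "lowered n p i \<subseteq> {0}" unfolding lowered_def lower_kernel_def by blast
    then show False using ne submoduleD(4)[OF lowered_submodule[OF refl]] by blast
  qed
  assume A: "submodule n i A" "lower_kernel n p i \<subseteq> A"
  let ?L = "lower n ^^ (p - i)"
  have "?L ` A = {0} \<or> ?L ` A = lowered n p i"
    using lowered_irreducible[OF refl submodule_lowered[OF A(1) refl]] submoduleD(2)[OF A(1)] unfolding lowered_def by blast
  then show "A = lower_kernel n p i \<or> A = standard n i"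
  proof
    assume "?L ` A = {0}"
    then have "A \<subseteq> lower_kernel n p i" using submoduleD(2)[OF A(1)] unfolding lower_kernel_def by blast
    then show ?thesis using A(2) by blast
  next
    assume eq: "?L ` A = lowered n p i"
    have "f \<in> A" if f: "f \<in> standard n i" for f
    proof -
      have "?L f \<in> ?L ` A" unfolding eq lowered_def using f by blast
      then obtain a where a: "a \<in> A" "?L f = ?L a" by blast
      have "?L f = ?L (f - a) + ?L a" using lower_funpow_linear(1)[of "p - i" n "f - a" a] by (simp only: diff_add_cancel)
      then have "?L (f - a) = 0" using a(2) by (metis add_cancel_right_left)
      moreover have "f - a \<in> standard n i" using f a(1) submoduleD(2)[OF A(1)] by (intro fun_vs.subspace_diff[OF subspace_standard]) auto
      ultimately have "f - a \<in> A" using A(2) by (auto simp: lower_kernel_def)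
      then have "f - a + a \<in> A" using a(1) by (rule fun_vs.subspace_add[OF submoduleD(1)[OF A(1)]])
      then show ?thesis by (simp only: diff_add_cancel)
    qed
    then show ?thesis using submoduleD(2)[OF A(1)] by blast
  qed
qed

end

section \<open>Traces on quotients\<close>

abbreviation coords :: "('a \<Rightarrow>\<^sub>0 complex) set \<Rightarrow> ('a \<Rightarrow>\<^sub>0 complex) \<Rightarrow> ('a \<Rightarrow>\<^sub>0 complex) \<Rightarrow> complex" where
  "coords \<equiv> free_vs.representation"

abbreviation vlinear :: "(('a \<Rightarrow>\<^sub>0 complex) \<Rightarrow> ('b \<Rightarrow>\<^sub>0 complex)) \<Rightarrow> bool" where
  "vlinear \<equiv> Vector_Spaces.linear cscale cscale"

interpretation free_pair: vector_space_pair
  "cscale :: complex \<Rightarrow> ('a \<Rightarrow>\<^sub>0 complex) \<Rightarrow> _" "cscale :: complex \<Rightarrow> ('b \<Rightarrow>\<^sub>0 complex) \<Rightarrow> _"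
  by unfold_locales

definition basis_trace :: "('a \<Rightarrow>\<^sub>0 complex) set \<Rightarrow> (('a \<Rightarrow>\<^sub>0 complex) \<Rightarrow> ('a \<Rightarrow>\<^sub>0 complex)) \<Rightarrow> complex" where
  "basis_trace B T = (\<Sum>b\<in>B. coords B (T b) b)"

lemma coords_sum:
  assumes "free_vs.independent B" "finite B" "v \<in> free_vs.span B"
  shows "(\<Sum>b\<in>B. cscale (coords B v b) b) = v"
  using free_vs.sum_representation_eq[OF assms(1,3,2) order_refl] by simp

text \<open>The identity tr(XY) = tr(YX) for the change of basis: expand the elements of one basis
  in the other, exchange the sums and recombine.\<close>

lemma basis_trace_unique:
  assumes B: "free_vs.independent B" "finite B" and B': "free_vs.independent B'" "finite B'"
    and eq: "free_vs.span B = free_vs.span B'" and T: "vlinear T" "T ` free_vs.span B \<subseteq> free_vs.span B"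
  shows "basis_trace B T = basis_trace B' T"
proof -
  have Tb: "T b \<in> free_vs.span B" if "b \<in> free_vs.span B" for b using T(2) that by blast
  have expand: "coords B' (T b') c = (\<Sum>b\<in>B. coords B b' b * coords B' (T b) c)" if b': "b' \<in> B'" for b' c
  proof -
    have bs: "b' \<in> free_vs.span B" using b' eq free_vs.span_base by blast
    have "T b' = T (\<Sum>b\<in>B. cscale (coords B b' b) b)" using coords_sum[OF B bs] by simp
    also have "\<dots> = (\<Sum>b\<in>B. cscale (coords B b' b) (T b))"
      by (simp add: free_pair.linear_sum[OF T(1)] free_pair.linear_scale[OF T(1)])
    finally have "coords B' (T b') = coords B' (\<Sum>b\<in>B. cscale (coords B b' b) (T b))" by simp
    also have "\<dots> = (\<lambda>c. \<Sum>b\<in>B. coords B' (cscale (coords B b' b) (T b)) c)"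
      using Tb free_vs.span_base eq by (intro free_vs.representation_sum[OF B'(1)] free_vs.span_scale) blast
    also have "\<dots> = (\<lambda>c. \<Sum>b\<in>B. coords B b' b * coords B' (T b) c)"
      using Tb free_vs.span_base eq by (intro ext sum.cong refl) (subst free_vs.representation_scale[OF B'(1)], auto)
    finally show ?thesis by simp
  qed
  have "basis_trace B' T = (\<Sum>b'\<in>B'. \<Sum>b\<in>B. coords B b' b * coords B' (T b) b')"
    unfolding basis_trace_def by (intro sum.cong refl) (simp add: expand)
  also have "\<dots> = (\<Sum>b\<in>B. \<Sum>b'\<in>B'. coords B' (T b) b' * coords B b' b)"
    by (subst sum.swap) (simp add: mult.commute)
  also have "\<dots> = (\<Sum>b\<in>B. coords B (T b) b)"
  proof (intro sum.cong refl)
    fix b assume b: "b \<in> B"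
    have Tb': "T b \<in> free_vs.span B'" using Tb[OF free_vs.span_base[OF b]] eq by simp
    have "coords B (T b) = coords B (\<Sum>b'\<in>B'. cscale (coords B' (T b) b') b')" using coords_sum[OF B' Tb'] by simp
    also have "\<dots> = (\<lambda>c. \<Sum>b'\<in>B'. coords B (cscale (coords B' (T b) b') b') c)"
      using free_vs.span_base eq by (intro free_vs.representation_sum[OF B(1)] free_vs.span_scale) blast
    also have "\<dots> = (\<lambda>c. \<Sum>b'\<in>B'. coords B' (T b) b' * coords B b' c)"
      using free_vs.span_base eq by (intro ext sum.cong refl) (subst free_vs.representation_scale[OF B(1)], auto)
    finally show "(\<Sum>b'\<in>B'. coords B' (T b) b' * coords B b' b) = coords B (T b) b" by simp
  qed
  finally show ?thesis by (simp add: basis_trace_def)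
qed

lemma basis_trace_split:
  assumes B: "free_vs.independent B" "finite B" and C: "C \<subseteq> B"
    and T: "T ` free_vs.span C \<subseteq> free_vs.span C"
  shows "(\<Sum>b\<in>B - C. coords B (T b) b) = basis_trace B T - basis_trace C T"
proof -
  have "coords B (T c) = coords C (T c)" if "c \<in> C" for c
    using T that free_vs.span_base by (intro free_vs.representation_extend[OF B(1) _ C]) blast
  then have "basis_trace C T = (\<Sum>b\<in>C. coords B (T b) b)"
    unfolding basis_trace_def by (intro sum.cong refl) simp
  moreover have "basis_trace B T = (\<Sum>b\<in>B - C. coords B (T b) b) + (\<Sum>b\<in>C. coords B (T b) b)"
    unfolding basis_trace_def by (rule sum.subset_diff[OF C B(2)])
  ultimately show ?thesis by simp
qed

definition finite_dim :: "('a \<Rightarrow>\<^sub>0 complex) set \<Rightarrow> bool" where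
  "finite_dim U \<longleftrightarrow> free_vs.subspace U \<and> (\<exists>F. finite F \<and> U \<subseteq> free_vs.span F)"

lemma finite_dim_independent:
  assumes "finite_dim U" "free_vs.independent B" "B \<subseteq> U" shows "finite B"
  using assms free_vs.independent_span_bound unfolding finite_dim_def by blast

lemma finite_dim_subspace: "finite_dim U \<Longrightarrow> free_vs.subspace W \<Longrightarrow> W \<subseteq> U \<Longrightarrow> finite_dim W"
  unfolding finite_dim_def by blast

lemma basis_pair_exists:
  assumes U: "finite_dim U" and W: "free_vs.subspace W" "W \<subseteq> U"
  obtains B C where "free_vs.independent B" "free_vs.span B = U" "C \<subseteq> B" "free_vs.span C = W" "finite B"
proof -
  obtain C where C: "C \<subseteq> W" "free_vs.independent C" "W \<subseteq> free_vs.span C"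
    using free_vs.maximal_independent_subset[of W] by blast
  obtain B where B: "C \<subseteq> B" "B \<subseteq> U" "free_vs.independent B" "U \<subseteq> free_vs.span B"
    using free_vs.maximal_independent_subset_extend[of C U] C W by blast
  have sU: "free_vs.subspace U" using U by (simp add: finite_dim_def)
  show ?thesis
  proof (rule that[OF B(3) _ B(1)])
    show "free_vs.span B = U" using free_vs.span_minimal[OF B(2) sU] B(4) by blast
    show "free_vs.span C = W" using free_vs.span_minimal[OF C(1) W(1)] C(3) by blast
    show "finite B" by (rule finite_dim_independent[OF U B(3,2)])
  qed
qed

text \<open>Uniqueness of the described value: it is the trace on U minus the trace on W, and
  neither depends on the basis.\<close>

lemma quotient_trace_eq:
  assumes U: "finite_dim U" and T: "vlinear T" "T ` U \<subseteq> U" "T ` W \<subseteq> W"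
    and B: "free_vs.independent B" "free_vs.span B = U" "C \<subseteq> B" "free_vs.span C = W"
  shows "quotient_trace U W T = (\<Sum>b\<in>B - C. coords B (T b) b)"
  unfolding quotient_trace_def
proof (rule the_equality)
  show "\<exists>B' C'. free_vs.independent B' \<and> free_vs.span B' = U \<and> C' \<subseteq> B' \<and> free_vs.span C' = W \<and>
      (\<Sum>b\<in>B - C. coords B (T b) b) = (\<Sum>b\<in>B' - C'. coords B' (T b) b)"
    using B by blast
  fix t assume "\<exists>B C. free_vs.independent B \<and> free_vs.span B = U \<and> C \<subseteq> B \<and> free_vs.span C = W \<and>
        t = (\<Sum>b\<in>B - C. coords B (T b) b)"
  then obtain B' C' where B': "free_vs.independent B'" "free_vs.span B' = U" "C' \<subseteq> B'" "free_vs.span C' = W"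
    "t = (\<Sum>b\<in>B' - C'. coords B' (T b) b)" by blast
  have fin: "finite B" "finite B'"
    using finite_dim_independent[OF U] B(1,2) B'(1,2) free_vs.span_superset by metis+
  have finC: "finite C" "finite C'" using fin B(3) B'(3) finite_subset by blast+
  have indC: "free_vs.independent C" "free_vs.independent C'"
    using B(1,3) B'(1,3) free_vs.independent_mono by blast+
  have "basis_trace B T = basis_trace B' T"
    using B B' T by (intro basis_trace_unique fin) auto
  moreover have "basis_trace C T = basis_trace C' T"
    using B B' T by (intro basis_trace_unique finC indC) auto
  moreover have "(\<Sum>b\<in>B - C. coords B (T b) b) = basis_trace B T - basis_trace C T"
    using T B by (intro basis_trace_split fin) auto
  moreover have "t = basis_trace B' T - basis_trace C' T"
    unfolding B'(5) using T B' by (intro basis_trace_split fin) auto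
  ultimately show "t = (\<Sum>b\<in>B - C. coords B (T b) b)" by simp
qed

lemma quotient_trace_basis:
  assumes "finite_dim U" "vlinear T" "T ` U \<subseteq> U" "free_vs.independent B" "free_vs.span B = U"
  shows "quotient_trace U {0} T = basis_trace B T"
proof -
  have "T ` {0} \<subseteq> {0}" using free_pair.linear_0[OF assms(2)] by simp
  then show ?thesis
    using quotient_trace_eq[of U T "{0}" B "{}"] assms unfolding basis_trace_def by simp
qed

lemma quotient_trace_add:
  assumes U: "finite_dim U" and W: "free_vs.subspace W" "W \<subseteq> U"
    and T: "vlinear T" "T ` U \<subseteq> U" "T ` W \<subseteq> W"
  shows "quotient_trace U {0} T = quotient_trace U W T + quotient_trace W {0} T"
proof -
  obtain B C where B: "free_vs.independent B" "free_vs.span B = U" "C \<subseteq> B" "free_vs.span C = W" "finite B"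
    by (rule basis_pair_exists[OF U W])
  have C: "free_vs.independent C" using B(1,3) free_vs.independent_mono by blast
  have "quotient_trace U W T = basis_trace B T - basis_trace C T"
    unfolding quotient_trace_eq[OF U T B(1-4)] using B T by (intro basis_trace_split) auto
  moreover have "quotient_trace U {0} T = basis_trace B T" by (rule quotient_trace_basis[OF U T(1,2) B(1,2)])
  moreover have "quotient_trace W {0} T = basis_trace C T"
    by (rule quotient_trace_basis[OF finite_dim_subspace[OF U W] T(1,3) C B(4)])
  ultimately show ?thesis by simp
qed

lemma quotient_trace_vanishing:
  assumes U: "finite_dim U" and W: "free_vs.subspace W" "W \<subseteq> U" and T: "vlinear T" "\<And>u. u \<in> U \<Longrightarrow> T u = 0"
  shows "quotient_trace U W T = 0"
proof -
  obtain B C where B: "free_vs.independent B" "free_vs.span B = U" "C \<subseteq> B" "free_vs.span C = W" "finite B"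
    by (rule basis_pair_exists[OF U W])
  have sub: "T ` U \<subseteq> U" "T ` W \<subseteq> W"
    using T(2) W free_vs.subspace_0[OF W(1)] by auto
  have "T b = 0" if "b \<in> B" for b using T(2) B(2) free_vs.span_base[OF that] by blast
  then show ?thesis
    unfolding quotient_trace_eq[OF U T(1) sub B(1-4)] by (simp add: free_vs.representation_zero)
qed

text \<open>A linear map intertwining \<open>T\<close> and \<open>T'\<close> identifies the quotient by its kernel with its image.\<close>

lemma quotient_trace_hom:
  assumes U: "finite_dim U" and T: "vlinear T" "T ` U \<subseteq> U" and T': "vlinear T'" and h: "vlinear h"
    and inter: "\<And>u. u \<in> U \<Longrightarrow> h (T u) = T' (h u)"
  shows "quotient_trace U {u \<in> U. h u = 0} T = quotient_trace (h ` U) {0} T'"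
proof -
  let ?K = "{u \<in> U. h u = 0}"
  have sU: "free_vs.subspace U" using U by (simp add: finite_dim_def)
  have K: "free_vs.subspace ?K"
  proof (rule free_vs.subspaceI)
    show "0 \<in> ?K" using free_vs.subspace_0[OF sU] free_pair.linear_0[OF h] by simp
  qed (auto simp: free_pair.linear_add[OF h] free_pair.linear_scale[OF h] intro: free_vs.subspace_add[OF sU] free_vs.subspace_scale[OF sU])
  have TK: "T ` ?K \<subseteq> ?K" using inter T(2) free_pair.linear_0[OF T'] by auto
  obtain B C where B: "free_vs.independent B" "free_vs.span B = U" "C \<subseteq> B" "free_vs.span C = ?K" "finite B"
    by (rule basis_pair_exists[OF U K]) auto
  let ?D = "B - C"
  have h_exp: "h v = (\<Sum>b\<in>?D. cscale (coords B v b) (h b))" if v: "v \<in> U" for v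
  proof -
    have "h v = h (\<Sum>b\<in>B. cscale (coords B v b) b)" using coords_sum[OF B(1,5)] v B(2) by simp
    also have "\<dots> = (\<Sum>b\<in>B. cscale (coords B v b) (h b))"
      by (simp add: free_pair.linear_sum[OF h] free_pair.linear_scale[OF h])
    also have "\<dots> = (\<Sum>b\<in>?D. cscale (coords B v b) (h b))"
    proof (rule sum.mono_neutral_right[OF B(5)])
      show "\<forall>b\<in>B - ?D. cscale (coords B v b) (h b) = 0"
      proof
        fix b assume "b \<in> B - ?D"
        then have "b \<in> free_vs.span C" using free_vs.span_base by blast
        then show "cscale (coords B v b) (h b) = 0" using B(4) free_vs.scale_zero_right by auto
      qed
    qed auto
    finally show ?thesis .
  qed
  have indep: "c b = 0" if sum0: "(\<Sum>b\<in>?D. cscale (c b) (h b)) = 0" and b: "b \<in> ?D" for c b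
  proof -
    let ?v = "\<Sum>b\<in>?D. cscale (c b) b"
    have vU: "?v \<in> U" using B(2) free_vs.span_base by (intro free_vs.subspace_sum[OF sU] free_vs.subspace_scale[OF sU]) blast
    have "h ?v = 0" using sum0 by (simp add: free_pair.linear_sum[OF h] free_pair.linear_scale[OF h])
    then have vC: "?v \<in> free_vs.span C" using vU B(4) by blast
    have "coords B ?v = coords C ?v" by (rule free_vs.representation_extend[OF B(1) vC B(3)])
    then have "coords B ?v b = 0" using b free_vs.representation_ne_zero[of C ?v b] by auto
    moreover have "coords B ?v b = (\<Sum>b'\<in>?D. coords B (cscale (c b') b') b)"
      using free_vs.span_base by (subst free_vs.representation_sum[OF B(1)]) (auto intro: free_vs.span_scale)
    moreover have "(\<Sum>b'\<in>?D. coords B (cscale (c b') b') b) = (\<Sum>b'\<in>?D. if b' = b then c b else 0)"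
    proof (intro sum.cong refl)
      fix b' assume "b' \<in> ?D"
      then have b'B: "b' \<in> B" by simp
      show "coords B (cscale (c b') b') b = (if b' = b then c b else 0)"
        unfolding free_vs.representation_scale[OF B(1) free_vs.span_base[OF b'B]] free_vs.representation_basis[OF B(1) b'B]
        by auto
    qed
    ultimately show "c b = 0" using b B(5) by simp
  qed
  have inj: "inj_on h ?D"
  proof (rule inj_onI, rule ccontr)
    fix b b' assume bb: "b \<in> ?D" "b' \<in> ?D" "h b = h b'" "b \<noteq> b'"
    let ?c = "\<lambda>x. if x = b then 1 else if x = b' then - 1 else 0 :: complex"
    have "(\<Sum>x\<in>?D. cscale (?c x) (h x)) = (\<Sum>x\<in>{b, b'}. cscale (?c x) (h x))"
      using bb B(5) by (intro sum.mono_neutral_right) (auto simp: free_vs.scale_zero_left)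
    also have "\<dots> = cscale 1 (h b) + cscale (- 1) (h b)" using bb by simp
    also have "\<dots> = 0" by (simp add: free_vs.scale_minus_left)
    finally have "?c b = 0" by (rule indep) (rule bb)
    then show False by simp
  qed
  have D': "free_vs.independent (h ` ?D)"
  proof (rule free_vs.independent_if_scalars_zero)
    show "finite (h ` ?D)" using B(5) by simp
    fix f x assume s: "(\<Sum>x\<in>h ` ?D. cscale (f x) x) = 0" and x: "x \<in> h ` ?D"
    then obtain b where b: "b \<in> ?D" "x = h b" by blast
    have "(\<Sum>b\<in>?D. cscale (f (h b)) (h b)) = 0" using s unfolding sum.reindex[OF inj] o_def .
    then show "f x = 0" using indep[of "\<lambda>b. f (h b)" b] b by simp
  qed
  have span: "free_vs.span (h ` ?D) = h ` U"
  proof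
    have "h ` ?D \<subseteq> h ` U" using B(2) free_vs.span_base by blast
    then show "free_vs.span (h ` ?D) \<subseteq> h ` U"
      by (intro free_vs.span_minimal free_pair.linear_subspace_image[OF h sU])
    show "h ` U \<subseteq> free_vs.span (h ` ?D)"
    proof
      fix w assume "w \<in> h ` U"
      then obtain v where "v \<in> U" "w = h v" by blast
      then show "w \<in> free_vs.span (h ` ?D)"
        by (auto simp: h_exp intro!: free_vs.span_sum free_vs.span_scale intro: free_vs.span_base)
    qed
  qed
  have hU: "finite_dim (h ` U)"
    unfolding finite_dim_def using free_pair.linear_subspace_image[OF h sU] span B(5) by (metis finite_Diff finite_imageI order_refl)
  have T'U: "T' ` (h ` U) \<subseteq> h ` U" using inter T(2) by force
  have "coords (h ` ?D) (T' (h b)) (h b) = coords B (T b) b" if b: "b \<in> ?D" for b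
  proof -
    have bU: "b \<in> U" using b B(2) free_vs.span_base by blast
    have TbU: "T b \<in> U" using bU T(2) by blast
    have "T' (h b) = (\<Sum>b'\<in>?D. cscale (coords B (T b) b') (h b'))" using inter[OF bU] h_exp[OF TbU] by simp
    moreover have "cscale (coords B (T b) b') (h b') \<in> free_vs.span (h ` ?D)" if "b' \<in> ?D" for b'
      by (rule free_vs.span_scale[OF free_vs.span_base[OF imageI[OF that]]])
    ultimately have "coords (h ` ?D) (T' (h b)) (h b) = (\<Sum>b'\<in>?D. coords (h ` ?D) (cscale (coords B (T b) b') (h b')) (h b))"
      by (simp only: free_vs.representation_sum[OF D'])
    also have "\<dots> = (\<Sum>b'\<in>?D. if b' = b then coords B (T b) b else 0)"
    proof (intro sum.cong refl)
      fix b' assume b': "b' \<in> ?D"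
      then have "h b' \<in> h ` ?D" by simp
      then show "coords (h ` ?D) (cscale (coords B (T b) b') (h b')) (h b) = (if b' = b then coords B (T b) b else 0)"
        unfolding free_vs.representation_scale[OF D' free_vs.span_base[OF \<open>h b' \<in> h ` ?D\<close>]] free_vs.representation_basis[OF D' \<open>h b' \<in> h ` ?D\<close>]
        using inj b b' by (auto simp: inj_on_def)
    qed
    finally show ?thesis using b B(5) by simp
  qed
  then have "basis_trace (h ` ?D) T' = (\<Sum>b\<in>?D. coords B (T b) b)"
    unfolding basis_trace_def by (simp add: sum.reindex[OF inj])
  then show ?thesis
    unfolding quotient_trace_basis[OF hU T' T'U D' span] quotient_trace_eq[OF U T TK B(1-4)] by simp
qed

section \<open>The action of the Temperley-Lieb algebra\<close>

lemma ring_free_algebra: "ring (free_algebra G)"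
proof (rule ringI)
  show "abelian_group (free_algebra G)"
  proof (rule abelian_groupI)
    show "x \<oplus>\<^bsub>free_algebra G\<^esub> y \<in> carrier (free_algebra G)"
      if "x \<in> carrier (free_algebra G)" "y \<in> carrier (free_algebra G)" for x y
      using that Poly_Mapping.keys_add[of x y] unfolding free_algebra_def by auto
    show "\<exists>y\<in>carrier (free_algebra G). y \<oplus>\<^bsub>free_algebra G\<^esub> x = \<zero>\<^bsub>free_algebra G\<^esub>"
      if "x \<in> carrier (free_algebra G)" for x
      using that by (intro bexI[of _ "- x"]) (simp_all add: free_algebra_def)
  qed (simp_all add: free_algebra_def add_ac)
  show "monoid (free_algebra G)"
  proof (rule monoidI)
    show "x \<otimes>\<^bsub>free_algebra G\<^esub> y \<in> carrier (free_algebra G)"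
      if "x \<in> carrier (free_algebra G)" "y \<in> carrier (free_algebra G)" for x y
    proof -
      have "set (letters u) \<subseteq> G" if u: "u \<in> Poly_Mapping.keys (x * y)" for u
      proof -
        obtain a b where "u = a + b" "a \<in> Poly_Mapping.keys x" "b \<in> Poly_Mapping.keys y"
          using keys_mult[of x y] u by blast
        then show ?thesis
          using \<open>x \<in> carrier _\<close> \<open>y \<in> carrier _\<close> by (simp add: free_algebra_def plus_word_def)
      qed
      then show ?thesis by (simp add: free_algebra_def)
    qed
  qed (simp_all add: free_algebra_def mult.assoc zero_word_def)
qed (simp_all add: free_algebra_def algebra_simps)

lemma free_algebra_ops:
  "x \<oplus>\<^bsub>free_algebra G\<^esub> y = x + y" "x \<otimes>\<^bsub>free_algebra G\<^esub> y = x * y"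
  "\<zero>\<^bsub>free_algebra G\<^esub> = 0" "\<one>\<^bsub>free_algebra G\<^esub> = 1"
  by (simp_all add: free_algebra_def)

lemma letters_plus: "letters (u + v) = letters u @ letters v"
  by (simp add: plus_word_def)

lemma poly_mapping_as_sum:
  "(\<Sum>u\<in>Poly_Mapping.keys a. Poly_Mapping.single u (Poly_Mapping.lookup a u)) = (a :: 'a \<Rightarrow>\<^sub>0 complex)"
proof (rule poly_mapping_eqI)
  fix x
  show "Poly_Mapping.lookup (\<Sum>u\<in>Poly_Mapping.keys a. Poly_Mapping.single u (Poly_Mapping.lookup a u)) x = Poly_Mapping.lookup a x"
    by (simp add: lookup_sum lookup_single when_def in_keys_iff)
qed

lemma cscale_single: "cscale c (Poly_Mapping.single u d) = Poly_Mapping.single u (c * d)"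
  by (rule poly_mapping_eqI) (simp add: lookup_cscale lookup_single when_def)

lemma vlinearI:
  assumes "\<And>u v. T (u + v) = T u + T v" "\<And>c v. T (cscale c v) = cscale c (T v)"
  shows "vlinear T"
  by unfold_locales (use assms in auto)

lemma vlinear_gen_op: "vlinear (gen_op \<delta> n p i)"
  by (rule vlinearI)
    (simp_all add: gen_op_def Poly_Mapping.lookup_add lookup_cscale free_vs.scale_left_distrib sum.distrib free_vs.scale_sum_right)

lemma vlinear_foldr_gen_op: "vlinear (foldr (gen_op \<delta> n p) ws)"
proof (induction ws)
  case Nil
  show ?case by (rule vlinearI) simp_all
next
  case (Cons i ws)
  show ?case
    by (rule vlinearI) (simp_all add: free_pair.linear_add[OF Cons] free_pair.linear_add[OF vlinear_gen_op]
      free_pair.linear_scale[OF Cons] free_pair.linear_scale[OF vlinear_gen_op])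
qed

lemma free_op_superset:
  assumes "finite A" "Poly_Mapping.keys a \<subseteq> A"
  shows "free_op \<delta> n p a v = (\<Sum>u\<in>A. cscale (Poly_Mapping.lookup a u) (foldr (gen_op \<delta> n p) (letters u) v))"
  unfolding free_op_def
  by (rule sum.mono_neutral_left[OF assms]) (auto simp: in_keys_iff)

lemma free_op_add: "free_op \<delta> n p (a + b) v = free_op \<delta> n p a v + free_op \<delta> n p b v"
proof -
  let ?A = "Poly_Mapping.keys a \<union> Poly_Mapping.keys b"
  show ?thesis
    using free_op_superset[of ?A "a + b"] free_op_superset[of ?A a] free_op_superset[of ?A b] Poly_Mapping.keys_add[of a b]
    by (simp add: Poly_Mapping.lookup_add free_vs.scale_left_distrib sum.distrib)
qed

lemma free_op_cscale: "free_op \<delta> n p (cscale c a) v = cscale c (free_op \<delta> n p a v)"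
proof -
  have "Poly_Mapping.keys (cscale c a) \<subseteq> Poly_Mapping.keys a" by (auto simp: in_keys_iff lookup_cscale)
  then show ?thesis
    using free_op_superset[of "Poly_Mapping.keys a" "cscale c a"] free_op_superset[of "Poly_Mapping.keys a" a]
    by (simp add: lookup_cscale free_vs.scale_sum_right)
qed

lemma free_op_0: "free_op \<delta> n p 0 v = 0"
  by (simp add: free_op_def)

lemma free_op_diff: "free_op \<delta> n p (a - b) v = free_op \<delta> n p a v - free_op \<delta> n p b v"
  using free_op_add[of \<delta> n p "a - b" b v] by (simp add: algebra_simps)

lemma free_op_single: "free_op \<delta> n p (Poly_Mapping.single u c) v = cscale c (foldr (gen_op \<delta> n p) (letters u) v)"
  using free_op_superset[of "{u}" "Poly_Mapping.single u c"] by simp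

lemma free_op_gen: "free_op \<delta> n p (gen i) v = gen_op \<delta> n p i v"
  by (simp add: gen_def free_op_single)

lemma vlinear_free_op: "vlinear (free_op \<delta> n p a)"
  by (rule vlinearI)
    (simp_all add: free_op_def free_pair.linear_add[OF vlinear_foldr_gen_op] free_pair.linear_scale[OF vlinear_foldr_gen_op]
      free_vs.scale_right_distrib sum.distrib free_vs.scale_sum_right mult.commute)

lemma free_op_sum: "finite A \<Longrightarrow> free_op \<delta> n p (\<Sum>i\<in>A. f i) v = (\<Sum>i\<in>A. free_op \<delta> n p (f i) v)"
  by (induction A rule: finite_induct) (simp_all add: free_op_0 free_op_add)

lemma free_op_mult: "free_op \<delta> n p (a * b) v = free_op \<delta> n p a (free_op \<delta> n p b v)"
proof -
  have 1: "free_op \<delta> n p (Poly_Mapping.single u c * Poly_Mapping.single w d) v =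
      free_op \<delta> n p (Poly_Mapping.single u c) (free_op \<delta> n p (Poly_Mapping.single w d) v)" for u c w d
    by (simp add: mult_single free_op_single letters_plus free_pair.linear_scale[OF vlinear_foldr_gen_op])
  have 2: "free_op \<delta> n p (Poly_Mapping.single u c * b) v = free_op \<delta> n p (Poly_Mapping.single u c) (free_op \<delta> n p b v)" for u c
  proof -
    have "free_op \<delta> n p (Poly_Mapping.single u c * (\<Sum>w\<in>Poly_Mapping.keys b. Poly_Mapping.single w (Poly_Mapping.lookup b w))) v =
      free_op \<delta> n p (Poly_Mapping.single u c) (free_op \<delta> n p (\<Sum>w\<in>Poly_Mapping.keys b. Poly_Mapping.single w (Poly_Mapping.lookup b w)) v)"
      by (simp add: sum_distrib_left free_op_sum 1 free_pair.linear_sum[OF vlinear_free_op])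
    then show ?thesis by (simp only: poly_mapping_as_sum)
  qed
  have "free_op \<delta> n p ((\<Sum>u\<in>Poly_Mapping.keys a. Poly_Mapping.single u (Poly_Mapping.lookup a u)) * b) v =
      free_op \<delta> n p (\<Sum>u\<in>Poly_Mapping.keys a. Poly_Mapping.single u (Poly_Mapping.lookup a u)) (free_op \<delta> n p b v)"
    by (simp add: sum_distrib_right free_op_sum 2)
  then show ?thesis by (simp only: poly_mapping_as_sum)
qed

lemma subspace_std_module: "free_vs.subspace (std_module n p)"
proof (rule free_vs.subspaceI)
  fix u v assume "u \<in> std_module n p" "v \<in> std_module n p"
  then show "u + v \<in> std_module n p" using Poly_Mapping.keys_add[of u v] by (auto simp: std_module_def)
next
  fix c v assume "v \<in> std_module n p"
  moreover have "Poly_Mapping.keys (cscale c v) \<subseteq> Poly_Mapping.keys v" by (auto simp: in_keys_iff lookup_cscale)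
  ultimately show "cscale c v \<in> std_module n p" by (auto simp: std_module_def)
qed (simp add: std_module_def)

lemma single_std_module: "w \<in> link_states n p \<Longrightarrow> Poly_Mapping.single w c \<in> std_module n p"
  by (simp add: std_module_def)

lemma finite_dim_std_module: "finite_dim (std_module n p)"
  unfolding finite_dim_def
proof (intro conjI exI subspace_std_module)
  let ?F = "(\<lambda>w. Poly_Mapping.single w (1 :: complex)) ` link_states n p"
  show "finite ?F" using finite_link_states by simp
  show "std_module n p \<subseteq> free_vs.span ?F"
  proof
    fix v assume v: "v \<in> std_module n p"
    have "v = (\<Sum>w\<in>Poly_Mapping.keys v. cscale (Poly_Mapping.lookup v w) (Poly_Mapping.single w 1))"
      using poly_mapping_as_sum[of v] by (simp add: cscale_single)
    also have "\<dots> \<in> free_vs.span ?F"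
      using v by (intro free_vs.span_sum free_vs.span_scale free_vs.span_base) (auto simp: std_module_def)
    finally show "v \<in> free_vs.span ?F" .
  qed
qed

lemma std_trace_eq:
  assumes T: "tl_op \<delta> n p X = T" "vlinear T" "T ` std_module n p \<subseteq> std_module n p"
  shows "std_trace \<delta> n p X = quotient_trace (std_module n p) {0} T"
proof -
  let ?s = "\<lambda>w. Poly_Mapping.single w (1 :: complex)"
  let ?B = "?s ` link_states n p"
  have inj: "inj_on ?s (link_states n p)" by (rule inj_onI) (metis lookup_single_eq lookup_single_not_eq zero_neq_one)
  have exp: "v = (\<Sum>w\<in>link_states n p. cscale (Poly_Mapping.lookup v w) (?s w))" if v: "v \<in> std_module n p" for v
  proof -
    have "v = (\<Sum>w\<in>Poly_Mapping.keys v. cscale (Poly_Mapping.lookup v w) (?s w))"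
      using poly_mapping_as_sum[of v] by (simp add: cscale_single)
    also have "\<dots> = (\<Sum>w\<in>link_states n p. cscale (Poly_Mapping.lookup v w) (?s w))"
      using v by (intro sum.mono_neutral_left finite_link_states) (auto simp: std_module_def in_keys_iff)
    finally show ?thesis .
  qed
  have ind: "free_vs.independent ?B"
  proof (rule free_vs.independent_if_scalars_zero)
    fix f x assume s: "(\<Sum>x\<in>?B. cscale (f x) x) = 0" and x: "x \<in> ?B"
    then obtain w where w: "w \<in> link_states n p" "x = ?s w" by blast
    have "(\<Sum>w\<in>link_states n p. cscale (f (?s w)) (?s w)) = 0"
      using s unfolding sum.reindex[OF inj] o_def .
    then have "Poly_Mapping.lookup (\<Sum>w\<in>link_states n p. cscale (f (?s w)) (?s w)) w = 0" by simp
    then have "(\<Sum>v\<in>link_states n p. if v = w then f (?s v) else 0) = 0"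
      by (simp add: lookup_sum lookup_cscale lookup_single when_def if_distrib cong: if_cong)
    then show "f x = 0" using w finite_link_states by simp
  qed (simp add: finite_link_states)
  have span: "free_vs.span ?B = std_module n p"
  proof
    show "free_vs.span ?B \<subseteq> std_module n p"
      by (intro free_vs.span_minimal subspace_std_module) (auto intro: single_std_module)
    show "std_module n p \<subseteq> free_vs.span ?B"
    proof
      fix v assume v: "v \<in> std_module n p"
      show "v \<in> free_vs.span ?B"
        by (subst exp[OF v]) (intro free_vs.span_sum free_vs.span_scale free_vs.span_base, auto)
    qed
  qed
  have coord: "coords ?B v (?s w) = Poly_Mapping.lookup v w" if v: "v \<in> std_module n p" and w: "w \<in> link_states n p" for v w
  proof -
    have sp: "cscale (Poly_Mapping.lookup v u) (?s u) \<in> free_vs.span ?B" if "u \<in> link_states n p" for u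
      by (rule free_vs.span_scale[OF free_vs.span_base[OF imageI[OF that]]])
    have "coords ?B v (?s w) = coords ?B (\<Sum>u\<in>link_states n p. cscale (Poly_Mapping.lookup v u) (?s u)) (?s w)"
      using exp[OF v] by simp
    also have "\<dots> = (\<Sum>u\<in>link_states n p. coords ?B (cscale (Poly_Mapping.lookup v u) (?s u)) (?s w))"
      by (simp only: free_vs.representation_sum[OF ind sp])
    also have "\<dots> = (\<Sum>u\<in>link_states n p. if u = w then Poly_Mapping.lookup v w else 0)"
    proof (intro sum.cong refl)
      fix u assume u: "u \<in> link_states n p"
      have uB: "?s u \<in> ?B" using u by blast
      show "coords ?B (cscale (Poly_Mapping.lookup v u) (?s u)) (?s w) = (if u = w then Poly_Mapping.lookup v w else 0)"
        unfolding free_vs.representation_scale[OF ind free_vs.span_base[OF uB]] free_vs.representation_basis[OF ind uB]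
        using inj u w by (auto simp: inj_on_def)
    qed
    finally show ?thesis using w finite_link_states by simp
  qed
  have "std_trace \<delta> n p X = (\<Sum>w\<in>link_states n p. coords ?B (T (?s w)) (?s w))"
    unfolding std_trace_def T(1) using T(3) single_std_module by (intro sum.cong refl) (subst coord, auto)
  also have "\<dots> = basis_trace ?B T" unfolding basis_trace_def by (simp add: sum.reindex[OF inj])
  finally show ?thesis using quotient_trace_basis[OF finite_dim_std_module T(2,3) ind span] by simp
qed

section \<open>Transfer between link coordinates and tensors\<close>

context nonzero_parameter
begin

definition iota :: "nat \<Rightarrow> nat \<Rightarrow> (link \<Rightarrow>\<^sub>0 complex) \<Rightarrow> tensor" where
  "iota n p v = link_comb n p (Poly_Mapping.lookup v)"

lemma iota_add: "iota n p (u + v) = iota n p u + iota n p v"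
  by (rule ext) (simp add: iota_def link_comb_def Poly_Mapping.lookup_add algebra_simps sum.distrib)

lemma iota_scale: "iota n p (cscale c v) = fscale c (iota n p v)"
  by (rule ext) (simp add: iota_def link_comb_def lookup_cscale sum_distrib_left mult.assoc)

lemma iota_0: "iota n p 0 = 0"
  by (rule ext) (simp add: iota_def link_comb_def)

lemma iota_diff: "iota n p (u - v) = iota n p u - iota n p v"
  by (rule ext) (simp add: iota_def link_comb_def Poly_Mapping.lookup_minus algebra_simps sum_subtractf)

lemma iota_sum: "finite A \<Longrightarrow> iota n p (\<Sum>i\<in>A. f i) S = (\<Sum>i\<in>A. iota n p (f i) S)"
  by (induction A rule: finite_induct) (simp_all add: iota_0 iota_add)

lemma iota_standard: "iota n p v \<in> standard n p"
  unfolding iota_def by (rule link_comb_in_standard)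

lemma iota_single: "w \<in> link_states n p \<Longrightarrow> iota n p (Poly_Mapping.single w c) = fscale c (link_vec n w)"
proof (rule ext)
  fix S assume w: "w \<in> link_states n p"
  have "iota n p (Poly_Mapping.single w c) S = (\<Sum>v\<in>link_states n p. if v = w then c * link_vec n w S else 0)"
    unfolding iota_def link_comb_def by (intro sum.cong refl) (auto simp: lookup_single when_def)
  then show "iota n p (Poly_Mapping.single w c) S = fscale c (link_vec n w) S" using w finite_link_states by simp
qed

lemma iota_eq_0: assumes "v \<in> std_module n p" "iota n p v = 0" shows "v = 0"
proof (rule poly_mapping_eqI)
  fix w
  show "Poly_Mapping.lookup v w = Poly_Mapping.lookup 0 w"
    using link_comb_independent[of n p "Poly_Mapping.lookup v"] assms
    unfolding iota_def std_module_def by (auto simp: in_keys_iff)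
qed

lemma iota_inject: "u \<in> std_module n p \<Longrightarrow> v \<in> std_module n p \<Longrightarrow> iota n p u = iota n p v \<Longrightarrow> u = v"
  using iota_eq_0[of "u - v" n p] free_vs.subspace_diff[OF subspace_std_module] by (simp add: iota_diff)

lemma iota_surj: assumes "f \<in> standard n p" obtains v where "v \<in> std_module n p" "iota n p v = f"
proof -
  obtain a where a: "f = link_comb n p a" using assms standard_eq by blast
  let ?v = "\<Sum>w\<in>link_states n p. Poly_Mapping.single w (a w)"
  have "?v \<in> std_module n p" by (intro free_vs.subspace_sum subspace_std_module single_std_module)
  moreover have "iota n p ?v = f"
    by (rule ext) (simp add: iota_sum finite_link_states iota_single a link_comb_def)
  ultimately show ?thesis by (rule that)
qed

lemma link_act_std_module:
  assumes "w \<in> link_states n p" "1 \<le> i" "Suc i \<le> n" shows "link_act \<delta> i w \<in> std_module n p"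
  using assms link_join_in_link_states[OF assms] unfolding link_act_def
  by (auto intro: single_std_module free_vs.subspace_0[OF subspace_std_module])

lemma iota_link_act:
  assumes "w \<in> link_states n p" "1 \<le> i" "Suc i \<le> n" shows "iota n p (link_act loop i w) = tl_e i (link_vec n w)"
  unfolding link_vec_equivariant[OF assms] link_act_def
  using assms(1) link_join_in_link_states[OF assms] iota_single[of "link_join i w" n p 1] fun_vs.scale_one[of "link_vec n (link_join i w)"]
  by (auto simp: iota_single iota_0 simp del: fscale_apply)

lemma gen_op_std_module:
  assumes "1 \<le> i" "Suc i \<le> n" shows "gen_op \<delta> n p i v \<in> std_module n p"
  unfolding gen_op_def
  using assms by (intro free_vs.subspace_sum free_vs.subspace_scale subspace_std_module link_act_std_module)

lemma iota_gen_op: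
  assumes "1 \<le> i" "Suc i \<le> n" shows "iota n p (gen_op loop n p i v) = tl_e i (iota n p v)"
proof (rule ext)
  fix S
  have "iota n p (gen_op loop n p i v) S = (\<Sum>w\<in>link_states n p. Poly_Mapping.lookup v w * tl_e i (link_vec n w) S)"
    using assms by (simp add: gen_op_def iota_sum finite_link_states iota_scale iota_link_act)
  also have "\<dots> = tl_e i (iota n p v) S"
    by (simp add: iota_def link_comb_eq_sum tl_e_sum finite_link_states tl_e_scale sum_fun_apply)
  finally show "iota n p (gen_op loop n p i v) S = tl_e i (iota n p v) S" .
qed

text \<open>The relations are not checked on link states: they hold for the tensor operators, and
  the embedding \<open>iota\<close> is injective and equivariant.\<close>

lemma free_op_tl_relator:
  assumes "r \<in> tl_relators loop {1..<n}" shows "free_op loop n p r v = 0"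
proof -
  let ?g = "gen_op loop n p"
  have sq: "?g i (?g i v) = cscale loop (?g i v)" if "i \<in> {1..<n}" for i
    by (rule iota_inject[where n = n and p = p]) (use that in \<open>auto simp: gen_op_std_module iota_gen_op iota_scale tl_e_square
      intro: free_vs.subspace_scale[OF subspace_std_module]\<close>)
  have br: "?g i (?g j (?g i v)) = ?g i v" if "i \<in> {1..<n}" "j \<in> {1..<n}" "j = i + 1 \<or> i = j + 1" for i j
    by (rule iota_inject[where n = n and p = p]) (use that in \<open>auto simp: gen_op_std_module iota_gen_op tl_e_braid1 tl_e_braid2\<close>)
  have cm: "?g i (?g j v) = ?g j (?g i v)" if "i \<in> {1..<n}" "j \<in> {1..<n}" "i + 1 < j \<or> j + 1 < i" for i j
  proof (rule iota_inject[where n = n and p = p])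
    show "iota n p (?g i (?g j v)) = iota n p (?g j (?g i v))"
      using that tl_e_commute[of i j "iota n p v"] tl_e_commute[of j i "iota n p v"] by (auto simp: iota_gen_op)
  qed (use that in \<open>auto simp: gen_op_std_module\<close>)
  show ?thesis
    using assms unfolding tl_relators_def
    by (auto simp: free_op_diff free_op_mult free_op_gen free_op_cscale sq br cm)
qed

lemma carrier_free_algebra_gen: "i \<in> G \<Longrightarrow> gen i \<in> carrier (free_algebra G)"
  by (simp add: gen_def free_algebra_def)

lemma tl_relators_carrier: "tl_relators \<delta> G \<subseteq> carrier (free_algebra G)"
proof -
  interpret ring "free_algebra G" by (rule ring_free_algebra)
  have m: "a * b \<in> carrier (free_algebra G)" if "a \<in> carrier (free_algebra G)" "b \<in> carrier (free_algebra G)" for a b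
    using m_closed[OF that] by (simp add: free_algebra_def)
  have d: "a - b \<in> carrier (free_algebra G)" if "a \<in> carrier (free_algebra G)" "b \<in> carrier (free_algebra G)" for a b
  proof -
    have "- b \<in> carrier (free_algebra G)" using that(2) by (simp add: free_algebra_def)
    from a_closed[OF that(1) this] show ?thesis by (simp add: free_algebra_ops)
  qed
  have c: "cscale x a \<in> carrier (free_algebra G)" if "a \<in> carrier (free_algebra G)" for x a
    using that by (auto simp: free_algebra_def in_keys_iff lookup_cscale)
  show ?thesis unfolding tl_relators_def by (auto intro!: d m c carrier_free_algebra_gen)
qed

text \<open>The elements acting as zero form an ideal containing the relators, hence contain the
  ideal they generate.\<close>

lemma tl_ideal_kernel:
  assumes "a \<in> tl_ideal loop {1..<n}" shows "free_op loop n p a v = 0"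
proof -
  let ?R = "free_algebra {1..<n}"
  let ?K = "{a \<in> carrier ?R. \<forall>v. free_op loop n p a v = 0}"
  interpret ring ?R by (rule ring_free_algebra)
  note ops = free_algebra_ops
  have "ideal ?K ?R"
  proof (rule idealI[OF ring_axioms])
    show "subgroup ?K (add_monoid ?R)"
    proof
      show "x \<otimes>\<^bsub>add_monoid ?R\<^esub> y \<in> ?K" if "x \<in> ?K" "y \<in> ?K" for x y
        using that a_closed[of x y] by (auto simp: ops free_op_add)
      show "inv\<^bsub>add_monoid ?R\<^esub> x \<in> ?K" if x: "x \<in> ?K" for x
      proof -
        have xc: "x \<in> carrier ?R" using x by blast
        note c = a_inv_closed[OF xc] r_neg[OF xc]
        have "free_op loop n p (x + \<ominus>\<^bsub>?R\<^esub> x) v = 0" for v using c(2) unfolding ops by (simp add: free_op_0)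
        then have "free_op loop n p (\<ominus>\<^bsub>?R\<^esub> x) v = 0" for v using x by (simp add: free_op_add)
        then show ?thesis using c(1) by (simp add: a_inv_def)
      qed
    qed (auto simp: ops free_op_0 free_algebra_def)
  next
    show "x \<otimes>\<^bsub>?R\<^esub> a \<in> ?K" if "a \<in> ?K" "x \<in> carrier ?R" for a x
      using that m_closed[of x a] free_pair.linear_0[OF vlinear_free_op] by (auto simp: ops free_op_mult)
    show "a \<otimes>\<^bsub>?R\<^esub> x \<in> ?K" if "a \<in> ?K" "x \<in> carrier ?R" for a x
      using that m_closed[of a x] by (auto simp: ops free_op_mult)
  qed
  moreover have "tl_relators loop {1..<n} \<subseteq> ?K"
    using tl_relators_carrier free_op_tl_relator by blast
  ultimately have "tl_ideal loop {1..<n} \<subseteq> ?K"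
    unfolding tl_ideal_def genideal_def by blast
  then show ?thesis using assms by blast
qed

lemma zero_in_tl_ideal: "0 \<in> tl_ideal \<delta> G"
proof -
  have "0 \<in> I" if "ideal I (free_algebra G)" for I
    using additive_subgroup.zero_closed[OF ideal.axioms(1)[OF that]] by (simp add: free_algebra_def)
  then show ?thesis unfolding tl_ideal_def genideal_def by blast
qed

definition tl_coset :: "nat \<Rightarrow> (word \<Rightarrow>\<^sub>0 complex) \<Rightarrow> (word \<Rightarrow>\<^sub>0 complex) set" where
  "tl_coset n a = tl_ideal loop {1..<n} +>\<^bsub>free_algebra {1..<n}\<^esub> a"

lemma carrier_TL: "carrier (TL loop n) = tl_coset n ` carrier (free_algebra {1..<n})"
  unfolding TL_def tl_algebra_def FactRing_def tl_coset_def by (auto simp: A_RCOSETS_def')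

text \<open>All representatives act equally and the coset is nonempty, so the set from which
  \<open>tl_op\<close> takes the only element is a singleton.\<close>

lemma tl_op_coset: "tl_op loop n p (tl_coset n a) = free_op loop n p a"
proof -
  have eq: "free_op loop n p (h + a) = free_op loop n p a" if "h \<in> tl_ideal loop {1..<n}" for h
    by (rule ext) (simp add: free_op_add tl_ideal_kernel[OF that])
  have "tl_coset n a = (\<lambda>h. h + a) ` tl_ideal loop {1..<n}"
    unfolding tl_coset_def a_r_coset_def' by (auto simp: free_algebra_def)
  then have "free_op loop n p ` tl_coset n a = (\<lambda>h. free_op loop n p (h + a)) ` tl_ideal loop {1..<n}"
    by (simp add: image_image)
  also have "\<dots> = {free_op loop n p a}" using eq zero_in_tl_ideal by auto
  finally show ?thesis by (simp add: tl_op_def)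
qed

end

section \<open>Traces of irreducible representations\<close>

context nonzero_parameter
begin

definition tensor_op :: "(word \<Rightarrow>\<^sub>0 complex) \<Rightarrow> tensor \<Rightarrow> tensor" where
  "tensor_op a f = (\<lambda>S. \<Sum>u\<in>Poly_Mapping.keys a. Poly_Mapping.lookup a u * foldr tl_e (letters u) f S)"

lemma iota_foldr:
  "set ws \<subseteq> {1..<n} \<Longrightarrow> iota n p (foldr (gen_op loop n p) ws v) = foldr tl_e ws (iota n p v)"
  by (induction ws) (simp_all add: iota_gen_op)

lemma iota_free_op:
  assumes "a \<in> carrier (free_algebra {1..<n})" shows "iota n p (free_op loop n p a v) = tensor_op a (iota n p v)"
proof (rule ext)
  fix S
  have "iota n p (foldr (gen_op loop n p) (letters u) v) = foldr tl_e (letters u) (iota n p v)"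
    if "u \<in> Poly_Mapping.keys a" for u
    using assms that by (intro iota_foldr) (simp add: free_algebra_def)
  then show "iota n p (free_op loop n p a v) S = tensor_op a (iota n p v) S"
    by (simp add: free_op_def iota_sum iota_scale tensor_op_def)
qed

lemma free_op_closed:
  assumes W: "free_vs.subspace W" "\<And>v i. v \<in> W \<Longrightarrow> 1 \<le> i \<Longrightarrow> Suc i \<le> n \<Longrightarrow> gen_op loop n p i v \<in> W"
    and a: "a \<in> carrier (free_algebra {1..<n})" and v: "v \<in> W"
  shows "free_op loop n p a v \<in> W"
proof -
  have "set ws \<subseteq> {1..<n} \<Longrightarrow> foldr (gen_op loop n p) ws v \<in> W" for ws
    by (induction ws) (use W(2) v in auto)
  then show ?thesis
    using a unfolding free_op_def free_algebra_def
    by (intro free_vs.subspace_sum[OF W(1)] free_vs.subspace_scale[OF W(1)]) auto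
qed

lemma std_submoduleD:
  assumes s: "std_submodule loop n p W"
  shows "free_vs.subspace W" "W \<subseteq> std_module n p" "\<And>v i. v \<in> W \<Longrightarrow> 1 \<le> i \<Longrightarrow> Suc i \<le> n \<Longrightarrow> gen_op loop n p i v \<in> W"
proof -
  show "free_vs.subspace W" "W \<subseteq> std_module n p" using s unfolding std_submodule_def by - (elim conjE, assumption)+
  fix v i assume v: "v \<in> W" and i: "1 \<le> i" "Suc i \<le> n"
  have "tl_coset n (gen i) \<in> carrier (TL loop n)"
    unfolding carrier_TL using i by (intro imageI carrier_free_algebra_gen) auto
  then have "tl_op loop n p (tl_coset n (gen i)) ` W \<subseteq> W" using s unfolding std_submodule_def by blast
  then have "free_op loop n p (gen i) v \<in> W" using v unfolding tl_op_coset by blast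
  then show "gen_op loop n p i v \<in> W" by (simp only: free_op_gen)
qed

lemma std_submoduleI:
  assumes "free_vs.subspace W" "W \<subseteq> std_module n p"
    and closed: "\<And>v i. v \<in> W \<Longrightarrow> 1 \<le> i \<Longrightarrow> Suc i \<le> n \<Longrightarrow> gen_op loop n p i v \<in> W"
  shows "std_submodule loop n p W"
  unfolding std_submodule_def
proof (intro conjI ballI subsetI)
  fix X x assume "X \<in> carrier (TL loop n)" "x \<in> tl_op loop n p X ` W"
  then obtain a v where a: "a \<in> carrier (free_algebra {1..<n})" "X = tl_coset n a" and v: "v \<in> W" "x = tl_op loop n p X v"
    unfolding carrier_TL by (elim imageE)
  show "x \<in> W" unfolding v(2) a(2) tl_op_coset by (rule free_op_closed[OF assms(1) closed a(1) v(1)])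
qed (fact | use assms(2) in blast)+

definition pullback :: "nat \<Rightarrow> nat \<Rightarrow> tensor set \<Rightarrow> (link \<Rightarrow>\<^sub>0 complex) set" where
  "pullback n p A = {v \<in> std_module n p. iota n p v \<in> A}"

lemma std_submodule_pullback:
  assumes A: "submodule n p A" shows "std_submodule loop n p (pullback n p A)"
proof (rule std_submoduleI)
  show "free_vs.subspace (pullback n p A)"
    unfolding pullback_def
    by (rule free_vs.subspaceI)
      (auto simp: iota_0 iota_add iota_scale submoduleD(4)[OF A] simp del: fscale_apply
        intro: free_vs.subspace_0 free_vs.subspace_add free_vs.subspace_scale subspace_std_module
          fun_vs.subspace_add[OF submoduleD(1)[OF A]] fun_vs.subspace_scale[OF submoduleD(1)[OF A]])
  show "gen_op loop n p i v \<in> pullback n p A" if "v \<in> pullback n p A" "1 \<le> i" "Suc i \<le> n" for v i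
    using that gen_op_std_module[of i n loop p v] iota_gen_op[of i n p v] submoduleD(3)[OF A, of "iota n p v" i]
    by (auto simp: pullback_def)
qed (auto simp: pullback_def)

lemma submodule_iota_image:
  assumes W: "std_submodule loop n p W" shows "submodule n p (iota n p ` W)"
proof -
  have sW: "free_vs.subspace W" and g: "\<And>v i. v \<in> W \<Longrightarrow> 1 \<le> i \<Longrightarrow> Suc i \<le> n \<Longrightarrow> gen_op loop n p i v \<in> W"
    using std_submoduleD[OF W] by -
  show ?thesis
    unfolding submodule_def
  proof (intro conjI ballI allI impI)
    show "fun_vs.subspace (iota n p ` W)"
    proof (rule fun_vs.subspaceI)
      show "0 \<in> iota n p ` W" by (rule image_eqI[where f = "iota n p" and x = 0], rule iota_0[symmetric], rule free_vs.subspace_0[OF sW])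
      show "x + y \<in> iota n p ` W" if "x \<in> iota n p ` W" "y \<in> iota n p ` W" for x y
        using that by (elim imageE, hypsubst) (unfold iota_add[symmetric], intro imageI free_vs.subspace_add[OF sW])
      show "fscale c x \<in> iota n p ` W" if "x \<in> iota n p ` W" for c x
        using that by (elim imageE, hypsubst) (unfold iota_scale[symmetric], intro imageI free_vs.subspace_scale[OF sW])
    qed
    show "iota n p ` W \<subseteq> standard n p" using iota_standard by blast
    show "tl_e j f \<in> iota n p ` W" if "f \<in> iota n p ` W" "1 \<le> j \<and> j < n" for f j
    proof -
      obtain v where v: "v \<in> W" "f = iota n p v" using \<open>f \<in> iota n p ` W\<close> by blast
      have j: "1 \<le> j" "Suc j \<le> n" using that(2) by simp_all
      show ?thesis unfolding v(2) iota_gen_op[OF j, symmetric] by (intro imageI g v j)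
    qed
  qed
qed

lemma pullback_iota_image: assumes "W \<subseteq> std_module n p" shows "pullback n p (iota n p ` W) = W"
  using assms iota_inject unfolding pullback_def by blast

lemma iota_image_pullback: assumes "A \<subseteq> standard n p" shows "iota n p ` pullback n p A = A"
proof (intro equalityI subsetI)
  fix f assume f: "f \<in> A"
  obtain v where v: "v \<in> std_module n p" "iota n p v = f" using iota_surj[of f n p] f assms by blast
  then have "v \<in> pullback n p A" using f unfolding pullback_def by blast
  then show "f \<in> iota n p ` pullback n p A" unfolding v(2)[symmetric] by (rule imageI)
qed (unfold pullback_def, blast)

lemma pullback_standard: "pullback n p (standard n p) = std_module n p"
  unfolding pullback_def using iota_standard by blast

lemma pullback_zero: "pullback n p {0} = {0}"
proof (intro equalityI subsetI)
  fix v assume "v \<in> pullback n p {0}"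
  then show "v \<in> {0}" unfolding pullback_def using iota_eq_0[of v n p] by blast
next
  fix v :: "link \<Rightarrow>\<^sub>0 complex" assume "v \<in> {0}"
  then show "v \<in> pullback n p {0}"
    unfolding pullback_def using iota_0[of n p] free_vs.subspace_0[OF subspace_std_module, of n p] by blast
qed

lemma pullback_inject:
  assumes "A \<subseteq> standard n p" "B \<subseteq> standard n p" and eq: "pullback n p A = pullback n p B" shows "A = B"
  using arg_cong[OF eq, of "image (iota n p)"] unfolding iota_image_pullback[OF assms(1)] iota_image_pullback[OF assms(2)] .

lemma pullback_eq_std_module: assumes "submodule n p B" shows "pullback n p B = std_module n p \<longleftrightarrow> B = standard n p"
proof
  assume "pullback n p B = std_module n p"
  then show "B = standard n p" using pullback_inject[OF submoduleD(2)[OF assms] order_refl] unfolding pullback_standard by blast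
qed (simp only: pullback_standard)

lemma free_op_pullback:
  assumes "submodule n p A" "a \<in> carrier (free_algebra {1..<n})" "v \<in> pullback n p A"
  shows "free_op loop n p a v \<in> pullback n p A"
  by (rule free_op_closed[OF std_submoduleD(1,3)[OF std_submodule_pullback[OF assms(1)]] assms(2,3)])

lemma subspace_pullback: "submodule n p A \<Longrightarrow> free_vs.subspace (pullback n p A)"
  by (rule std_submoduleD(1)[OF std_submodule_pullback])

end

context root_of_unity
begin

text \<open>A second maximal submodule agrees with A: if one of the two is zero it lies in the other
  and maximality applies; two nonzero proper submodules are equal anyway.\<close>

lemma max_submodule_eq:
  assumes A: "submodule n p A" "A \<noteq> standard n p"
    and max: "\<And>B. submodule n p B \<Longrightarrow> A \<subseteq> B \<Longrightarrow> B = A \<or> B = standard n p"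
  shows "max_submodule loop n p = pullback n p A"
  unfolding max_submodule_def
proof (rule the_equality)
  show "std_submodule loop n p (pullback n p A) \<and> pullback n p A \<noteq> std_module n p \<and>
      (\<forall>W'. std_submodule loop n p W' \<and> pullback n p A \<subseteq> W' \<longrightarrow> W' = pullback n p A \<or> W' = std_module n p)"
  proof (intro conjI allI impI std_submodule_pullback A(1))
    show "pullback n p A \<noteq> std_module n p" unfolding pullback_eq_std_module[OF A(1)] by (rule A(2))
    fix W assume W: "std_submodule loop n p W \<and> pullback n p A \<subseteq> W"
    then have sub: "W \<subseteq> std_module n p" using std_submoduleD(2) by blast
    have "A \<subseteq> iota n p ` W" using W iota_image_pullback[OF submoduleD(2)[OF A(1)]] by blast
    then have "iota n p ` W = A \<or> iota n p ` W = standard n p"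
      using max submodule_iota_image W by blast
    then have "pullback n p (iota n p ` W) = pullback n p A \<or> pullback n p (iota n p ` W) = pullback n p (standard n p)"
      by (rule disj_forward) (rule arg_cong, assumption)+
    then show "W = pullback n p A \<or> W = std_module n p"
      unfolding pullback_iota_image[OF sub] pullback_standard .
  qed
  fix W assume "std_submodule loop n p W \<and> W \<noteq> std_module n p \<and>
      (\<forall>W'. std_submodule loop n p W' \<and> W \<subseteq> W' \<longrightarrow> W' = W \<or> W' = std_module n p)"
  note W = conjunct1[OF this] conjunct1[OF conjunct2[OF this]]
    mp[OF spec[OF conjunct2[OF conjunct2[OF this]]], OF conjI]
  note sub = std_submoduleD(2)[OF W(1)]
  let ?B = "iota n p ` W"
  note B = submodule_iota_image[OF W(1)]
  have B_ne: "?B \<noteq> standard n p"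
    using W(2) unfolding pullback_eq_std_module[OF B, symmetric] pullback_iota_image[OF sub] .
  have max_B: "C = ?B \<or> C = standard n p" if C: "submodule n p C" "?B \<subseteq> C" for C
  proof -
    have "W \<subseteq> pullback n p C"
      using C(2) sub unfolding pullback_def by blast
    then have "pullback n p C = W \<or> pullback n p C = std_module n p" by (rule W(3)[OF std_submodule_pullback[OF C(1)]])
    then show ?thesis
    proof
      assume eq: "pullback n p C = W"
      show ?thesis using iota_image_pullback[OF submoduleD(2)[OF C(1)]] unfolding eq by (rule disjI1[OF sym])
    qed (unfold pullback_eq_std_module[OF C(1)], rule disjI2)
  qed
  have "?B = A"
  proof (cases "A = {0} \<or> ?B = {0}")
    case True
    then show ?thesis
    proof
      assume "A = {0}"
      then have "A \<subseteq> ?B" using submoduleD(4)[OF B] by (simp only: empty_subsetI insert_subset simp_thms)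
      then show ?thesis using max[OF B] B_ne by argo
    next
      assume "?B = {0}"
      then have "?B \<subseteq> A" using submoduleD(4)[OF A(1)] by (simp only: empty_subsetI insert_subset simp_thms)
      then show ?thesis using max_B[OF A(1)] A(2) by argo
    qed
  next
    case False
    show ?thesis by (rule proper_submodule_unique[OF B _ B_ne A(1) _ A(2)]) (use False in argo)+
  qed
  then have "pullback n p ?B = pullback n p A" by (rule arg_cong)
  then show "W = pullback n p A" unfolding pullback_iota_image[OF sub] .
qed

lemma standard_ne_0: assumes "2 * p \<le> n" shows "standard n p \<noteq> {0}"
proof -
  have "n = (n - 2 * p) + 2 * p" using assms by simp
  then show ?thesis using cups_link_vec_standard[of p "n - 2 * p"] cups_link_vec_ne_0[of p "n - 2 * p"] by auto
qed

lemma max_submodule_none: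
  assumes "2 * p \<le> n" "\<And>i. \<not> reflected n p i" shows "max_submodule loop n p = pullback n p {0}"
proof (rule max_submodule_eq[OF submodule_zero])
  show "{0} \<noteq> standard n p" using standard_ne_0[OF assms(1)] by blast
  show "B = {0} \<or> B = standard n p" if "submodule n p B" for B
    using socle_reflected[OF that] assms(2) by blast
qed

lemma max_submodule_lowered:
  assumes "reflected n p i" "2 * p \<le> n" "2 * p < n \<or> l \<noteq> 2"
  shows "max_submodule loop n p = pullback n p (lowered n p i)"
proof (rule max_submodule_eq[OF lowered_submodule[OF assms(1,2)] lowered_proper(1)[OF assms]])
  fix B assume B: "submodule n p B" "lowered n p i \<subseteq> B"
  have "lowered n p i \<noteq> {0}"
  proof -
    obtain m k where "n = m + 2 * i" by (rule reflectedD[OF assms(1,2)])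
    then show ?thesis using lowered_contains(2)[of m i p] assms(1,2) by simp
  qed
  moreover from this have "B \<noteq> {0}" using B(2) submoduleD(4)[OF lowered_submodule[OF assms(1,2)]] by blast
  ultimately show "B = lowered n p i \<or> B = standard n p"
    using proper_submodule_unique[OF B(1) _ _ lowered_submodule[OF assms(1,2)] _ lowered_proper(1)[OF assms]] by blast
qed

lemma max_submodule_lower_kernel:
  assumes "reflected n p i" "2 * p \<le> n"
  shows "max_submodule loop n i = pullback n i (lower_kernel n p i)"
  by (rule max_submodule_eq[OF submodule_lower_kernel lower_kernel_maximal[OF assms]])

text \<open>In link coordinates the power of the lowering operator is an intertwiner h on V_{n,i},
  with the maximal submodule as kernel and the lowered image as range, so the trace on L_{n,i} can
  be taken on the range.\<close>

lemma irr_trace_lowered: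
  assumes ref: "reflected n p i" "2 * p \<le> n" and a: "a \<in> carrier (free_algebra {1..<n})"
  shows "irr_trace loop n i (tl_coset n a) = quotient_trace (pullback n p (lowered n p i)) {0} (free_op loop n p a)"
proof -
  let ?L = "lower n ^^ (p - i)"
  have L: "?L f \<in> standard n p" if "f \<in> standard n i" for f
    using lowered_submodule[OF ref] submoduleD(2) that unfolding lowered_def by blast
  have "\<exists>u. u \<in> std_module n p \<and> iota n p u = ?L (iota n i v)" for v
    using iota_surj[OF L[OF iota_standard]] by metis
  then obtain h where h: "\<And>v. h v \<in> std_module n p" "\<And>v. iota n p (h v) = ?L (iota n i v)" by metis
  have hl: "vlinear h"
  proof (rule vlinearI)
    show "h (u + v) = h u + h v" for u v
      by (rule iota_inject[OF h(1) free_vs.subspace_add[OF subspace_std_module h(1) h(1)]])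
        (simp only: h(2) iota_add lower_funpow_linear)
    show "h (cscale c v) = cscale c (h v)" for c v
      by (rule iota_inject[OF h(1) free_vs.subspace_scale[OF subspace_std_module h(1)]])
        (simp only: h(2) iota_scale lower_funpow_linear)
  qed
  have word: "?L (foldr tl_e ws f) = foldr tl_e ws (?L f)" if "set ws \<subseteq> {1..<n}" for ws f
    using that by (induction ws) (simp_all add: lower_funpow_tl_e)
  have fin: "?L (tensor_op a f) = tensor_op a (?L f)" for f
  proof -
    have sum: "?L (\<Sum>u\<in>A. g u) = (\<Sum>u\<in>A. ?L (g u))" if "finite A" for A and g :: "word \<Rightarrow> tensor"
      using that
    proof (induction A rule: finite_induct)
      case empty
      have "(\<Sum>u\<in>{}. g u) = 0" "(\<Sum>u\<in>{}. ?L (g u)) = 0" by (rule sum.empty)+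
      then show ?case by (metis lower_funpow_linear(3))
    next
      case (insert x F)
      have "(\<Sum>u\<in>insert x F. g u) = g x + (\<Sum>u\<in>F. g u)" "(\<Sum>u\<in>insert x F. ?L (g u)) = ?L (g x) + (\<Sum>u\<in>F. ?L (g u))"
        by (rule sum.insert; fact)+
      then show ?case using insert by (metis lower_funpow_linear(1))
    qed
    have t: "tensor_op a f = (\<Sum>u\<in>Poly_Mapping.keys a. fscale (Poly_Mapping.lookup a u) (foldr tl_e (letters u) f))" for f
      by (rule ext) (simp add: tensor_op_def sum_fun_apply)
    have k: "set (letters u) \<subseteq> {1..<n}" if "u \<in> Poly_Mapping.keys a" for u
      using a that by (simp add: free_algebra_def)
    show ?thesis
      unfolding t sum[OF finite_keys] lower_funpow_linear by (intro sum.cong refl) (simp only: word k)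
  qed
  have inter: "h (free_op loop n i a v) = free_op loop n p a (h v)" for v
  proof (rule iota_inject[OF h(1)])
    show "free_op loop n p a (h v) \<in> std_module n p"
      using free_op_pullback[OF submodule_standard a] h(1) unfolding pullback_standard by blast
    show "iota n p (h (free_op loop n i a v)) = iota n p (free_op loop n p a (h v))"
      by (simp only: h(2) iota_free_op[OF a] fin)
  qed
  have K: "pullback n i (lower_kernel n p i) = {v \<in> std_module n i. h v = 0}"
  proof -
    have "h v = 0 \<longleftrightarrow> ?L (iota n i v) = 0" for v
      using h(2)[of v] iota_eq_0[OF h(1)[of v]] iota_0[of n p] by metis
    then show ?thesis unfolding pullback_def lower_kernel_def using iota_standard by blast
  qed
  have img: "h ` std_module n i = pullback n p (lowered n p i)"
  proof (intro equalityI subsetI)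
    fix x assume "x \<in> h ` std_module n i"
    then show "x \<in> pullback n p (lowered n p i)"
      using h iota_standard unfolding pullback_def lowered_def by auto
  next
    fix x assume "x \<in> pullback n p (lowered n p i)"
    then have x: "x \<in> std_module n p" "iota n p x \<in> lowered n p i" by (auto simp: pullback_def)
    then obtain f where f: "f \<in> standard n i" "iota n p x = ?L f" unfolding lowered_def by blast
    obtain v where v: "v \<in> std_module n i" "iota n i v = f" by (rule iota_surj[OF f(1)])
    have "h v = x" by (rule iota_inject[OF h(1) x(1)]) (simp only: h(2) v(2) f(2))
    then show "x \<in> h ` std_module n i" using v(1) by blast
  qed
  have T: "free_op loop n i a ` std_module n i \<subseteq> std_module n i"
    using free_op_pullback[OF submodule_standard a] unfolding pullback_standard by blast
  show ?thesis
    unfolding irr_trace_def tl_op_coset max_submodule_lower_kernel[OF ref] K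
    using quotient_trace_hom[OF finite_dim_std_module vlinear_free_op T vlinear_free_op hl inter] unfolding img .
qed

lemma std_trace_coset:
  assumes "a \<in> carrier (free_algebra {1..<n})"
  shows "std_trace loop n p (tl_coset n a) = quotient_trace (std_module n p) {0} (free_op loop n p a)"
  using free_op_pullback[OF submodule_standard assms] unfolding pullback_standard
  by (intro std_trace_eq tl_op_coset vlinear_free_op) blast

lemma irr_labels_iff: "p \<in> irr_labels l n \<longleftrightarrow> 2 * p \<le> n \<and> (2 * p < n \<or> l \<noteq> 2)"
proof -
  have "p \<le> n div 2 \<longleftrightarrow> 2 * p \<le> n" "even n \<and> p = n div 2 \<longleftrightarrow> 2 * p = n" by auto
  then show ?thesis unfolding irr_labels_def by auto
qed

theorem std_trace_decomposition:
  assumes "2 * p \<le> n" "\<not> (l = 2 \<and> n = 0)" and X: "X \<in> carrier (TL loop n)"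
  shows "std_trace loop n p X = (if p \<in> irr_labels l n then irr_trace loop n p X else 0) +
    (\<Sum>i\<in>{i. reflected n p i}. irr_trace loop n i X)"
proof -
  obtain a where a: "a \<in> carrier (free_algebra {1..<n})" "X = tl_coset n a" using X carrier_TL by blast
  have label: "p \<in> irr_labels l n \<longleftrightarrow> 2 * p < n \<or> l \<noteq> 2"
    using assms(1) unfolding irr_labels_iff by simp
  show ?thesis
  proof (cases "\<exists>i. reflected n p i")
    case False
    \<comment> \<open>For l = 2 and n = 2p > 0 the index p - 1 is reflected, since n + 1 - p - (p -
      1) = 2. So without a reflected index p is a label.\<close>
    have "2 * p < n \<or> l \<noteq> 2"
    proof (rule ccontr)
      assume n: "\<not> (2 * p < n \<or> l \<noteq> 2)"
      then have "n = 2 * p" "l = 2" "p \<noteq> 0" using assms(1,2) by auto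
      then have "reflected n p (p - 1)" unfolding reflected_def by auto
      then show False using False by blast
    qed
    then show ?thesis
      using False max_submodule_none[OF assms(1)] unfolding a(2) std_trace_coset[OF a(1)] irr_trace_def tl_op_coset label
      by (simp add: pullback_zero)
  next
    case True
    then obtain i where i: "reflected n p i" by blast
    have one: "{i. reflected n p i} = {i}" using reflected_unique[OF _ i assms(1)] i by blast
    let ?M = "pullback n p (lowered n p i)" and ?T = "free_op loop n p a"
    note sub = lowered_submodule[OF i assms(1)]
    have "quotient_trace (std_module n p) {0} ?T =
        (if p \<in> irr_labels l n then irr_trace loop n p X else 0) + quotient_trace ?M {0} ?T"
    proof (cases "p \<in> irr_labels l n")
      case True
      then have max: "max_submodule loop n p = ?M" using max_submodule_lowered[OF i assms(1)] label by blast
      have "quotient_trace (std_module n p) {0} ?T = quotient_trace (std_module n p) ?M ?T + quotient_trace ?M {0} ?T"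
      proof (rule quotient_trace_add[OF finite_dim_std_module subspace_pullback[OF sub] _ vlinear_free_op])
        show "?T ` std_module n p \<subseteq> std_module n p"
          using free_op_pullback[OF submodule_standard a(1)] unfolding pullback_standard by blast
        show "?T ` ?M \<subseteq> ?M" using free_op_pullback[OF sub a(1)] by blast
      qed (auto simp: pullback_def)
      then show ?thesis using True unfolding irr_trace_def max a(2) tl_op_coset by simp
    next
      case False
      \<comment> \<open>No irreducible is labelled by this p: V_{n,p} coincides with the image of
        V_{n,i}, and only the second summand remains.\<close>
      then have n: "n = 2 * p" "l = 2" using label assms(1) by auto
      have "lowered n p i \<noteq> {0}"
      proof -
        obtain m k where "n = m + 2 * i" by (rule reflectedD[OF i assms(1)])
        then show ?thesis using lowered_contains(2)[of m i p] i assms(1) by simp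
      qed
      then have "lowered n p i = standard n p" using irreducible_half[OF n(2)] sub n(1) by blast
      then show ?thesis using False by (simp add: pullback_standard)
    qed
    then show ?thesis
      unfolding one using std_trace_coset[OF a(1)] irr_trace_lowered[OF i assms(1) a(1)] a(2) by simp
  qed
qed

lemma max_submodule_killed:
  assumes "p \<in> irr_labels l n"
  obtains A where "submodule n p A" "max_submodule loop n p = pullback n p A"
    "\<And>f. f \<in> A \<Longrightarrow> foldr tl_e (top_word (n - 2 * p) p) f = 0"
proof (cases "\<exists>i. reflected n p i")
  case True
  then obtain i where i: "reflected n p i" by blast
  have p: "2 * p \<le> n" "2 * p < n \<or> l \<noteq> 2" using assms unfolding irr_labels_iff by blast+
  show ?thesis
    by (rule that[OF lowered_submodule[OF i p(1)] max_submodule_lowered[OF i p] lowered_proper(2)[OF i p]])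
next
  case False
  have p: "2 * p \<le> n" using assms unfolding irr_labels_iff by blast
  have z: "foldr tl_e ws 0 = 0" for ws by (induction ws) (simp_all only: foldr_Nil foldr_Cons id_apply o_apply tl_e_zero)
  show ?thesis
    by (rule that[OF submodule_zero max_submodule_none[OF p]]) (use False z in \<open>auto simp del: zero_fun_apply\<close>)
qed

lemma top_word_subset: "set (top_word m p) \<subseteq> {1..<m + 2 * p}"
proof
  fix j assume "j \<in> set (top_word m p)"
  then show "j \<in> {1..<m + 2 * p}" using top_word_range[of j m p] by simp
qed

text \<open>The product of caps and cups alone has trace \<open>loop\<close> to the power p on
  V_{n,p}, which vanishes for l = 2 and p > 0. It is therefore multiplied by an element b that moves
  the cyclic vector z to a vector on which the caps do not vanish.\<close>

lemma irr_trace_separating: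
  assumes p: "p \<in> irr_labels l n"
  obtains X where "X \<in> carrier (TL loop n)" "irr_trace loop n p X \<noteq> 0" "\<And>i. i < p \<Longrightarrow> irr_trace loop n i X = 0"
proof -
  define m where "m = n - 2 * p"
  have n: "n = m + 2 * p" and ml: "1 \<le> m \<or> loop \<noteq> 0"
    using p loop_eq_0_iff unfolding irr_labels_iff m_def by auto
  let ?R = "free_algebra {1..<n}"
  interpret ring ?R by (rule ring_free_algebra)
  let ?v = "cups p m (link_vec m id)"
  obtain z where z: "z \<in> std_module n p" "iota n p z = ?v"
    using iota_surj[of ?v n p] cups_link_vec_standard[of p m] n by metis
  let ?F = "free_op loop n p"
  let ?N = "(\<lambda>b. ?F b z) ` carrier ?R"
  have mem: "?F b v \<in> std_module n p" if "b \<in> carrier ?R" "v \<in> std_module n p" for b v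
    using free_op_pullback[OF submodule_standard that(1)] that(2) unfolding pullback_standard by blast
  have "std_submodule loop n p ?N"
  proof (rule std_submoduleI)
    show "free_vs.subspace ?N"
    proof (rule free_vs.subspaceI)
      show "0 \<in> ?N" using zero_closed free_op_0[of loop n p z] by (metis free_algebra_ops(3) image_eqI)
      fix x y assume "x \<in> ?N" "y \<in> ?N"
      then obtain b c where "b \<in> carrier ?R" "c \<in> carrier ?R" "x = ?F b z" "y = ?F c z" by blast
      then show "x + y \<in> ?N" using a_closed[of b c] free_op_add[of loop n p b c z] by (metis free_algebra_ops(1) image_eqI)
    next
      fix c x assume "x \<in> ?N"
      then obtain b where b: "b \<in> carrier ?R" "x = ?F b z" by blast
      have "cscale c b \<in> carrier ?R" using b(1) by (auto simp: free_algebra_def in_keys_iff lookup_cscale)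
      then show "cscale c x \<in> ?N" using b free_op_cscale[of loop n p c b z] by (metis image_eqI)
    qed
    show "?N \<subseteq> std_module n p" using mem z(1) by blast
    fix x i assume "x \<in> ?N" and i: "1 \<le> i" "Suc i \<le> n"
    then obtain b where b: "b \<in> carrier ?R" "x = ?F b z" by blast
    have "gen i \<in> carrier ?R" using i by (intro carrier_free_algebra_gen) auto
    then have "gen i * b \<in> carrier ?R" using m_closed[of "gen i" b] b(1) by (metis free_algebra_ops(2))
    moreover have "gen_op loop n p i x = ?F (gen i * b) z" by (simp add: free_op_mult free_op_gen b(2))
    ultimately show "gen_op loop n p i x \<in> ?N" by blast
  qed
  then have N: "submodule n p (iota n p ` ?N)" by (rule submodule_iota_image)
  have "?F 1 z = z" unfolding single_one[symmetric] free_op_single by (simp add: zero_word_def)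
  then have "?v \<in> iota n p ` ?N" using z(2) one_closed by (metis free_algebra_ops(4) image_eqI)
  then have full: "iota n p ` ?N = standard n p" using submodule_cups_full[of m p] N ml unfolding n by blast
  obtain f where f: "f \<in> standard n p" "caps p m f (\<lambda>_. False) \<noteq> 0"
    using caps_surjective[OF ml, of p] unfolding n by blast
  have "f \<in> iota n p ` ?N" unfolding full by (rule f(1))
  then obtain y where y: "f = iota n p y" "y \<in> ?N" by (rule imageE)
  obtain b where y_eq: "y = ?F b z" and b_carrier: "b \<in> carrier ?R" using y(2) by (rule imageE)
  note b = b_carrier y(1)[unfolded y_eq, symmetric]
  define x where "x = Poly_Mapping.single (Word (top_word m p)) (1 :: complex)"
  have x: "x \<in> carrier ?R" using top_word_subset[of m p] unfolding x_def free_algebra_def n by simp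
  define a where "a = x * b"
  have a: "a \<in> carrier ?R" unfolding a_def using m_closed[OF x b(1)] by (simp add: free_algebra_ops)
  have iota_a: "iota n i (free_op loop n i a u) = foldr tl_e (top_word m p) (iota n i (free_op loop n i b u))" for i u
  proof -
    have "set (top_word m p) \<subseteq> {1..<n}" unfolding n by (rule top_word_subset)
    then show ?thesis unfolding a_def free_op_mult x_def free_op_single by (simp add: iota_foldr)
  qed
  \<comment> \<open>The operator of a is u -> \<psi>(u) z, so its trace is \<psi>(z).\<close>
  define \<psi> where "\<psi> u = caps p m (iota n p (?F b u)) (\<lambda>_. False)" for u
  have Ta: "?F a u = cscale (\<psi> u) z" if "u \<in> std_module n p" for u
  proof (rule iota_inject[OF mem[OF a that] free_vs.subspace_scale[OF subspace_std_module z(1)]])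
    have "iota n p (?F b u) \<in> standard (m + 2 * p) p" using iota_standard[of n p] unfolding n by blast
    then show "iota n p (?F a u) = iota n p (cscale (\<psi> u) z)"
      unfolding iota_a iota_scale z(2) \<psi>_def by (rule top_word_rank_one)
  qed
  have \<psi>_lin: "\<psi> (u + v) = \<psi> u + \<psi> v" "\<psi> (cscale c u) = c * \<psi> u" "\<psi> 0 = 0" for u v c
    unfolding \<psi>_def by (simp_all add: free_pair.linear_add[OF vlinear_free_op] free_pair.linear_scale[OF vlinear_free_op]
        free_pair.linear_0[OF vlinear_free_op] iota_add iota_scale iota_0 caps_linear)
  have \<psi>_sum: "\<psi> (\<Sum>w\<in>A. g w) = (\<Sum>w\<in>A. \<psi> (g w))" if "finite A" for A and g :: "link \<Rightarrow> link \<Rightarrow>\<^sub>0 complex"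
    using that by (induction A rule: finite_induct) (simp_all add: \<psi>_lin)
  have z_sum: "z = (\<Sum>w\<in>link_states n p. cscale (Poly_Mapping.lookup z w) (Poly_Mapping.single w 1))"
  proof -
    have "z = (\<Sum>w\<in>Poly_Mapping.keys z. cscale (Poly_Mapping.lookup z w) (Poly_Mapping.single w 1))"
      using poly_mapping_as_sum[of z] by (simp add: cscale_single)
    also have "\<dots> = (\<Sum>w\<in>link_states n p. cscale (Poly_Mapping.lookup z w) (Poly_Mapping.single w 1))"
      using z(1) by (intro sum.mono_neutral_left finite_link_states) (auto simp: std_module_def in_keys_iff)
    finally show ?thesis .
  qed
  let ?X = "tl_coset n a"
  have "std_trace loop n p ?X = (\<Sum>w\<in>link_states n p. Poly_Mapping.lookup z w * \<psi> (Poly_Mapping.single w 1))"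
    unfolding std_trace_def tl_op_coset using Ta[OF single_std_module] by (simp add: lookup_cscale mult.commute)
  also have "\<dots> = \<psi> z" by (subst (2) z_sum) (simp add: \<psi>_sum finite_link_states \<psi>_lin)
  also have "\<psi> z \<noteq> 0" unfolding \<psi>_def b(2) by (rule f(2))
  finally have tr: "std_trace loop n p ?X \<noteq> 0" .
  obtain A where A: "submodule n p A" "max_submodule loop n p = pullback n p A"
    "\<And>f. f \<in> A \<Longrightarrow> foldr tl_e (top_word m p) f = 0"
    using max_submodule_killed[OF p] unfolding m_def by blast
  have killA: "?F a u = 0" if u: "u \<in> pullback n p A" for u
  proof (rule iota_eq_0)
    show "?F a u \<in> std_module n p" using mem[OF a] u by (simp add: pullback_def)
    show "iota n p (?F a u) = 0" unfolding iota_a using free_op_pullback[OF A(1) b(1) u] by (intro A(3)) (simp add: pullback_def)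
  qed
  have sub: "pullback n p A \<subseteq> std_module n p" by (auto simp: pullback_def)
  have "quotient_trace (std_module n p) {0} (?F a) =
      quotient_trace (std_module n p) (pullback n p A) (?F a) + quotient_trace (pullback n p A) {0} (?F a)"
    using mem[OF a] free_op_pullback[OF A(1) a]
    by (intro quotient_trace_add[OF finite_dim_std_module subspace_pullback[OF A(1)] sub vlinear_free_op]) auto
  moreover have "quotient_trace (pullback n p A) {0} (?F a) = 0"
    using free_vs.subspace_0[OF subspace_pullback[OF A(1)]] killA
    by (intro quotient_trace_vanishing finite_dim_subspace[OF finite_dim_std_module subspace_pullback[OF A(1)] sub]
        vlinear_free_op free_vs.subspace_single_0) auto
  ultimately have "irr_trace loop n p ?X \<noteq> 0"
    using tr std_trace_coset[OF a] unfolding irr_trace_def tl_op_coset A(2) by simp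
  moreover have "irr_trace loop n i ?X = 0" if i: "i < p" for i
  proof -
    have "i \<in> irr_labels l n" using i p unfolding irr_labels_def by auto
    then obtain B where B: "submodule n i B" "max_submodule loop n i = pullback n i B"
      using max_submodule_killed by metis
    show ?thesis
      unfolding irr_trace_def tl_op_coset B(2)
    proof (rule quotient_trace_vanishing[OF finite_dim_std_module subspace_pullback[OF B(1)] _ vlinear_free_op])
      fix u assume u: "u \<in> std_module n i"
      show "free_op loop n i a u = 0"
      proof (rule iota_eq_0)
        show "free_op loop n i a u \<in> std_module n i"
          using free_op_pullback[OF submodule_standard a] u unfolding pullback_standard by blast
        have "iota n i (free_op loop n i b u) \<in> standard (m + 2 * p) i" using iota_standard[of n i] unfolding n by blast
        then show "iota n i (free_op loop n i a u) = 0" unfolding iota_a using i by (rule top_word_kills)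
      qed
    qed (auto simp: pullback_def)
  qed
  moreover have "?X \<in> carrier (TL loop n)" unfolding carrier_TL using a by blast
  ultimately show ?thesis using that by blast
qed

text \<open>Triangularity: a separating element for the largest label r with nonzero coefficient
  sees that label alone, as smaller labels give trace zero and larger ones have coefficient
  zero.\<close>

lemma irr_trace_independent:
  assumes "\<And>X. X \<in> carrier (TL loop n) \<Longrightarrow> (\<Sum>i\<in>irr_labels l n. c i * irr_trace loop n i X) = 0" "p \<in> irr_labels l n"
  shows "c p = 0"
proof (rule ccontr)
  assume nz: "c p \<noteq> 0"
  have fin: "finite (irr_labels l n)" unfolding irr_labels_def by simp
  let ?P = "{p \<in> irr_labels l n. c p \<noteq> 0}"
  have P: "finite ?P" "?P \<noteq> {}" using fin nz assms(2) by auto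
  define r where "r = Max ?P"
  have r: "r \<in> irr_labels l n" "c r \<noteq> 0" "\<And>i. i \<in> irr_labels l n \<Longrightarrow> r < i \<Longrightarrow> c i = 0"
  proof -
    show "r \<in> irr_labels l n" "c r \<noteq> 0" using Max_in[OF P] by (simp_all add: r_def)
    show "c i = 0" if "i \<in> irr_labels l n" "r < i" for i
    proof (rule ccontr)
      assume "c i \<noteq> 0"
      then have "i \<le> r" unfolding r_def using that(1) P(1) by (intro Max_ge) auto
      then show False using that(2) by simp
    qed
  qed
  obtain X where X: "X \<in> carrier (TL loop n)" "irr_trace loop n r X \<noteq> 0" "\<And>i. i < r \<Longrightarrow> irr_trace loop n i X = 0"
    using irr_trace_separating[OF r(1)] by metis
  have "(\<Sum>i\<in>irr_labels l n. c i * irr_trace loop n i X) = (\<Sum>i\<in>{r}. c i * irr_trace loop n i X)"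
    using r X(3) by (intro sum.mono_neutral_right fin) (auto, metis linorder_neqE_nat)
  then show False using assms(1)[OF X(1)] X(2) r(2) by simp
qed

end

section \<open>Coefficients of extremal traces\<close>

lemma ext_coeff_eq_0: "n < 2 * i \<Longrightarrow> ext_coeff \<gamma> n i = 0"
  by (simp add: ext_coeff_def ext_coeff0_def)

lemma ext_coeff_shift: "2 * i \<le> n \<Longrightarrow> ext_coeff \<gamma> n (i + j) = \<gamma> ^ i * ext_coeff \<gamma> (n - 2 * i) j"
  by (simp add: ext_coeff_def power_add of_nat_diff algebra_simps)

text \<open>L_{n,i} occurs in V_{n,i} and in at most one other standard representation, whose index
  is i plus the residue; there is none if the residue is 0. An index beyond n/2 does no harm because
  \<open>ext_coeff\<close> is zero there.\<close>

definition irr_coeff :: "nat \<Rightarrow> complex \<Rightarrow> nat \<Rightarrow> nat \<Rightarrow> complex" where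
  "irr_coeff l \<gamma> n i = ext_coeff \<gamma> n i +
     (if l dvd n + 1 - 2 * i then 0 else ext_coeff \<gamma> n (i + (n + 1 - 2 * i) mod l))"

lemma irr_coeff_shift: assumes "2 * i \<le> n" shows "irr_coeff l \<gamma> n i = \<gamma> ^ i * irr_coeff l \<gamma> (n - 2 * i) 0"
proof -
  have "n + 1 - 2 * i = n - 2 * i + 1" using assms by simp
  then show ?thesis
    using ext_coeff_shift[OF assms, of \<gamma> 0] ext_coeff_shift[OF assms, of \<gamma>]
    unfolding irr_coeff_def by (simp add: distrib_left)
qed

context root_of_unity
begin

text \<open>Solves the reflection condition for p in terms of i: p - i lies strictly between 0 and l
  and is congruent to n + 1 - 2i. This is the origin of the residue j in the theorem.\<close>

lemma reflected_iff:
  assumes "2 * p \<le> n"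
  shows "reflected n p i \<longleftrightarrow> \<not> l dvd n + 1 - 2 * i \<and> p = i + (n + 1 - 2 * i) mod l"
proof
  assume r: "reflected n p i"
  define k where "k = p - i"
  have k: "p = i + k" "0 < k" "k < l" "l dvd n + 1 - p - i" using r unfolding reflected_def k_def by auto
  have "n + 1 - 2 * i = (n + 1 - p - i) + k" using k(1) assms by simp
  then have "(n + 1 - 2 * i) mod l = k" using k(3,4) by (metis add.commute dvd_imp_mod_0 mod_add_right_eq mod_less add_0_right)
  then show "\<not> l dvd n + 1 - 2 * i \<and> p = i + (n + 1 - 2 * i) mod l" using k(1,2) by (simp add: dvd_eq_mod_eq_0)
next
  assume r: "\<not> l dvd n + 1 - 2 * i \<and> p = i + (n + 1 - 2 * i) mod l"
  have "l dvd (n + 1 - 2 * i) - (n + 1 - 2 * i) mod l" by (rule dvd_minus_mod)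
  moreover have "(n + 1 - 2 * i) - (n + 1 - 2 * i) mod l = n + 1 - p - i" using r by simp
  moreover have "(n + 1 - 2 * i) mod l < l" "0 < (n + 1 - 2 * i) mod l" using l_ge_2 r by (simp_all add: dvd_eq_mod_eq_0)
  ultimately show "reflected n p i" using r unfolding reflected_def by auto
qed

lemma sum_reflected:
  "(\<Sum>p\<le>n div 2. if reflected n p i then ext_coeff \<gamma> n p else 0) =
     (if l dvd n + 1 - 2 * i then 0 else ext_coeff \<gamma> n (i + (n + 1 - 2 * i) mod l))"
proof -
  let ?j = "i + (n + 1 - 2 * i) mod l"
  have "(\<Sum>p\<le>n div 2. if reflected n p i then ext_coeff \<gamma> n p else 0) =
      (\<Sum>p\<le>n div 2. if p = ?j then (if l dvd n + 1 - 2 * i then 0 else ext_coeff \<gamma> n p) else 0)"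
    using reflected_iff by (intro sum.cong) auto
  also have "\<dots> = (if ?j \<le> n div 2 then (if l dvd n + 1 - 2 * i then 0 else ext_coeff \<gamma> n ?j) else 0)" by simp
  also have "\<dots> = (if l dvd n + 1 - 2 * i then 0 else ext_coeff \<gamma> n ?j)"
  proof (cases "?j \<le> n div 2")
    case False
    have "n < 2 * k" if "\<not> k \<le> n div 2" for k using that by linarith
    from this[OF False] have "n < 2 * ?j" .
    then show ?thesis using ext_coeff_eq_0 by simp
  qed simp
  finally show ?thesis .
qed

theorem std_expansion_to_irr_expansion:
  assumes n: "\<not> (l = 2 \<and> n = 0)" and X: "X \<in> carrier (TL loop n)"
  shows "(\<Sum>p\<le>n div 2. ext_coeff \<gamma> n p * std_trace loop n p X) =
    (\<Sum>i\<in>irr_labels l n. irr_coeff l \<gamma> n i * irr_trace loop n i X)"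
proof -
  let ?L = "irr_labels l n" and ?e = "ext_coeff \<gamma> n" and ?t = "\<lambda>i. irr_trace loop n i X"
  have fin: "finite ?L" unfolding irr_labels_def by simp
  have expand: "?e p * std_trace loop n p X = (if p \<in> ?L then ?e p * ?t p else 0) + (\<Sum>i\<in>?L. (if reflected n p i then ?e p else 0) * ?t i)"
    if p: "p \<in> {..n div 2}" for p
  proof -
    have p2: "2 * p \<le> n" using p by auto
    \<comment> \<open>A reflected index is smaller than p, hence less than n/2, and so always a
      label.\<close>
    have "{i. reflected n p i} = {i \<in> ?L. reflected n p i}"
      using p2 unfolding irr_labels_iff reflected_def by auto
    then have "(\<Sum>i\<in>{i. reflected n p i}. ?t i) = (\<Sum>i\<in>?L. if reflected n p i then ?t i else 0)"
      using fin by (simp add: sum.inter_filter)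
    then have "?e p * (\<Sum>i\<in>{i. reflected n p i}. ?t i) = (\<Sum>i\<in>?L. (if reflected n p i then ?e p else 0) * ?t i)"
      by (simp add: sum_distrib_left if_distrib if_distribR cong: if_cong)
    then show ?thesis unfolding std_trace_decomposition[OF p2 n X] by (simp add: distrib_left)
  qed
  have "(\<Sum>p\<le>n div 2. ?e p * std_trace loop n p X) = (\<Sum>p\<le>n div 2. if p \<in> ?L then ?e p * ?t p else 0) +
      (\<Sum>p\<le>n div 2. \<Sum>i\<in>?L. (if reflected n p i then ?e p else 0) * ?t i)"
    unfolding sum.distrib[symmetric] by (rule sum.cong[OF HOL.refl expand])
  also have "(\<Sum>p\<le>n div 2. if p \<in> ?L then ?e p * ?t p else 0) = (\<Sum>i\<in>?L. ?e i * ?t i)"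
    by (rule sum.mono_neutral_cong_right) (auto simp: irr_labels_def)
  also have "(\<Sum>p\<le>n div 2. \<Sum>i\<in>?L. (if reflected n p i then ?e p else 0) * ?t i) =
      (\<Sum>i\<in>?L. (\<Sum>p\<le>n div 2. if reflected n p i then ?e p else 0) * ?t i)"
    unfolding sum_distrib_right by (rule sum.swap)
  finally show ?thesis unfolding sum_reflected irr_coeff_def by (simp add: sum.distrib distrib_right)
qed

lemma irr_coeffs_eq:
  assumes \<chi>: "extremal_trace loop \<gamma> \<chi>" and lam: "irr_coeffs l loop \<chi> lam"
    and n: "\<not> (l = 2 \<and> n = 0)" and i: "i \<in> irr_labels l n"
  shows "lam n i = irr_coeff l \<gamma> n i"
proof -
  have "(\<Sum>i\<in>irr_labels l n. (lam n i - irr_coeff l \<gamma> n i) * irr_trace loop n i X) = 0"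
    if X: "X \<in> carrier (TL loop n)" for X
  proof -
    have "(\<Sum>i\<in>irr_labels l n. lam n i * irr_trace loop n i X) = \<chi> (tl_incl loop X)"
      using lam n X unfolding irr_coeffs_def by simp
    also have "\<dots> = (\<Sum>i\<in>irr_labels l n. irr_coeff l \<gamma> n i * irr_trace loop n i X)"
      using \<chi> X std_expansion_to_irr_expansion[OF n X] unfolding extremal_trace_def by simp
    finally show ?thesis by (simp add: left_diff_distrib sum_subtractf)
  qed
  from irr_trace_independent[OF this i] show ?thesis by simp
qed

lemma irr_coeffs_exist:
  assumes "extremal_trace loop \<gamma> \<chi>"
  shows "irr_coeffs l loop \<chi> (\<lambda>n i. if i \<in> irr_labels l n then irr_coeff l \<gamma> n i else 0)"
  using assms std_expansion_to_irr_expansion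
  unfolding irr_coeffs_def extremal_trace_def by (auto simp: irr_labels_def)

end

theorem proposition6p4:
  fixes q \<gamma> :: complex and \<delta> :: real and l :: nat
    and \<chi> :: "(word \<Rightarrow>\<^sub>0 complex) set \<Rightarrow> complex"
  assumes "q \<noteq> 0"
    and "l \<ge> 2" and "q ^ (2 * l) = 1" and "\<forall>m. 0 < m \<and> m < l \<longrightarrow> q ^ (2 * m) \<noteq> 1"
    and "complex_of_real \<delta> = q + inverse q" and "\<delta> \<ge> 0"
    and "extremal_trace (complex_of_real \<delta>) \<gamma> \<chi>"
  shows "(\<exists>lam. irr_coeffs l (complex_of_real \<delta>) \<chi> lam) \<and>
    (\<forall>lam. irr_coeffs l (complex_of_real \<delta>) \<chi> lam \<longrightarrow>
       lam 0 0 = (if l = 2 then 0 else 1) \<and>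
       lam 1 0 = 1 \<and>
       (\<forall>n i. i \<le> n div 2 \<longrightarrow> lam n i = \<gamma> ^ i * lam (n - 2 * i) 0) \<and>
       (\<forall>n\<ge>1. lam n 0 =
          (if l dvd n + 1 then ext_coeff0 \<gamma> (int n)
           else ext_coeff0 \<gamma> (int n)
             + \<gamma> ^ ((n + 1) mod l) * ext_coeff0 \<gamma> (int n - 2 * int ((n + 1) mod l)))))"
  unfolding assms(5)
proof (intro conjI allI impI)
  interpret root_of_unity q l
    using assms(1-4) by unfold_locales auto
  have \<chi>: "extremal_trace loop \<gamma> \<chi>" using assms(7) unfolding assms(5) .
  show "\<exists>lam. irr_coeffs l loop \<chi> lam" by (rule exI[of "irr_coeffs l loop \<chi>", OF irr_coeffs_exist[OF \<chi>]])
  fix lam assume lam: "irr_coeffs l loop \<chi> lam"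
  have half: "lam n i = 0" if "l = 2" "n = 2 * i" for n i
    using lam that unfolding irr_coeffs_def by (metis dvd_triv_left nonzero_mult_div_cancel_left zero_neq_numeral)
  have eq: "lam n i = irr_coeff l \<gamma> n i" if "2 * i \<le> n" "2 * i < n \<or> l \<noteq> 2" for n i
    using that by (intro irr_coeffs_eq[OF \<chi> lam]) (auto simp: irr_labels_iff)
  \<comment> \<open>For l > 2 the residue is 1, and the additional term is c at -2, which is
    zero.\<close>
  show "lam 0 0 = (if l = 2 then 0 else 1)"
    using eq[of 0 0] half[of 0 0] l_ge_2 by (auto simp: irr_coeff_def ext_coeff_def ext_coeff0_def)
  show "lam 1 0 = 1"
  proof (cases "l = 2")
    case True
    then show ?thesis using eq[of 0 1] by (simp add: irr_coeff_def ext_coeff_def ext_coeff0_def)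
  next
    case False
    \<comment> \<open>The residue is 2 and the additional term is c at -3, hence zero; for l = 2 the
      pair (1, 0) was critical.\<close>
    then show ?thesis using eq[of 0 1] l_ge_2 by (auto simp: irr_coeff_def ext_coeff_def ext_coeff0_def dvd_eq_mod_eq_0)
  qed
  show "lam n i = \<gamma> ^ i * lam (n - 2 * i) 0" if "i \<le> n div 2" for n i
  proof (cases "l = 2 \<and> n = 2 * i")
    case True
    \<comment> \<open>Here n - 2i = 0, so both sides are zero by the convention for the missing
      label.\<close>
    then show ?thesis using half[of n i] half[of 0 0] by simp
  next
    case False
    have "2 * i \<le> n" using that by auto
    then show ?thesis using False eq[of i n] eq[of 0 "n - 2 * i"] irr_coeff_shift[of i n l \<gamma>] by auto
  qed
  show "lam n 0 = (if l dvd n + 1 then ext_coeff0 \<gamma> (int n)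
      else ext_coeff0 \<gamma> (int n) + \<gamma> ^ ((n + 1) mod l) * ext_coeff0 \<gamma> (int n - 2 * int ((n + 1) mod l)))"
    if "n \<ge> 1" for n
    using eq[of 0 n] that by (simp add: irr_coeff_def ext_coeff_def)
qed

end
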